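(* Under the network hypotheses listed in the context (the moment condition, multi-scale heavy traffic, and the lowest-rate initial condition), let $Z^*=\{Z^*(t);t\ge0\}$ be the $J$-dimensional weak limit, as $r\to0$, of the scaled queue length processes of the generalized Jackson networks, $$\big\{\big(\gamma_1(r)Z_1^{(r)}(t/\gamma_1^2(r)),\dots,\gamma_J(r)Z_J^{(r)}(t/\gamma_J^2(r))\big);\ t\ge0\big\}\Longrightarrow Z^* .$$ Here $Z^*$ has mutually independent coordinate processes, and for each $j\in\mathcal J$, $Z_j^*$ is the first coordinate process of a $(J-j+1)$-dimensional semimartingale reflecting Brownian motion (SRBM) with initial state $\xi^{(j)}$, drift vector $-G^{(j)}_{[j:J],j}$, covariance matrix $(E^{(j)}\Gamma(E^{(j)})')_{[j:J],[j:J]}$ and reflection matrix $G^{(j)}_{[j:J],[j:J]}$, where $\xi^{(1)}=\xi$ and $\xi^{(j)}=\mathbf 0$ for $j>1$. Then $$Z^*(t)\Longrightarrow(\zeta_1,\dots,\zeta_J)\qquad\text{as }t\to\infty,$$ where $\zeta_1,\dots,\zeta_J$ are independent and $\zeta_j$ has an exponential distribution with mean $$m_j=\frac{E^{(j)}_{j,[1:J]}\,\Gamma\,(E^{(j)}_{j,[1:J]})'}{2\,G^{(j)}_{jj}}=\frac{(u^{(j)})'\,\Gamma\,u^{(j)}}{2(1-w_{jj})},\qquad j=1,\dots,J.$$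
   Context: $J\ge1$, $\mathcal J=\{1,\dots,J\}$; $\Longrightarrow$ denotes weak convergence (convergence in distribution) of random vectors or processes; $\delta$ is the Kronecker delta; prime denotes transpose. Network. An open generalized Jackson network has $J$ single-server stations with infinite buffers and first-come-first-serve service. The data are: external arrival rates $\alpha_j\ge0$, with $\mathcal E=\{j:\alpha_j>0\}$; i.i.d. sequences $\{T_{e,j}(i)\}_{i\ge1}$ and $\{T_{s,j}(i)\}_{i\ge1}$ with mean one, where $T_{e,j}(i)/\alpha_j$ ($j\in\mathcal E$) are the interarrival times and $T_{s,j}(i)/\mu_j$ the service times at station $j$, $\mu_j>0$ being the service rate; i.i.d. routing vectors $\phi_j(i)$, equal to the $k$th unit vector with probability $P_{jk}$ (job goes to station $k$) and to $\mathbf 0$ with probability $1-\sum_kP_{jk}$ (job leaves), with $I-P$ invertible; and initial queue lengths $Z_j(0)\ge0$. The sequences $\{T_{e,j}(i)\}_i$, $\{T_{s,j}(i)\}_i$, $\{\phi_j(i)\}_i$, $Z_j(0)$, $j\in\mathcal J$, are mutually independent. $\lambda$ is the solution of $\lambda_j=\alpha_j+\sum_i\lambda_iP_{ij}$, and $c_{e,j}^2=\mathrm{Var}(T_{e,j}(1))$, $c_{s,j}^2=\mathrm{Var}(T_{s,j}(1))$. For a family of such networks indexed by $r\in(0,1)$, only the initial queue lengths $Z_j^{(r)}(0)$ and service rates $\mu_j^{(r)}$ depend on $r$; $Z^{(r)}$ is the queue length process of the $r$th network. Hypotheses. (Moment condition) For some $\varepsilon\in(0,1)$, $\mathbb E[T_{e,j}(1)^{2+\varepsilon}]<\infty$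 for $j\in\mathcal E$ and $\mathbb E[T_{s,j}(1)^{2+\varepsilon}]<\infty$ for $j\in\mathcal J$. (Multi-scale heavy traffic) $\mu_j^{(r)}=\lambda_j+\gamma_j(r)$ for all $j$, where $\gamma_1,\dots,\gamma_J$ are strictly increasing functions on $(0,1)$ with $\gamma_j(r)\to0$, $\gamma_j(r)/\gamma_i(r)\to0$ for $i<j$, and $\gamma_1(r)^{(2-\varepsilon)/(2+\varepsilon)}\sqrt{\log\log(1/\gamma_1(r))}\,\log\log(1/\gamma_J(r))\to0$ as $r\to0$. (Lowest-rate initial condition) There is an $\mathbb R_+^J$-valued random vector $\xi$ with $(\gamma_1(r)Z_1^{(r)}(0),\dots,\gamma_1(r)Z_J^{(r)}(0))\Longrightarrow\xi$ as $r\to0$. Covariance. $\Gamma$ is the matrix $$\Gamma_{jk}=\alpha_jc_{e,j}^2\delta_{jk}+\sum_{i\in\mathcal J}\lambda_i\big[P_{ij}(\delta_{jk}-P_{ik})+c_{s,i}^2(\delta_{ij}-P_{ij})(\delta_{ik}-P_{ik})\big]$$ (the first term being $0$ if $\alpha_j=0$), and it is assumed positive definite. Matrices. $M_{A,B}$ is the submatrix of $M$ with rows in $A$ and columns in $B$; $[\ell:k]=\{\ell,\dots,k\}$; $M_{A,k}=M_{A,\{k\}}$, $M_{k,B}=M_{\{k\},B}$, $M_k=M_{[1:k],[1:k]}$; terms with empty index sets are absent. $R=I-P'$. For $k=2,\dots,J$ put $A^{(k)}=R_{[1:k-1],[1:k-1]}$ (invertible), $C^{(k)}=R_{[k:J],[1:k-1]}$,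 $$E^{(k)}=\begin{bmatrix}I_{k-1}&0\\-C^{(k)}(A^{(k)})^{-1}&I_{J-k+1}\end{bmatrix},\qquad G^{(k)}=E^{(k)}R,$$ and $E^{(1)}=I$, $G^{(1)}=R$. For $i\le j$, $w_{ij}$ is defined by $(w_{1j},\dots,w_{j-1,j})=-R_{j,[1:j-1]}R_{j-1}^{-1}$ and $w_{jj}=1-R_{jj}+R_{j,[1:j-1]}R_{j-1}^{-1}R_{[1:j-1],j}$; $u^{(j)}$ is the column vector with entries $(w_{1j},\dots,w_{j-1,j},1,0,\dots,0)$. SRBM. An $\mathcal M$-matrix is a matrix $sI-B$ with $s>0$, $B\ge0$ entrywise and spectral radius of $B$ less than $s$ ($I-P'$ and the $G^{(k)}_{[k:J],[k:J]}$ are $\mathcal M$-matrices). For an $\mathcal M$-matrix $Q\in\mathbb R^{d\times d}$ and a càdlàg path $x$ in $\mathbb R^d$ with $x(0)\in\mathbb R_+^d$, there is a unique pair $(z,y)$ of càdlàg $\mathbb R_+^d$-valued paths with $z=x+Qy$, each $y_j$ nondecreasing with $y_j(0)=0$, and $\int_0^\infty z_j\,dy_j=0$ for each $j$; write $z=\Phi(x;Q)$. An SRBM with initial state $x_0$, drift vector $\theta$, positive definite covariance matrix $\Sigma$ and reflection matrix $Q$ is $\Phi(X;Q)$ with $X(t)=x_0+\theta t+LW(t)$, where $L$ is the lower triangular Cholesky factor, $LL'=\Sigma$, and $W$ is a $d$-dimensional standard Brownian motion independent of $x_0$. *)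

theory Defs
  imports "HOL-Probability.Probability"
begin

section \<open>Matrices over finite sets of indices\<close>

text \<open>The dimension \<open>J - j + 1\<close> varies inside the statement, so vectors and matrices are functions on
  \<open>nat\<close>, always used together with a finite index set \<open>K\<close>; entries outside \<open>K\<close> are irrelevant. Stations
  are numbered \<open>1, \<dots>, J\<close>, and the block of \<open>A\<close> with rows and columns in \<open>[j:J]\<close> is \<open>A\<close> used with
  \<open>K = {j..J}\<close>, without renumbering.\<close>

definition kron :: "nat \<Rightarrow> nat \<Rightarrow> real" where
  "kron i k = (if i = k then 1 else 0)"

definition mat_mult_on ::
    "nat set \<Rightarrow> (nat \<Rightarrow> nat \<Rightarrow> real) \<Rightarrow> (nat \<Rightarrow> nat \<Rightarrow> real) \<Rightarrow> nat \<Rightarrow> nat \<Rightarrow> real" where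
  "mat_mult_on K A B i k = (\<Sum>l\<in>K. A i l * B l k)"

definition is_inverse_on ::
    "nat set \<Rightarrow> (nat \<Rightarrow> nat \<Rightarrow> real) \<Rightarrow> (nat \<Rightarrow> nat \<Rightarrow> real) \<Rightarrow> bool" where
  "is_inverse_on K A B \<longleftrightarrow>
     (\<forall>i\<in>K. \<forall>k\<in>K. mat_mult_on K A B i k = kron i k \<and> mat_mult_on K B A i k = kron i k)"

definition invertible_on :: "nat set \<Rightarrow> (nat \<Rightarrow> nat \<Rightarrow> real) \<Rightarrow> bool" where
  "invertible_on K A \<longleftrightarrow> (\<exists>B. is_inverse_on K A B)"

text \<open>The entries with indices in \<open>K\<close> do not depend on the choice.\<close>

definition inverse_on :: "nat set \<Rightarrow> (nat \<Rightarrow> nat \<Rightarrow> real) \<Rightarrow> nat \<Rightarrow> nat \<Rightarrow> real" where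
  "inverse_on K A = (SOME B. is_inverse_on K A B)"

definition quad_form_on :: "nat set \<Rightarrow> (nat \<Rightarrow> nat \<Rightarrow> real) \<Rightarrow> (nat \<Rightarrow> real) \<Rightarrow> real" where
  "quad_form_on K A v = (\<Sum>i\<in>K. \<Sum>k\<in>K. v i * A i k * v k)"

definition positive_definite_on :: "nat set \<Rightarrow> (nat \<Rightarrow> nat \<Rightarrow> real) \<Rightarrow> bool" where
  "positive_definite_on K A \<longleftrightarrow>
     (\<forall>i\<in>K. \<forall>k\<in>K. A i k = A k i) \<and> (\<forall>v. (\<exists>i\<in>K. v i \<noteq> 0) \<longrightarrow> 0 < quad_form_on K A v)"

definition is_cholesky_factor_on ::
    "nat set \<Rightarrow> (nat \<Rightarrow> nat \<Rightarrow> real) \<Rightarrow> (nat \<Rightarrow> nat \<Rightarrow> real) \<Rightarrow> bool" where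
  "is_cholesky_factor_on K A L \<longleftrightarrow>
     (\<forall>i\<in>K. 0 < L i i) \<and>
     (\<forall>i\<in>K. \<forall>k\<in>K. i < k \<longrightarrow> L i k = 0) \<and>
     (\<forall>i\<in>K. \<forall>k\<in>K. (\<Sum>l\<in>K. L i l * L k l) = A i k)"

definition spectral_radius_on :: "nat set \<Rightarrow> (nat \<Rightarrow> nat \<Rightarrow> real) \<Rightarrow> real" where
  "spectral_radius_on K B =
     Max {cmod c | c. \<exists>v :: nat \<Rightarrow> complex. (\<exists>i\<in>K. v i \<noteq> 0) \<and>
            (\<forall>i\<in>K. (\<Sum>k\<in>K. complex_of_real (B i k) * v k) = c * v i)}"

definition M_matrix_on :: "nat set \<Rightarrow> (nat \<Rightarrow> nat \<Rightarrow> real) \<Rightarrow> bool" where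
  "M_matrix_on K Q \<longleftrightarrow>
     (\<exists>s B. 0 < s \<and> (\<forall>i\<in>K. \<forall>k\<in>K. 0 \<le> B i k) \<and> spectral_radius_on K B < s \<and>
            (\<forall>i\<in>K. \<forall>k\<in>K. Q i k = s * kron i k - B i k))"


section \<open>Weak convergence\<close>

text \<open>Weak convergence of random elements of a topological space. The functions \<open>X i\<close> and \<open>Y\<close> are
  meant to be measurable for the Borel sigma-algebra of \<open>T\<close>.\<close>

definition converges_in_distribution ::
    "'x topology \<Rightarrow> 'i filter \<Rightarrow> 'a measure \<Rightarrow> ('i \<Rightarrow> 'a \<Rightarrow> 'x) \<Rightarrow> 'b measure \<Rightarrow> ('b \<Rightarrow> 'x) \<Rightarrow> bool" where
  "converges_in_distribution T F M X N Y \<longleftrightarrow>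
     (\<forall>f. continuous_map T euclideanreal f \<and> bounded (f ` topspace T) \<longrightarrow>
        ((\<lambda>i. \<integral>\<omega>. f (X i \<omega>) \<partial>M) \<longlongrightarrow> (\<integral>\<omega>. f (Y \<omega>) \<partial>N)) F)"

definition euclidean_on :: "nat set \<Rightarrow> (nat \<Rightarrow> real) topology" where
  "euclidean_on K = product_topology (\<lambda>_. euclideanreal) K"

definition borel_on :: "nat set \<Rightarrow> (nat \<Rightarrow> real) measure" where
  "borel_on K = Pi\<^sub>M K (\<lambda>_. borel)"

definition cadlag_paths :: "nat set \<Rightarrow> (real \<Rightarrow> nat \<Rightarrow> real) set" where
  "cadlag_paths K = {x. \<forall>i\<in>K. \<forall>t\<ge>0.
      ((\<lambda>s. x s i) \<longlongrightarrow> x t i) (at_right t) \<and>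
      (0 < t \<longrightarrow> (\<exists>l. ((\<lambda>s. x s i) \<longlongrightarrow> l) (at_left t)))}"

text \<open>Convergence in the Skorokhod \<open>J\<^sub>1\<close> topology on \<open>[0,\<infinity>)\<close>: an increasing bijection of
  \<open>[0,\<infinity>)\<close> is a continuous time change. Values of paths at negative times or outside \<open>K\<close> play no role.\<close>

definition skorokhod_converges ::
    "nat set \<Rightarrow> (nat \<Rightarrow> real \<Rightarrow> nat \<Rightarrow> real) \<Rightarrow> (real \<Rightarrow> nat \<Rightarrow> real) \<Rightarrow> bool" where
  "skorokhod_converges K xs x \<longleftrightarrow>
     (\<exists>\<tau> :: nat \<Rightarrow> real \<Rightarrow> real.
        (\<forall>n. strict_mono_on {0..} (\<tau> n) \<and> bij_betw (\<tau> n) {0..} {0..}) \<and>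
        uniform_limit {0..} \<tau> (\<lambda>t. t) sequentially \<and>
        (\<forall>T\<ge>0. \<forall>i\<in>K.
           uniform_limit {0..T} (\<lambda>n t. xs n (\<tau> n t) i) (\<lambda>t. x t i) sequentially))"

definition skorokhod_open :: "nat set \<Rightarrow> (real \<Rightarrow> nat \<Rightarrow> real) set \<Rightarrow> bool" where
  "skorokhod_open K U \<longleftrightarrow>
     U \<subseteq> cadlag_paths K \<and>
     (\<forall>x\<in>U. \<forall>xs. range xs \<subseteq> cadlag_paths K \<and> skorokhod_converges K xs x \<longrightarrow>
        (\<forall>\<^sub>F n in sequentially. xs n \<in> U))"

text \<open>The \<open>J\<^sub>1\<close> topology is metrizable, hence determined by its convergent sequences.\<close>

definition skorokhod_topology :: "nat set \<Rightarrow> (real \<Rightarrow> nat \<Rightarrow> real) topology" where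
  "skorokhod_topology K = topology (skorokhod_open K)"

lemma istopology_skorokhod_open: "istopology (skorokhod_open K)"
  unfolding istopology_def
proof (intro conjI allI impI)
  fix U V assume "skorokhod_open K U" "skorokhod_open K V"
  then show "skorokhod_open K (U \<inter> V)"
    unfolding skorokhod_open_def by (auto intro!: eventually_conj)
next
  fix \<K> assume *: "\<forall>U\<in>\<K>. skorokhod_open K U"
  show "skorokhod_open K (\<Union>\<K>)"
    unfolding skorokhod_open_def
  proof (intro conjI ballI allI impI)
    show "\<Union>\<K> \<subseteq> cadlag_paths K"
      using * unfolding skorokhod_open_def by blast
  next
    fix x xs assume x: "x \<in> \<Union>\<K>"
      and xs: "range xs \<subseteq> cadlag_paths K \<and> skorokhod_converges K xs x"
    from x obtain U where U: "U \<in> \<K>" "x \<in> U" by blast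
    with * xs have "\<forall>\<^sub>F n in sequentially. xs n \<in> U"
      unfolding skorokhod_open_def by blast
    then show "\<forall>\<^sub>F n in sequentially. xs n \<in> \<Union>\<K>"
      by eventually_elim (use U in blast)
  qed
qed

lemma openin_skorokhod_topology: "openin (skorokhod_topology K) = skorokhod_open K"
  unfolding skorokhod_topology_def by (rule topology_inverse'[OF istopology_skorokhod_open])

lemma topspace_skorokhod_topology: "topspace (skorokhod_topology K) = cadlag_paths K"
proof
  show "topspace (skorokhod_topology K) \<subseteq> cadlag_paths K"
    using openin_topspace[of "skorokhod_topology K"]
    unfolding openin_skorokhod_topology skorokhod_open_def by blast
next
  have "skorokhod_open K (cadlag_paths K)"
    unfolding skorokhod_open_def by (simp add: image_subset_iff)
  then show "cadlag_paths K \<subseteq> topspace (skorokhod_topology K)"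
    using openin_subset[of "skorokhod_topology K"] unfolding openin_skorokhod_topology by blast
qed


section \<open>Stochastic processes\<close>

abbreviation path_space :: "(real \<Rightarrow> real) measure" where
  "path_space \<equiv> Pi\<^sub>M {0..} (\<lambda>_. borel)"

definition coord_path :: "(real \<Rightarrow> 'a \<Rightarrow> nat \<Rightarrow> real) \<Rightarrow> nat \<Rightarrow> 'a \<Rightarrow> real \<Rightarrow> real" where
  "coord_path Z j \<omega> = (\<lambda>t\<in>{0..}. Z t \<omega> j)"

text \<open>On cadlag paths the sigma-algebra of the time evaluations is the Borel sigma-algebra of the
  \<open>J\<^sub>1\<close> topology.\<close>

definition cadlag_process :: "'a measure \<Rightarrow> nat set \<Rightarrow> (real \<Rightarrow> 'a \<Rightarrow> nat \<Rightarrow> real) \<Rightarrow> bool" where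
  "cadlag_process M K Z \<longleftrightarrow>
     (\<forall>t\<ge>0. \<forall>j\<in>K. (\<lambda>\<omega>. Z t \<omega> j) \<in> borel_measurable M) \<and>
     (\<forall>\<omega>\<in>space M. (\<lambda>t. Z t \<omega>) \<in> cadlag_paths K)"

text \<open>The sigma-algebra on the sample space generated by \<open>X\<close>.\<close>

definition generated_events :: "'a measure \<Rightarrow> 'b measure \<Rightarrow> ('a \<Rightarrow> 'b) \<Rightarrow> 'a set set" where
  "generated_events M N X = sets (vimage_algebra (space M) X N)"

definition standard_brownian_motion ::
    "'a measure \<Rightarrow> nat set \<Rightarrow> (real \<Rightarrow> 'a \<Rightarrow> nat \<Rightarrow> real) \<Rightarrow> bool" where
  "standard_brownian_motion M K W \<longleftrightarrow>
     prob_space M \<and>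
     (\<forall>t\<ge>0. \<forall>i\<in>K. (\<lambda>\<omega>. W t \<omega> i) \<in> borel_measurable M) \<and>
     (AE \<omega> in M. \<forall>i\<in>K. W 0 \<omega> i = 0 \<and> continuous_on {0..} (\<lambda>t. W t \<omega> i)) \<and>
     (\<forall>i\<in>K. \<forall>s t. 0 \<le> s \<and> s < t \<longrightarrow>
        distributed M lborel (\<lambda>\<omega>. W t \<omega> i - W s \<omega> i) (normal_density 0 (sqrt (t - s)))) \<and>
     (\<forall>i\<in>K. \<forall>a :: nat \<Rightarrow> real. 0 \<le> a 0 \<and> strict_mono a \<longrightarrow>
        prob_space.indep_vars M (\<lambda>_. borel) (\<lambda>n \<omega>. W (a (Suc n)) \<omega> i - W (a n) \<omega> i) UNIV) \<and>
     prob_space.indep_vars M (\<lambda>_. path_space) (coord_path W) K"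


section \<open>Skorokhod reflection and semimartingale reflecting Brownian motion\<close>

text \<open>\<open>z = \<Phi>(x; Q)\<close> as a relation. The path \<open>y\<close> is constant on negative times in the Stieltjes measure.\<close>

definition is_reflection_of ::
    "nat set \<Rightarrow> (nat \<Rightarrow> nat \<Rightarrow> real) \<Rightarrow> (real \<Rightarrow> nat \<Rightarrow> real) \<Rightarrow> (real \<Rightarrow> nat \<Rightarrow> real) \<Rightarrow> bool" where
  "is_reflection_of K Q x z \<longleftrightarrow>
     x \<in> cadlag_paths K \<and> (\<forall>i\<in>K. 0 \<le> x 0 i) \<and>
     (\<exists>y. z \<in> cadlag_paths K \<and> y \<in> cadlag_paths K \<and>
        (\<forall>i\<in>K. \<forall>t\<ge>0. 0 \<le> z t i \<and> 0 \<le> y t i) \<and>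
        (\<forall>i\<in>K. \<forall>t\<ge>0. z t i = x t i + (\<Sum>k\<in>K. Q i k * y t k)) \<and>
        (\<forall>i\<in>K. mono_on {0..} (\<lambda>t. y t i) \<and> y 0 i = 0) \<and>
        (\<forall>i\<in>K. (\<integral>\<^sup>+t\<in>{0..}. ennreal (z t i) \<partial>interval_measure (\<lambda>t. y (max 0 t) i)) = 0))"

text \<open>\<open>Z\<close> is an SRBM on \<open>M\<close> with initial distribution \<open>\<nu>\<close>, drift \<open>\<theta>\<close>, covariance \<open>\<Sigma>\<close> and reflection
  matrix \<open>Q\<close>, with coordinates in \<open>K\<close>.\<close>

definition is_SRBM ::
    "'a measure \<Rightarrow> nat set \<Rightarrow> (nat \<Rightarrow> real) measure \<Rightarrow> (nat \<Rightarrow> real) \<Rightarrow> (nat \<Rightarrow> nat \<Rightarrow> real) \<Rightarrow>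
     (nat \<Rightarrow> nat \<Rightarrow> real) \<Rightarrow> (real \<Rightarrow> 'a \<Rightarrow> nat \<Rightarrow> real) \<Rightarrow> bool" where
  "is_SRBM M K \<nu> \<theta> \<Sigma> Q Z \<longleftrightarrow>
     prob_space M \<and> positive_definite_on K \<Sigma> \<and> M_matrix_on K Q \<and>
     (\<forall>t\<ge>0. \<forall>i\<in>K. (\<lambda>\<omega>. Z t \<omega> i) \<in> borel_measurable M) \<and>
     (\<exists>x0 W L.
        x0 \<in> measurable M (borel_on K) \<and> distr M (borel_on K) x0 = \<nu> \<and>
        is_cholesky_factor_on K \<Sigma> L \<and>
        standard_brownian_motion M K W \<and>
        prob_space.indep_set M
          (generated_events M (borel_on K) x0)
          (generated_events M (Pi\<^sub>M K (\<lambda>_. path_space)) (\<lambda>\<omega>. \<lambda>i\<in>K. coord_path W i \<omega>)) \<and>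
        (AE \<omega> in M. is_reflection_of K Q
           (\<lambda>t i. x0 \<omega> i + \<theta> i * t + (\<Sum>k\<in>K. L i k * W t \<omega> k))
           (\<lambda>t. Z t \<omega>)))"


section \<open>Generalized Jackson networks\<close>

subsection \<open>Sample path dynamics\<close>

text \<open>The arguments \<open>te\<close>, \<open>ts\<close>, \<open>rt\<close>, \<open>z0\<close> are realizations of the interarrival variables, service
  variables, routing vectors and initial queue lengths. The sequences are indexed from 1.\<close>

definition external_arrivals :: "(nat \<Rightarrow> real) \<Rightarrow> (nat \<Rightarrow> nat \<Rightarrow> real) \<Rightarrow> nat \<Rightarrow> real \<Rightarrow> nat" where
  "external_arrivals \<alpha> te j t =
     (if 0 < \<alpha> j then card {n. 1 \<le> n \<and> (\<Sum>i=1..n. te j i / \<alpha> j) \<le> t} else 0)"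

text \<open>In the following, \<open>d i n\<close> is the time of the \<open>n\<close>-th service completion at station \<open>i\<close>.\<close>

definition departures :: "(nat \<Rightarrow> nat \<Rightarrow> ennreal) \<Rightarrow> nat \<Rightarrow> real \<Rightarrow> nat set" where
  "departures d i t = {n. 1 \<le> n \<and> d i n \<le> ennreal t}"

definition transfers ::
    "(nat \<Rightarrow> nat \<Rightarrow> nat \<Rightarrow> real) \<Rightarrow> (nat \<Rightarrow> nat \<Rightarrow> ennreal) \<Rightarrow> nat \<Rightarrow> nat \<Rightarrow> real \<Rightarrow> nat set" where
  "transfers rt d i j t = {n \<in> departures d i t. rt i n j = 1}"

text \<open>The time of the \<open>n\<close>-th arrival at station \<open>j\<close>, where the initial jobs are counted first, as
  arrivals at time 0. Counting with \<^term>\<open>count_space UNIV\<close> allows for infinite sets.\<close>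

definition arrival_time ::
    "nat \<Rightarrow> (nat \<Rightarrow> real) \<Rightarrow> (nat \<Rightarrow> nat \<Rightarrow> real) \<Rightarrow> (nat \<Rightarrow> nat \<Rightarrow> nat \<Rightarrow> real) \<Rightarrow> (nat \<Rightarrow> nat) \<Rightarrow>
     (nat \<Rightarrow> nat \<Rightarrow> ennreal) \<Rightarrow> nat \<Rightarrow> nat \<Rightarrow> ennreal" where
  "arrival_time J \<alpha> te rt z0 d j n =
     Inf {ennreal t | t. 0 \<le> t \<and>
       of_nat n \<le> of_nat (z0 j + external_arrivals \<alpha> te j t) +
                  (\<Sum>i=1..J. emeasure (count_space UNIV) (transfers rt d i j t))}"

text \<open>First-come-first-serve: the \<open>n\<close>-th job to arrive is the \<open>n\<close>-th to be served, and its service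
  starts when it has arrived and its predecessor has left. This is a monotone fixed point equation
  for the service completion times. If all service times are positive, its solution is unique up to
  null sets. If service times may vanish, a routing cycle admits further solutions in which jobs
  arrive as a consequence of their own departure; they have smaller completion times than the
  actual ones, which therefore form the greatest solution.\<close>

definition completion_times ::
    "nat \<Rightarrow> (nat \<Rightarrow> real) \<Rightarrow> (nat \<Rightarrow> real) \<Rightarrow> (nat \<Rightarrow> nat \<Rightarrow> real) \<Rightarrow> (nat \<Rightarrow> nat \<Rightarrow> real) \<Rightarrow>
     (nat \<Rightarrow> nat \<Rightarrow> nat \<Rightarrow> real) \<Rightarrow> (nat \<Rightarrow> nat) \<Rightarrow> nat \<Rightarrow> nat \<Rightarrow> ennreal" where
  "completion_times J \<alpha> \<mu> te ts rt z0 =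
     gfp (\<lambda>d j n. if n = 0 then 0
            else max (arrival_time J \<alpha> te rt z0 d j n) (d j (n - 1)) + ennreal (ts j n / \<mu> j))"

definition queue_length ::
    "nat \<Rightarrow> (nat \<Rightarrow> real) \<Rightarrow> (nat \<Rightarrow> real) \<Rightarrow> (nat \<Rightarrow> nat \<Rightarrow> real) \<Rightarrow> (nat \<Rightarrow> nat \<Rightarrow> real) \<Rightarrow>
     (nat \<Rightarrow> nat \<Rightarrow> nat \<Rightarrow> real) \<Rightarrow> (nat \<Rightarrow> nat) \<Rightarrow> nat \<Rightarrow> real \<Rightarrow> real" where
  "queue_length J \<alpha> \<mu> te ts rt z0 j t =
     (let d = completion_times J \<alpha> \<mu> te ts rt z0 in
        real (z0 j) + real (external_arrivals \<alpha> te j t)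
        + (\<Sum>i=1..J. real (card (transfers rt d i j t)))
        - real (card (departures d j t)))"

text \<open>For the gfp above to be a fixed point the operator must be monotone.\<close>

lemma mono_completion_operator:
  "mono (\<lambda>d j n. if n = 0 then 0
      else max (arrival_time J \<alpha> te rt z0 d j n) (d j (n - 1)) + ennreal (ts j n / \<mu> j))"
proof (rule monoI, rule le_funI, rule le_funI)
  fix d d' :: "nat \<Rightarrow> nat \<Rightarrow> ennreal" and j n
  assume le: "d \<le> d'"
  then have le': "d i m \<le> d' i m" for i m by (simp add: le_fun_def)
  have sub: "transfers rt d' i j t \<subseteq> transfers rt d i j t" for i t
    unfolding transfers_def departures_def using le' order_trans by blast
  have "(\<Sum>i=1..J. emeasure (count_space UNIV) (transfers rt d' i j t))
      \<le> (\<Sum>i=1..J. emeasure (count_space UNIV) (transfers rt d i j t))" for t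
    by (intro sum_mono emeasure_mono sub) auto
  then have "of_nat (z0 j + external_arrivals \<alpha> te j t) +
        (\<Sum>i=1..J. emeasure (count_space UNIV) (transfers rt d' i j t))
      \<le> of_nat (z0 j + external_arrivals \<alpha> te j t) +
        (\<Sum>i=1..J. emeasure (count_space UNIV) (transfers rt d i j t))" for t
    by (rule add_left_mono)
  then have "arrival_time J \<alpha> te rt z0 d j n \<le> arrival_time J \<alpha> te rt z0 d' j n"
    unfolding arrival_time_def
    by (intro Inf_superset_mono) (blast intro: order_trans)
  then show "(if n = 0 then 0
      else max (arrival_time J \<alpha> te rt z0 d j n) (d j (n - 1)) + ennreal (ts j n / \<mu> j))
    \<le> (if n = 0 then 0
      else max (arrival_time J \<alpha> te rt z0 d' j n) (d' j (n - 1)) + ennreal (ts j n / \<mu> j))"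
    using max.mono[OF _ le'[of j "n - 1"]] by (auto intro: add_right_mono)
qed

subsection \<open>Stochastic primitives\<close>

definition iid :: "'a measure \<Rightarrow> 'b measure \<Rightarrow> (nat \<Rightarrow> 'a \<Rightarrow> 'b) \<Rightarrow> bool" where
  "iid M N X \<longleftrightarrow>
     prob_space.indep_vars M (\<lambda>_. N) X {1..} \<and> (\<forall>i\<ge>1. distr M N (X i) = distr M N (X 1))"

datatype primitive = Interarrival nat | Service nat | Routing nat | Initial nat

fun primitive_events ::
    "'a measure \<Rightarrow> nat \<Rightarrow> (nat \<Rightarrow> nat \<Rightarrow> 'a \<Rightarrow> real) \<Rightarrow> (nat \<Rightarrow> nat \<Rightarrow> 'a \<Rightarrow> real) \<Rightarrow>
     (nat \<Rightarrow> nat \<Rightarrow> 'a \<Rightarrow> nat \<Rightarrow> real) \<Rightarrow> (nat \<Rightarrow> 'a \<Rightarrow> nat) \<Rightarrow> primitive \<Rightarrow> 'a set set" where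
  "primitive_events M J Te Ts \<phi> Z0 (Interarrival j) =
     generated_events M (Pi\<^sub>M {1..} (\<lambda>_. borel)) (\<lambda>\<omega>. \<lambda>i\<in>{1..}. Te j i \<omega>)"
| "primitive_events M J Te Ts \<phi> Z0 (Service j) =
     generated_events M (Pi\<^sub>M {1..} (\<lambda>_. borel)) (\<lambda>\<omega>. \<lambda>i\<in>{1..}. Ts j i \<omega>)"
| "primitive_events M J Te Ts \<phi> Z0 (Routing j) =
     generated_events M (Pi\<^sub>M {1..} (\<lambda>_. borel_on {1..J})) (\<lambda>\<omega>. \<lambda>i\<in>{1..}. \<lambda>k\<in>{1..J}. \<phi> j i \<omega> k)"
| "primitive_events M J Te Ts \<phi> Z0 (Initial j) = generated_events M (count_space UNIV) (Z0 j)"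

text \<open>The interarrival variables are only relevant for stations with \<open>\<alpha> j > 0\<close>, and nothing is required
  of them at other stations.\<close>

locale generalized_jackson_network = prob_space M
  for M :: "'a measure" +
  fixes J :: nat
    and \<alpha> :: "nat \<Rightarrow> real"
    and P :: "nat \<Rightarrow> nat \<Rightarrow> real"
    and \<mu> :: "nat \<Rightarrow> real"
    and Te Ts :: "nat \<Rightarrow> nat \<Rightarrow> 'a \<Rightarrow> real"
    and \<phi> :: "nat \<Rightarrow> nat \<Rightarrow> 'a \<Rightarrow> nat \<Rightarrow> real"
    and Z0 :: "nat \<Rightarrow> 'a \<Rightarrow> nat"
  assumes J_pos: "1 \<le> J"
    and arrival_rate_nonneg: "\<And>j. j \<in> {1..J} \<Longrightarrow> 0 \<le> \<alpha> j"
    and service_rate_pos: "\<And>j. j \<in> {1..J} \<Longrightarrow> 0 < \<mu> j"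
    and interarrival_iid: "\<And>j. j \<in> {1..J} \<Longrightarrow> 0 < \<alpha> j \<Longrightarrow> iid M borel (Te j)"
    and interarrival_nonneg:
      "\<And>j i. j \<in> {1..J} \<Longrightarrow> 0 < \<alpha> j \<Longrightarrow> 1 \<le> i \<Longrightarrow> AE \<omega> in M. 0 \<le> Te j i \<omega>"
    and interarrival_mean:
      "\<And>j. j \<in> {1..J} \<Longrightarrow> 0 < \<alpha> j \<Longrightarrow> integrable M (Te j 1) \<and> expectation (Te j 1) = 1"
    and service_iid: "\<And>j. j \<in> {1..J} \<Longrightarrow> iid M borel (Ts j)"
    and service_nonneg: "\<And>j i. j \<in> {1..J} \<Longrightarrow> 1 \<le> i \<Longrightarrow> AE \<omega> in M. 0 \<le> Ts j i \<omega>"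
    and service_mean:
      "\<And>j. j \<in> {1..J} \<Longrightarrow> integrable M (Ts j 1) \<and> expectation (Ts j 1) = 1"
    and routing_iid:
      "\<And>j. j \<in> {1..J} \<Longrightarrow> iid M (borel_on {1..J}) (\<lambda>i \<omega>. \<lambda>k\<in>{1..J}. \<phi> j i \<omega> k)"
    and routing_prob:
      "\<And>j k. j \<in> {1..J} \<Longrightarrow> k \<in> {1..J} \<Longrightarrow>
         prob {\<omega> \<in> space M. \<forall>l\<in>{1..J}. \<phi> j 1 \<omega> l = kron k l} = P j k"
    and exit_prob:
      "\<And>j. j \<in> {1..J} \<Longrightarrow>
         prob {\<omega> \<in> space M. \<forall>l\<in>{1..J}. \<phi> j 1 \<omega> l = 0} = 1 - (\<Sum>k=1..J. P j k)"
    and invertible: "invertible_on {1..J} (\<lambda>i k. kron i k - P i k)"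
    and initial_measurable: "\<And>j. j \<in> {1..J} \<Longrightarrow> Z0 j \<in> measurable M (count_space UNIV)"
    and primitives_indep:
      "indep_sets (primitive_events M J Te Ts \<phi> Z0)
         (Interarrival ` {j \<in> {1..J}. 0 < \<alpha> j} \<union> Service ` {1..J} \<union> Routing ` {1..J} \<union> Initial ` {1..J})"

definition is_queue_length_process ::
    "'a measure \<Rightarrow> nat \<Rightarrow> (nat \<Rightarrow> real) \<Rightarrow> (nat \<Rightarrow> real) \<Rightarrow> (nat \<Rightarrow> nat \<Rightarrow> 'a \<Rightarrow> real) \<Rightarrow>
     (nat \<Rightarrow> nat \<Rightarrow> 'a \<Rightarrow> real) \<Rightarrow> (nat \<Rightarrow> nat \<Rightarrow> 'a \<Rightarrow> nat \<Rightarrow> real) \<Rightarrow> (nat \<Rightarrow> 'a \<Rightarrow> nat) \<Rightarrow>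
     (real \<Rightarrow> 'a \<Rightarrow> nat \<Rightarrow> real) \<Rightarrow> bool" where
  "is_queue_length_process M J \<alpha> \<mu> Te Ts \<phi> Z0 Z \<longleftrightarrow>
     cadlag_process M {1..J} Z \<and>
     (AE \<omega> in M. \<forall>j\<in>{1..J}. \<forall>t\<ge>0.
        Z t \<omega> j = queue_length J \<alpha> \<mu> (\<lambda>j i. Te j i \<omega>) (\<lambda>j i. Ts j i \<omega>) (\<lambda>j i. \<phi> j i \<omega>)
                    (\<lambda>j. Z0 j \<omega>) j t)"


section \<open>Multi-scale heavy traffic and the data of the limit process\<close>

definition multi_scale_heavy_traffic ::
    "nat \<Rightarrow> real \<Rightarrow> (nat \<Rightarrow> real) \<Rightarrow> (nat \<Rightarrow> real \<Rightarrow> real) \<Rightarrow> (real \<Rightarrow> nat \<Rightarrow> real) \<Rightarrow> bool" where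
  "multi_scale_heavy_traffic J \<epsilon> lam \<gamma> \<mu> \<longleftrightarrow>
     (\<forall>r\<in>{0<..<1}. \<forall>j\<in>{1..J}. \<mu> r j = lam j + \<gamma> j r) \<and>
     (\<forall>j\<in>{1..J}. strict_mono_on {0<..<1} (\<gamma> j) \<and> (\<gamma> j \<longlongrightarrow> 0) (at_right 0)) \<and>
     (\<forall>i\<in>{1..J}. \<forall>j\<in>{1..J}. i < j \<longrightarrow> ((\<lambda>r. \<gamma> j r / \<gamma> i r) \<longlongrightarrow> 0) (at_right 0)) \<and>
     ((\<lambda>r. \<gamma> 1 r powr ((2 - \<epsilon>) / (2 + \<epsilon>)) * sqrt (ln (ln (1 / \<gamma> 1 r))) * ln (ln (1 / \<gamma> J r)))
        \<longlongrightarrow> 0) (at_right 0)"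

text \<open>\<open>ce2\<close> and \<open>cs2\<close> are the variances of the interarrival and service variables.\<close>

definition network_covariance ::
    "nat \<Rightarrow> (nat \<Rightarrow> real) \<Rightarrow> (nat \<Rightarrow> real) \<Rightarrow> (nat \<Rightarrow> nat \<Rightarrow> real) \<Rightarrow> (nat \<Rightarrow> real) \<Rightarrow> (nat \<Rightarrow> real) \<Rightarrow>
     nat \<Rightarrow> nat \<Rightarrow> real" where
  "network_covariance J \<alpha> lam P ce2 cs2 j k =
     \<alpha> j * ce2 j * kron j k +
     (\<Sum>i=1..J. lam i * (P i j * (kron j k - P i k)
                        + cs2 i * (kron i j - P i j) * (kron i k - P i k)))"

definition R_mat :: "(nat \<Rightarrow> nat \<Rightarrow> real) \<Rightarrow> nat \<Rightarrow> nat \<Rightarrow> real" where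
  "R_mat P i k = kron i k - P k i"

text \<open>\<open>E\<^sup>(\<^sup>k\<^sup>)\<close>; for \<open>k = 1\<close> this is the identity.\<close>

definition E_mat :: "(nat \<Rightarrow> nat \<Rightarrow> real) \<Rightarrow> nat \<Rightarrow> nat \<Rightarrow> nat \<Rightarrow> real" where
  "E_mat P k i l =
     (if k \<le> i \<and> l < k
      then - (\<Sum>m\<in>{1..<k}. R_mat P i m * inverse_on {1..<k} (R_mat P) m l)
      else kron i l)"

definition G_mat :: "nat \<Rightarrow> (nat \<Rightarrow> nat \<Rightarrow> real) \<Rightarrow> nat \<Rightarrow> nat \<Rightarrow> nat \<Rightarrow> real" where
  "G_mat J P k = mat_mult_on {1..J} (E_mat P k) (R_mat P)"

text \<open>\<open>(E\<^sup>(\<^sup>k\<^sup>) \<Gamma> (E\<^sup>(\<^sup>k\<^sup>))')\<close>\<close>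

definition transformed_covariance ::
    "nat \<Rightarrow> (nat \<Rightarrow> nat \<Rightarrow> real) \<Rightarrow> (nat \<Rightarrow> nat \<Rightarrow> real) \<Rightarrow> nat \<Rightarrow> nat \<Rightarrow> nat \<Rightarrow> real" where
  "transformed_covariance J P \<Gamma> k =
     mat_mult_on {1..J} (mat_mult_on {1..J} (E_mat P k) \<Gamma>) (\<lambda>i l. E_mat P k l i)"

definition w_coeff :: "(nat \<Rightarrow> nat \<Rightarrow> real) \<Rightarrow> nat \<Rightarrow> nat \<Rightarrow> real" where
  "w_coeff P i j =
     (let Rinv = inverse_on {1..<j} (R_mat P) in
      if i < j then - (\<Sum>l\<in>{1..<j}. R_mat P j l * Rinv l i)
      else 1 - R_mat P j j + (\<Sum>l\<in>{1..<j}. \<Sum>m\<in>{1..<j}. R_mat P j l * Rinv l m * R_mat P m j))"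

definition u_vec :: "(nat \<Rightarrow> nat \<Rightarrow> real) \<Rightarrow> nat \<Rightarrow> nat \<Rightarrow> real" where
  "u_vec P j i = (if i < j then w_coeff P i j else if i = j then 1 else 0)"

text \<open>The distribution of \<open>\<xi>\<^sup>(\<^sup>j\<^sup>)\<close>, where \<open>\<xi>\<close> is a random vector on \<open>X\<close>.\<close>

definition initial_law :: "nat \<Rightarrow> 'c measure \<Rightarrow> ('c \<Rightarrow> nat \<Rightarrow> real) \<Rightarrow> nat \<Rightarrow> (nat \<Rightarrow> real) measure" where
  "initial_law J X \<xi> j =
     (if j = 1 then distr X (borel_on {1..J}) (\<lambda>\<omega>. \<lambda>k\<in>{1..J}. \<xi> \<omega> k)
      else return (borel_on {j..J}) (\<lambda>k\<in>{j..J}. 0))"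

definition exponential_law :: "real \<Rightarrow> real measure" where
  "exponential_law m = density lborel (exponential_density (1 / m))"

end

theory Submission
  imports Defs "Jordan_Normal_Form.Spectral_Radius" "HOL-Real_Asymp.Real_Asymp"
begin

text \<open>Fix \<open>j\<close> and write \<open>Q\<close> for the reflection matrix and \<open>y\<close> for the regulator of the \<open>j\<close>-th SRBM. Its
  first coordinate is a one-dimensional reflection of Brownian motion with drift \<open>-Q\<^sub>j\<^sub>j\<close>, minus the
  nondecreasing process \<open>\<Sum>\<^bsub>l \<noteq> j\<^esub> |Q\<^sub>j\<^sub>l| y\<^sub>l\<close>. Hence it is dominated by a one-dimensional reflected
  Brownian motion, whose law converges to the exponential one. For the matching lower bound it suffices
  that the increments of \<open>y\<^sub>l\<close>, \<open>l \<noteq> j\<close>, over windows \<open>[t - T, t]\<close> vanish in mean as \<open>t \<rightarrow> \<infinity>\<close>. Restarting the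
  process at 0 at an earlier time \<open>t - k T\<close> makes these increments larger, as reflection with an
  \<open>M\<close>-matrix is monotone; by stationarity of the Brownian increments, averaging the resulting bounds over
  \<open>k \<le> n\<close> gives \<open>E y\<^sub>l(n T) / n\<close> for the process started at 0. Since the drift is \<open>-Q e\<^sub>j\<close>, the function
  \<open>y = t e\<^sub>j + c v\<close> with \<open>Q v \<ge> 1\<close> is a supersolution as soon as \<open>c\<close> bounds the Brownian path up to \<open>t\<close>, so
  that \<open>E y\<^sub>l(t) = o(t)\<close> for \<open>l \<noteq> j\<close>. The one-dimensional law is obtained on time grids from the Lindley
  recursion, by induction over the number of steps, with \<open>E exp(\<theta> \<xi>) = 1\<close> for the increments \<open>\<xi>\<close>.
  The marginal limits are combined through independence and Skorokhod's representation theorem.\<close>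

text \<open>The definition of an SRBM supplies the regulator \<open>y\<close> only pathwise, for
  almost every outcome and without measurability. Expectations are therefore never taken of
  \<open>y\<close> itself: its increments are bounded by a regulator that is computed by Picard
  iteration from Brownian increments at countably many dyadic times. That regulator is a measurable
  function of increments whose law can be shifted in time. Complementarity serves to show that
  \<open>y\<close> is the least solution, so that the comparison reaches it. With drift minus column
  \<open>j\<close> of \<open>Q\<close>, the other regulators only have to answer fluctuations, hence
  grow sublinearly. A window of fixed length \<open>T\<close> is enough for the lower bound because
  one-dimensional reflection started at 0 misses its stationary tail by at most a multiple
  \<open>exp (- \<mu>\<^sup>2 T / (2 \<sigma>\<^sup>2))\<close> of a bounded function after time
  \<open>T\<close>. The tail estimate for the Lindley recursion is used twice: for the limit law,
  and for bounding the mean range of a Brownian path by \<open>2 \<mu> t\<close> plus a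
  constant.\<close>

section \<open>Matrices with a positive supersolution\<close>

text \<open>\<open>spectral_radius_on\<close> speaks of eigenvectors indexed by \<open>K\<close>.
  Identifying its eigenvalues with those of a carrier matrix gives access to finiteness of the
  spectrum and to the growth bounds from the Jordan normal form.\<close>

lemma eigenvalue_reindexed_mat:
  fixes B :: "nat \<Rightarrow> nat \<Rightarrow> real"
  assumes f: "bij_betw f {0..<d} K"
  shows "eigenvalue (mat d d (\<lambda>(i, k). complex_of_real (B (f i) (f k)))) c \<longleftrightarrow>
    (\<exists>v :: nat \<Rightarrow> complex. (\<exists>i\<in>K. v i \<noteq> 0) \<and>
       (\<forall>i\<in>K. (\<Sum>k\<in>K. complex_of_real (B i k) * v k) = c * v i))" (is "?L \<longleftrightarrow> ?R")
proof
  define A where "A = mat d d (\<lambda>(i, k). complex_of_real (B (f i) (f k)))"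
  have prod: "(A *\<^sub>v w) $ i = (\<Sum>k\<in>K. complex_of_real (B (f i) k) * w $ (inv_into {0..<d} f k))"
    if "i < d" "w \<in> carrier_vec d" for w i
  proof -
    have "(A *\<^sub>v w) $ i = (\<Sum>k\<in>{0..<d}. complex_of_real (B (f i) (f k)) * w $ k)"
      using that by (auto simp: A_def scalar_prod_def)
    also have "\<dots> = (\<Sum>k\<in>{0..<d}. complex_of_real (B (f i) (f k)) * w $ (inv_into {0..<d} f (f k)))"
      using f by (intro sum.cong) (auto simp: bij_betw_def)
    also have "\<dots> = (\<Sum>k\<in>K. complex_of_real (B (f i) k) * w $ (inv_into {0..<d} f k))"
      by (rule sum.reindex_bij_betw[OF f])
    finally show ?thesis .
  qed
  {
    assume ?L
    then obtain w where w: "w \<in> carrier_vec d" "w \<noteq> 0\<^sub>v d" "A *\<^sub>v w = c \<cdot>\<^sub>v w"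
      unfolding eigenvalue_def eigenvector_def A_def by auto
    from w obtain i where i: "i < d" "w $ i \<noteq> 0" by (metis eq_vecI carrier_vecD index_zero_vec)
    show ?R
    proof (intro exI[of _ "\<lambda>k. w $ (inv_into {0..<d} f k)"] conjI ballI bexI[of _ "f i"])
      show "w $ inv_into {0..<d} f (f i) \<noteq> 0" using i f by (simp add: bij_betw_def)
      show "f i \<in> K" using i f by (auto simp: bij_betw_def)
      fix k assume "k \<in> K"
      then obtain i' where i': "i' < d" "k = f i'" using f by (auto simp: bij_betw_def)
      have inv: "inv_into {0..<d} f (f i') = i'" using f i' by (simp add: bij_betw_def)
      show "(\<Sum>l\<in>K. complex_of_real (B k l) * w $ inv_into {0..<d} f l) = c * w $ inv_into {0..<d} f k"
        using prod[OF i'(1) w(1)] w i' by (simp add: inv)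
    qed
  }
  {
    assume ?R
    then obtain v where v: "\<exists>i\<in>K. v i \<noteq> 0"
      "\<And>i. i\<in>K \<Longrightarrow> (\<Sum>k\<in>K. complex_of_real (B i k) * v k) = c * v i" by blast
    define w where "w = vec d (\<lambda>i. v (f i))"
    have "w \<in> carrier_vec d" by (simp add: w_def)
    moreover have "w \<noteq> 0\<^sub>v d"
    proof -
      from v(1) f obtain i where "i < d" "v (f i) \<noteq> 0" by (auto simp: bij_betw_def)
      then have "w $ i \<noteq> 0" "0\<^sub>v d $ i = (0::complex)" by (auto simp: w_def)
      then show ?thesis by metis
    qed
    moreover have "A *\<^sub>v w = c \<cdot>\<^sub>v w"
    proof (rule eq_vecI)
      fix i assume "i < dim_vec (c \<cdot>\<^sub>v w)"
      then have i: "i < d" by (simp add: w_def)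
      have *: "w $ inv_into {0..<d} f k = v k" if "k \<in> K" for k
        using that f bij_betw_inv_into_right[OF f that] bij_betwE[OF bij_betw_inv_into[OF f]]
        by (auto simp: w_def)
      show "(A *\<^sub>v w) $ i = (c \<cdot>\<^sub>v w) $ i"
      proof -
        have "f i \<in> K" using i f by (auto simp: bij_betw_def)
        then have "(\<Sum>k\<in>K. complex_of_real (B (f i) k) * w $ inv_into {0..<d} f k) = c * v (f i)"
          using v(2)[of "f i"] by (simp add: * cong: sum.cong)
        then show ?thesis using i by (subst prod) (auto simp: w_def)
      qed
    qed (simp add: A_def w_def)
    ultimately show ?L unfolding eigenvalue_def eigenvector_def A_def by auto
  }
qed

text \<open>The witness is a partial sum of the Neumann series of \<open>I - B / s\<close> applied to a constant vector.\<close>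

lemma M_matrix_positive_vector:
  assumes "finite K" and Q: "M_matrix_on K Q"
  shows "\<exists>v. \<forall>k\<in>K. 0 < v k \<and> 1 \<le> (\<Sum>l\<in>K. Q k l * v l)"
proof (cases "K = {}")
  case False
  from Q obtain s B where s: "0 < s" and B: "\<And>i k. i\<in>K \<Longrightarrow> k\<in>K \<Longrightarrow> 0 \<le> B i k"
    and rad: "spectral_radius_on K B < s"
    and QB: "\<And>i k. i\<in>K \<Longrightarrow> k\<in>K \<Longrightarrow> Q i k = s * kron i k - B i k"
    unfolding M_matrix_on_def by blast
  define d where "d = card K"
  have d: "d > 0" using False assms by (simp add: d_def card_gt_0_iff)
  obtain f where f: "bij_betw f {0..<d} K"
    using ex_bij_betw_nat_finite[OF \<open>finite K\<close>] unfolding d_def by blast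
  define E where "E = {cmod c | c. \<exists>v :: nat \<Rightarrow> complex. (\<exists>i\<in>K. v i \<noteq> 0) \<and>
            (\<forall>i\<in>K. (\<Sum>k\<in>K. complex_of_real (B i k) * v k) = c * v i)}"
  \<comment> \<open>\<open>spectral_radius_on\<close> is a \<open>Max\<close>, which bounds the
    elements of \<open>E\<close> only once \<open>E\<close> is known to be finite.\<close>
  have "E = norm ` spectrum (mat d d (\<lambda>(i, k). complex_of_real (B (f i) (f k))))"
    unfolding E_def spectrum_def eigenvalue_reindexed_mat[OF f, symmetric] by auto
  then have "finite E" using card_finite_spectrum(1)[OF mat_carrier] by auto
  then have le: "e \<le> spectral_radius_on K B" if "e \<in> E" for e
    using that unfolding spectral_radius_on_def E_def[symmetric] by simp
  \<comment> \<open>Dividing by a number strictly between the spectral radius and \<open>s\<close>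
    leaves a spectral radius below 1, hence bounded powers, with a factor \<open>(t / s) ^ n\<close>
    to spare. The maximum with \<open>s / 2\<close> makes \<open>t\<close> positive without a sign
    for \<open>spectral_radius_on K B\<close>.\<close>
  define t where "t = max (s / 2) ((s + spectral_radius_on K B) / 2)"
  have t: "0 < t" "t < s" "spectral_radius_on K B < t" using s rad by (auto simp: t_def less_max_iff_disj)
  define A where "A = mat d d (\<lambda>(i, k). complex_of_real (B (f i) (f k) / t))"
  have Ac: "A \<in> carrier_mat d d" by (simp add: A_def)
  have "spectral_radius A < 1"
  proof -
    obtain c where c: "eigenvalue A c" "spectral_radius A = norm c"
      using spectral_radius_mem_max(1)[OF Ac d] unfolding spectrum_def by auto
    obtain v :: "nat \<Rightarrow> complex" where v: "\<exists>i\<in>K. v i \<noteq> 0"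
      "\<And>i. i\<in>K \<Longrightarrow> (\<Sum>k\<in>K. complex_of_real (B i k / t) * v k) = c * v i"
      using c(1) unfolding A_def eigenvalue_reindexed_mat[OF f, of "\<lambda>i k. B i k / t"] by blast
    have "(\<Sum>k\<in>K. complex_of_real (B i k) * v k) = (t * c) * v i" if "i \<in> K" for i
      using v(2)[OF that] t(1) by (simp add: sum_divide_distrib[symmetric] field_simps)
    then have "norm (t * c) \<in> E" unfolding E_def using v(1) by blast
    from le[OF this] have "t * norm c \<le> spectral_radius_on K B" using t(1) by (simp add: norm_mult)
    with t(3) have "t * norm c < t * 1" by linarith
    then show ?thesis using mult_less_cancel_left_pos[OF t(1)] unfolding c(2) by blast
  qed
  then obtain C where C: "norm_bound (A ^\<^sub>m n) C" for n
    using spectral_radius_jnf_norm_bound_less_1_upper_triangular[OF Ac] by blast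
  have comm: "A * A ^\<^sub>m n = A ^\<^sub>m n * A" for n
  proof (induction n)
    case (Suc n)
    have "A * A ^\<^sub>m Suc n = (A * A ^\<^sub>m n) * A"
      using assoc_mult_mat[OF Ac pow_carrier_mat[OF Ac] Ac, of n] by simp
    then show ?case using Suc by simp
  qed (use Ac in auto)
  \<comment> \<open>The \<open>n\<close>-th power of \<open>B / s\<close> applied to the constant 1.
    It is \<open>(t / s) ^ n\<close> times the \<open>n\<close>-th power of \<open>A\<close> applied
    to that vector, hence decays geometrically.\<close>
  define b where "b = rec_nat (\<lambda>i. 1) (\<lambda>n b i. (\<Sum>l\<in>K. B i l / s * b l))"
  have b0: "b 0 i = 1" and bS: "b (Suc n) i = (\<Sum>l\<in>K. B i l / s * b n l)" for n i
    by (simp_all add: b_def)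
  let ?one = "vec d (\<lambda>_. 1) :: complex vec"
  have bA: "complex_of_real (b n (f i)) = (t / s) ^ n * (A ^\<^sub>m n *\<^sub>v ?one) $ i" if "i < d" for n i
    using that
  proof (induction n arbitrary: i)
    case 0
    then show ?case using Ac by (auto simp: b0)
  next
    case (Suc n)
    define w where "w = A ^\<^sub>m n *\<^sub>v ?one"
    have w: "w \<in> carrier_vec d" unfolding w_def by (rule mult_mat_vec_carrier[OF pow_carrier_mat[OF Ac]]) simp
    have "A ^\<^sub>m Suc n *\<^sub>v ?one = A *\<^sub>v w"
      using comm[of n] Ac by (simp add: w_def assoc_mult_mat_vec[OF Ac pow_carrier_mat[OF Ac], symmetric])
    then have "(A ^\<^sub>m Suc n *\<^sub>v ?one) $ i = (\<Sum>l\<in>{0..<d}. complex_of_real (B (f i) (f l) / t) * w $ l)"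
      using Suc.prems w by (auto simp: A_def scalar_prod_def)
    moreover have "b (Suc n) (f i) = (\<Sum>l\<in>{0..<d}. B (f i) (f l) / s * b n (f l))"
      unfolding bS by (rule sum.reindex_bij_betw[OF f, symmetric])
    ultimately show ?case using s t
      by (simp add: Suc.IH sum_distrib_left w_def[symmetric] field_simps)
  qed
  have bnd: "\<bar>b n k\<bar> \<le> (t / s) ^ n * (d * C)" if "k \<in> K" for n k
  proof -
    obtain i where i: "i < d" "k = f i" using \<open>k \<in> K\<close> f by (force simp: bij_betw_def)
    have "norm ((A ^\<^sub>m n *\<^sub>v ?one) $ i) = norm (\<Sum>l\<in>{0..<d}. (A ^\<^sub>m n) $$ (i, l))"
      using i Ac by (auto simp: scalar_prod_def)
    also have "\<dots> \<le> (\<Sum>l\<in>{0..<d}. C)"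
      using C[of n] i Ac unfolding norm_bound_def by (intro order_trans[OF norm_sum] sum_mono) auto
    finally have *: "norm ((A ^\<^sub>m n *\<^sub>v ?one) $ i) \<le> d * C" by simp
    have "\<bar>b n k\<bar> = norm (complex_of_real (b n (f i)))" by (simp add: i)
    also have "\<dots> = (t / s) ^ n * norm ((A ^\<^sub>m n *\<^sub>v ?one) $ i)"
      unfolding bA[OF i(1)] using s t by (simp add: norm_mult norm_power norm_divide)
    also have "\<dots> \<le> (t / s) ^ n * (d * C)" using * s t by (intro mult_left_mono) auto
    finally show ?thesis .
  qed
  have "(\<lambda>n. (t / s) ^ n * (d * C)) \<longlonglongrightarrow> 0 * (d * C)"
    using s t by (intro tendsto_intros LIMSEQ_power_zero) auto
  then have "\<forall>\<^sub>F n in sequentially. (t / s) ^ n * (d * C) < 1 / 2"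
    by (intro order_tendstoD) auto
  then obtain N where N: "(t / s) ^ N * (d * C) < 1 / 2" using eventually_happens' by force
  have N0: "b N k < 1 / 2" if "k \<in> K" for k using bnd[OF that, of N] N by auto
  have b_nonneg: "0 \<le> b n k" if "k \<in> K" for n k
    using that B s by (induction n arbitrary: k) (auto simp: b0 bS intro!: sum_nonneg)
  have "N > 0" using N0 False by (cases N) (auto simp: b0)
  \<comment> \<open>\<open>Q\<close> applied to the sum telescopes to
    \<open>s * (b 0 - b N)\<close>, and \<open>b N < 1 / 2\<close>, so the factor
    \<open>2 / s\<close> yields at least 1.\<close>
  define v where "v k = (\<Sum>n<N. b n k) * 2 / s" for k
  show ?thesis
  proof (intro exI[of _ v] ballI conjI)
    fix k assume k: "k \<in> K"
    have "b 0 k \<le> (\<Sum>n<N. b n k)"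
      using \<open>N > 0\<close> b_nonneg[OF k] by (intro member_le_sum) auto
    then show "0 < v k" using s by (simp add: v_def b0)
    have "(\<Sum>l\<in>K. kron k l * v l) = v k"
      using k \<open>finite K\<close> by (simp add: kron_def if_distrib[of "\<lambda>a. a * _"] cong: if_cong)
    moreover have "(\<Sum>l\<in>K. B k l * v l) = 2 * (\<Sum>n<N. b (Suc n) k)"
      unfolding bS v_def sum_distrib_left sum_distrib_right sum_divide_distrib
      by (subst sum.swap) (simp add: field_simps)
    moreover have "(\<Sum>l\<in>K. Q k l * v l) = s * (\<Sum>l\<in>K. kron k l * v l) - (\<Sum>l\<in>K. B k l * v l)"
      using k by (simp add: QB left_diff_distrib sum_subtractf sum_distrib_left mult.assoc cong: sum.cong)
    ultimately have "(\<Sum>l\<in>K. Q k l * v l) = 2 * ((\<Sum>n<N. b n k) - (\<Sum>n<N. b (Suc n) k))"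
      using s by (simp add: v_def)
    also have "\<dots> = 2 * (b 0 k - b N k)"
      using sum_lessThan_telescope'[of "\<lambda>n. b n k" N] by (simp only: sum_subtractf)
    finally show "1 \<le> (\<Sum>l\<in>K. Q k l * v l)" using N0[OF k] by (simp add: b0)
  qed
qed simp

lemma M_matrix_off_diagonal:
  assumes "M_matrix_on K Q" "k \<in> K" "l \<in> K" "k \<noteq> l"
  shows "Q k l \<le> 0"
  using assms unfolding M_matrix_on_def by (force simp: kron_def)

section \<open>The Skorokhod problem on a set of times\<close>

text \<open>The supremum is taken in \<open>ereal\<close>, where a countable one is measurable
  without a boundedness condition. Empty and unbounded families both give 0 under
  \<open>real_of_ereal\<close>, so the lemmas carry an explicit bound \<open>c\<close>.\<close>

definition running_max :: "real set \<Rightarrow> (real \<Rightarrow> real) \<Rightarrow> real \<Rightarrow> real" where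
  "running_max D u t = real_of_ereal (SUP s\<in>{s\<in>D. s \<le> t}. ereal (max 0 (u s)))"

lemma running_max_bounded:
  assumes "0 \<le> c" "\<And>s. s \<in> D \<Longrightarrow> s \<le> t \<Longrightarrow> u s \<le> c"
  shows "0 \<le> running_max D u t" "running_max D u t \<le> c"
    and "\<And>s. s \<in> D \<Longrightarrow> s \<le> t \<Longrightarrow> u s \<le> running_max D u t"
proof -
  define S where "S = (SUP s\<in>{s\<in>D. s \<le> t}. ereal (max 0 (u s)))"
  have le: "S \<le> ereal c" unfolding S_def using assms by (intro SUP_least) auto
  have up: "ereal (max 0 (u s)) \<le> S" if "s \<in> D" "s \<le> t" for s
    unfolding S_def using that by (intro SUP_upper2[of s]) auto
  have rm: "running_max D u t = real_of_ereal S" by (simp add: running_max_def S_def)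
  show "running_max D u t \<le> c" using le \<open>0 \<le> c\<close> unfolding rm by (cases S) auto
  show "0 \<le> running_max D u t"
  proof (cases "{s\<in>D. s \<le> t} = {}")
    case True
    then show ?thesis unfolding running_max_def by (simp only: True image_empty Sup_empty) (simp add: bot_ereal_def)
  next
    case False
    then obtain s where "s \<in> D" "s \<le> t" by blast
    from up[OF this] le show ?thesis unfolding rm by (cases S) auto
  qed
  show "u s \<le> running_max D u t" if "s \<in> D" "s \<le> t" for s
    using up[OF that] le unfolding rm by (cases S) (auto simp: max_def split: if_splits)
qed

lemma running_max_mono_time:
  assumes "0 \<le> c" "\<And>s. s \<in> D \<Longrightarrow> u s \<le> c" "r \<le> s"
  shows "running_max D u r \<le> running_max D u s"
  using assms running_max_bounded[of c D s u]
  by (intro running_max_bounded(2)) auto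

text \<open>One-dimensional core of the comparison: adding a nonnegative nondecreasing
  \<open>a\<close> can only enlarge later increments of the running maximum. A value of
  \<open>u'\<close> after \<open>r\<close> lies below \<open>running_max D u s - a r\<close>, and at
  \<open>r\<close> the two maxima differ by at most \<open>a r\<close>.\<close>

lemma running_max_increment_le:
  assumes c: "0 \<le> c" "\<And>s. s \<in> D \<Longrightarrow> u s \<le> c"
    and u: "\<And>s. s \<in> D \<Longrightarrow> u s = u' s + a s"
    and a: "\<And>s. s \<in> D \<Longrightarrow> 0 \<le> a s" "\<And>r s. r \<in> D \<Longrightarrow> s \<in> D \<Longrightarrow> r \<le> s \<Longrightarrow> a r \<le> a s"
    and rs: "r \<in> D" "s \<in> D" "r \<le> s"
  shows "running_max D u' r \<le> running_max D u r"
    and "running_max D u r - running_max D u' r \<le> running_max D u s - running_max D u' s"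
proof -
  have u'c: "u' s \<le> c" if "s \<in> D" for s using that c(2)[of s] u[of s] a(1)[of s] by auto
  have R: "0 \<le> running_max D u t" "\<And>q. q \<in> D \<Longrightarrow> q \<le> t \<Longrightarrow> u q \<le> running_max D u t" for t
    using running_max_bounded[of c D t u] c by auto
  have R': "0 \<le> running_max D u' t" "\<And>q. q \<in> D \<Longrightarrow> q \<le> t \<Longrightarrow> u' q \<le> running_max D u' t" for t
    using running_max_bounded[of c D t u'] c(1) u'c by auto
  show "running_max D u' r \<le> running_max D u r"
  proof (rule running_max_bounded(2))
    fix q assume q: "q \<in> D" "q \<le> r"
    show "u' q \<le> running_max D u r" using R(2)[OF q] u[OF q(1)] a(1)[OF q(1)] by linarith
  qed (rule R(1))
  have ur: "running_max D u r \<le> running_max D u' r + a r"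
  proof (rule running_max_bounded(2))
    fix q assume q: "q \<in> D" "q \<le> r"
    show "u q \<le> running_max D u' r + a r"
      using R'(2)[OF q] u[OF q(1)] a(2)[OF q(1) rs(1) q(2)] by linarith
  qed (use R' a rs in auto)
  have le: "running_max D u r \<le> running_max D u s" by (rule running_max_mono_time[OF c rs(3)])
  have "running_max D u' s \<le> running_max D u' r + (running_max D u s - running_max D u r)"
  proof (rule running_max_bounded(2))
    fix q assume q: "q \<in> D" "q \<le> s"
    show "u' q \<le> running_max D u' r + (running_max D u s - running_max D u r)"
    proof (cases "q \<le> r")
      case True
      with R'(2)[OF q(1) True] le show ?thesis by linarith
    next
      case False
      then have "a r \<le> a q" using a(2)[OF rs(1) q(1)] by simp
      with R(2)[OF q] u[OF q(1)] ur show ?thesis by linarith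
    qed
  qed (use R' le in auto)
  then show "running_max D u r - running_max D u' r \<le> running_max D u s - running_max D u' s" by simp
qed

text \<open>Picard iteration for the regulator \<open>y\<close> of the Skorokhod problem with times restricted to \<open>D\<close>:
  coordinate by coordinate, \<open>y\<close> solves the one-dimensional reflection problem given the other ones.\<close>

primrec regulator_iterate ::
    "real set \<Rightarrow> nat set \<Rightarrow> (nat \<Rightarrow> nat \<Rightarrow> real) \<Rightarrow> (real \<Rightarrow> nat \<Rightarrow> real) \<Rightarrow> nat \<Rightarrow> real \<Rightarrow> nat \<Rightarrow> real" where
  "regulator_iterate D K Q x 0 = (\<lambda>t k. 0)"
| "regulator_iterate D K Q x (Suc n) = (\<lambda>t k.
     running_max D (\<lambda>s. - x s k - (\<Sum>l\<in>K - {k}. Q k l * regulator_iterate D K Q x n s l)) t / Q k k)"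

definition regulator ::
    "real set \<Rightarrow> nat set \<Rightarrow> (nat \<Rightarrow> nat \<Rightarrow> real) \<Rightarrow> (real \<Rightarrow> nat \<Rightarrow> real) \<Rightarrow> real \<Rightarrow> nat \<Rightarrow> real" where
  "regulator D K Q x t k = lim (\<lambda>n. regulator_iterate D K Q x n t k)"

text \<open>Supersolutions: the Skorokhod problem without complementarity. The constructed
  \<open>regulator\<close> lies below all of them, and the existence of one makes the Picard
  iteration converge.\<close>

definition regulator_bound ::
    "real set \<Rightarrow> nat set \<Rightarrow> (nat \<Rightarrow> nat \<Rightarrow> real) \<Rightarrow> (real \<Rightarrow> nat \<Rightarrow> real) \<Rightarrow> (real \<Rightarrow> nat \<Rightarrow> real) \<Rightarrow> bool" where
  "regulator_bound D K Q x w \<longleftrightarrow>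
     (\<forall>k\<in>K. \<forall>s\<in>D. 0 \<le> w s k \<and> 0 \<le> x s k + (\<Sum>l\<in>K. Q k l * w s l)) \<and>
     (\<forall>k\<in>K. \<forall>r\<in>D. \<forall>s\<in>D. r \<le> s \<longrightarrow> w r k \<le> w s k)"

section \<open>Comparison of regulators by monotone Picard iteration\<close>

locale reflection_matrix =
  fixes K :: "nat set" and Q :: "nat \<Rightarrow> nat \<Rightarrow> real" and D :: "real set"
  assumes finite_K: "finite K"
    and diag: "\<And>k. k \<in> K \<Longrightarrow> 0 < Q k k"
    and off_diag: "\<And>k l. k \<in> K \<Longrightarrow> l \<in> K \<Longrightarrow> k \<noteq> l \<Longrightarrow> Q k l \<le> 0"
    and bdd: "\<exists>b\<in>D. \<forall>s\<in>D. s \<le> b"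
begin

abbreviation "It \<equiv> regulator_iterate D K Q"

text \<open>Nonnegativity of \<open>x + Q y\<close> in coordinate \<open>k\<close> means
  \<open>demand x y s k \<le> Q k k * y s k\<close>; a Picard step is the running maximum of the
  demand, divided by \<open>Q k k\<close>.\<close>

definition demand :: "(real \<Rightarrow> nat \<Rightarrow> real) \<Rightarrow> (real \<Rightarrow> nat \<Rightarrow> real) \<Rightarrow> real \<Rightarrow> nat \<Rightarrow> real" where
  "demand x y s k = - x s k - (\<Sum>l\<in>K - {k}. Q k l * y s l)"

lemma It_Suc: "It x (Suc n) s k = running_max D (\<lambda>s. demand x (It x n) s k) s / Q k k"
  by (simp add: demand_def)

lemma demand_mono:
  assumes "k \<in> K" "\<And>l. l \<in> K \<Longrightarrow> y s l \<le> y' s l"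
  shows "demand x y s k \<le> demand x y' s k"
  unfolding demand_def using assms off_diag
  by (intro diff_left_mono sum_mono mult_left_mono_neg) auto

lemma demand_le:
  assumes "regulator_bound D K Q x w" "k \<in> K" "s \<in> D"
  shows "demand x w s k \<le> Q k k * w s k"
proof -
  have "(\<Sum>l\<in>K. Q k l * w s l) = Q k k * w s k + (\<Sum>l\<in>K - {k}. Q k l * w s l)"
    using assms finite_K by (simp add: sum.remove)
  moreover have "0 \<le> x s k + (\<Sum>l\<in>K. Q k l * w s l)"
    using assms unfolding regulator_bound_def by auto
  ultimately show ?thesis unfolding demand_def by linarith
qed

text \<open>Off-diagonal entries are nonpositive, so the demand grows with \<open>y\<close>. A
  supersolution meets its own demand, hence no iterate started from 0 can pass it.\<close>

lemma It_bounds: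
  assumes w: "regulator_bound D K Q x w" and "k \<in> K" "s \<in> D"
  shows "0 \<le> It x n s k" "It x n s k \<le> w s k"
proof -
  have "0 \<le> It x n s k \<and> It x n s k \<le> w s k"
    using assms(2,3)
  proof (induction n arbitrary: s k)
    case 0
    then show ?case using w unfolding regulator_bound_def by auto
  next
    case (Suc n)
    have *: "demand x (It x n) r k \<le> Q k k * w s k" if r: "r \<in> D" "r \<le> s" for r
    proof -
      have "demand x (It x n) r k \<le> demand x w r k"
        using Suc r by (intro demand_mono) auto
      also have "\<dots> \<le> Q k k * w r k" using demand_le[OF w Suc.prems(1) r(1)] .
      also have "\<dots> \<le> Q k k * w s k"
        using w Suc.prems r diag[of k] unfolding regulator_bound_def by (intro mult_left_mono) auto
      finally show ?thesis .
    qed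
    have "0 \<le> Q k k * w s k" using w Suc.prems diag[of k] unfolding regulator_bound_def by auto
    note rm = running_max_bounded[OF this, of D s "\<lambda>r. demand x (It x n) r k", OF *]
    show ?case unfolding It_Suc using rm(1,2) diag[OF Suc.prems(1)] by (simp add: field_simps)
  qed
  then show "0 \<le> It x n s k" "It x n s k \<le> w s k" by auto
qed

lemma demand_It_bounded:
  assumes w: "regulator_bound D K Q x w" and k: "k \<in> K"
  shows "\<exists>c\<ge>0. \<forall>s\<in>D. demand x (It x n) s k \<le> c"
proof -
  obtain b where b: "b \<in> D" "\<And>s. s \<in> D \<Longrightarrow> s \<le> b" using bdd by blast
  have "demand x (It x n) s k \<le> Q k k * w b k" if s: "s \<in> D" for s
  proof -
    have "demand x (It x n) s k \<le> demand x w s k"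
      using s It_bounds[OF w] k by (intro demand_mono) auto
    also have "\<dots> \<le> Q k k * w s k" using demand_le[OF w k s] .
    also have "\<dots> \<le> Q k k * w b k"
      using w s k b diag[of k] unfolding regulator_bound_def by (intro mult_left_mono) auto
    finally show ?thesis .
  qed
  moreover have "0 \<le> Q k k * w b k"
    using w b k diag[of k] unfolding regulator_bound_def by auto
  ultimately show ?thesis by blast
qed

lemma demand_le_It_Suc:
  assumes w: "regulator_bound D K Q x w" and k: "k \<in> K" and "r \<in> D" "r \<le> s"
  shows "demand x (It x n) r k \<le> Q k k * It x (Suc n) s k"
proof -
  obtain c where "0 \<le> c" "\<And>s. s \<in> D \<Longrightarrow> demand x (It x n) s k \<le> c"
    using demand_It_bounded[OF w k] by blast
  from running_max_bounded(3)[of c D s "\<lambda>s. demand x (It x n) s k" r, OF this] assms diag[OF k]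
  show ?thesis unfolding It_Suc by simp
qed

lemma It_Suc_le:
  assumes k: "k \<in> K" and "0 \<le> c" "\<And>r. r \<in> D \<Longrightarrow> r \<le> s \<Longrightarrow> demand x (It x n) r k \<le> Q k k * c"
  shows "It x (Suc n) s k \<le> c"
  using running_max_bounded(2)[of "Q k k * c" D s "\<lambda>s. demand x (It x n) s k"] assms diag[OF k]
  unfolding It_Suc by (simp add: field_simps)

lemma It_incseq:
  assumes w: "regulator_bound D K Q x w" and "k \<in> K" "s \<in> D"
  shows "It x n s k \<le> It x (Suc n) s k"
  using assms(2,3)
proof (induction n arbitrary: s k)
  case 0
  then show ?case using It_bounds(1)[OF w, of k s 1] by simp
next
  case (Suc n)
  show ?case
  proof (rule It_Suc_le[OF Suc.prems(1)])
    show "0 \<le> It x (Suc (Suc n)) s k" by (rule It_bounds(1)[OF w Suc.prems])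
    fix r assume r: "r \<in> D" "r \<le> s"
    have "demand x (It x n) r k \<le> demand x (It x (Suc n)) r k"
      using Suc r by (intro demand_mono) auto
    also have "\<dots> \<le> Q k k * It x (Suc (Suc n)) s k" by (rule demand_le_It_Suc[OF w Suc.prems(1) r])
    finally show "demand x (It x n) r k \<le> Q k k * It x (Suc (Suc n)) s k" .
  qed
qed

lemma regulator_LIMSEQ:
  assumes w: "regulator_bound D K Q x w" and ks: "k \<in> K" "s \<in> D"
  shows "(\<lambda>n. It x n s k) \<longlonglongrightarrow> regulator D K Q x s k"
proof -
  have "incseq (\<lambda>n. It x n s k)" using It_incseq[OF w ks] by (rule incseq_SucI)
  then obtain L where "(\<lambda>n. It x n s k) \<longlonglongrightarrow> L"
    using incseq_convergent[of "\<lambda>n. It x n s k" "w s k"] It_bounds(2)[OF w ks] by blast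
  then show ?thesis unfolding regulator_def by (simp add: limI)
qed

lemma regulator_bounds:
  assumes w: "regulator_bound D K Q x w" and ks: "k \<in> K" "s \<in> D"
  shows "0 \<le> regulator D K Q x s k" "regulator D K Q x s k \<le> w s k"
  using regulator_LIMSEQ[OF assms] It_bounds[OF assms]
  by (auto intro: LIMSEQ_le_const LIMSEQ_le_const2)

text \<open>Raising the starting point by \<open>h\<close> lowers the demand by \<open>h\<close>
  plus a combination, with weights \<open>- Q k l\<close>, of the differences of the iterates. Both
  claims are carried together because the sign of these differences and their monotonicity in time
  are what \<open>running_max_increment_le\<close> asks of \<open>a\<close> in the next
  step.\<close>

lemma It_increment_comparison:
  assumes w: "regulator_bound D K Q x w" and w': "regulator_bound D K Q x' w'"
    and x': "\<And>s k. s \<in> D \<Longrightarrow> k \<in> K \<Longrightarrow> x' s k = x s k + h k"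
    and h: "\<And>k. k \<in> K \<Longrightarrow> 0 \<le> h k"
    and "k \<in> K" "r \<in> D" "s \<in> D" "r \<le> s"
  shows "It x' n r k \<le> It x n r k \<and> It x n r k - It x' n r k \<le> It x n s k - It x' n s k"
  using assms(5-)
proof (induction n arbitrary: r s k)
  case (Suc n)
  define a where "a s = h k + (\<Sum>l\<in>K - {k}. - Q k l * (It x n s l - It x' n s l))" for s
  obtain c where c: "0 \<le> c" "\<And>s. s \<in> D \<Longrightarrow> demand x (It x n) s k \<le> c"
    using demand_It_bounded[OF w \<open>k \<in> K\<close>] by blast
  have u: "demand x (It x n) s k = demand x' (It x' n) s k + a s" if "s \<in> D" for s
    using x'[OF that Suc.prems(1)]
    by (simp add: demand_def a_def sum_subtractf sum_negf algebra_simps)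
  have a0: "0 \<le> a s" if "s \<in> D" for s
    unfolding a_def using Suc.IH[of _ s s] that Suc.prems off_diag[of k] h
    by (intro add_nonneg_nonneg sum_nonneg mult_nonneg_nonneg) auto
  have am: "a r \<le> a s" if "r \<in> D" "s \<in> D" "r \<le> s" for r s
    unfolding a_def using Suc.IH[of _ r s] that Suc.prems off_diag[of k] h
    by (intro add_left_mono sum_mono mult_left_mono) auto
  have *: "running_max D (\<lambda>s. demand x' (It x' n) s k) r \<le> running_max D (\<lambda>s. demand x (It x n) s k) r"
    "running_max D (\<lambda>s. demand x (It x n) s k) r - running_max D (\<lambda>s. demand x' (It x' n) s k) r
     \<le> running_max D (\<lambda>s. demand x (It x n) s k) s - running_max D (\<lambda>s. demand x' (It x' n) s k) s"
    using running_max_increment_le[of c D "\<lambda>s. demand x (It x n) s k" "\<lambda>s. demand x' (It x' n) s k" a r s,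
      OF c u a0 am Suc.prems(2-)] by auto
  show ?case
    unfolding It_Suc diff_divide_distrib[symmetric]
    using * diag[OF Suc.prems(1)] by (auto intro!: divide_right_mono)
qed simp

text \<open>Contraction in the supremum norm weighted by \<open>v\<close>. Beyond being a
  supersolution, \<open>y\<close> is known through \<open>least\<close>: a constant that dominates
  its demand up to \<open>s\<close> dominates \<open>Q k k * y s k\<close>. For a reflected path
  this comes from complementarity.\<close>

lemma It_contraction:
  assumes w: "regulator_bound D K Q x y" and \<rho>: "0 \<le> \<rho>"
    and C: "0 \<le> C" "\<And>k s. k \<in> K \<Longrightarrow> s \<in> D \<Longrightarrow> y s k \<le> C * v k"
    and v: "\<And>k. k \<in> K \<Longrightarrow> 0 \<le> v k"
    and contr: "\<And>k. k \<in> K \<Longrightarrow> (\<Sum>l\<in>K - {k}. - Q k l * v l) \<le> \<rho> * (Q k k * v k)"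
    and least: "\<And>k s c. k \<in> K \<Longrightarrow> s \<in> D \<Longrightarrow> 0 \<le> c \<Longrightarrow> (\<And>r. r \<in> D \<Longrightarrow> r \<le> s \<Longrightarrow> demand x y r k \<le> c)
       \<Longrightarrow> Q k k * y s k \<le> c"
    and "k \<in> K" "s \<in> D"
  shows "y s k \<le> It x n s k + C * \<rho> ^ n * v k"
  using assms(8-)
proof (induction n arbitrary: s k)
  case 0
  then show ?case using C by simp
next
  case (Suc n)
  define e where "e = Q k k * (C * \<rho> ^ Suc n * v k)"
  have "Q k k * y s k \<le> Q k k * It x (Suc n) s k + e"
  proof (rule least[OF Suc.prems])
    show "0 \<le> Q k k * It x (Suc n) s k + e"
      unfolding e_def using It_bounds(1)[OF w Suc.prems, of "Suc n"] diag[OF Suc.prems(1)] v[OF Suc.prems(1)] C(1) \<rho>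
      by (intro add_nonneg_nonneg mult_nonneg_nonneg) auto
    fix r assume r: "r \<in> D" "r \<le> s"
    have "(\<Sum>l\<in>K - {k}. - Q k l * y r l) \<le> (\<Sum>l\<in>K - {k}. - Q k l * (It x n r l + C * \<rho> ^ n * v l))"
      using Suc.IH[OF _ r(1)] off_diag[OF Suc.prems(1)] by (intro sum_mono mult_left_mono) auto
    also have "\<dots> = (\<Sum>l\<in>K - {k}. - Q k l * It x n r l) + C * \<rho> ^ n * (\<Sum>l\<in>K - {k}. - Q k l * v l)"
      by (simp add: sum.distrib[symmetric] sum_distrib_left algebra_simps sum_negf sum_subtractf)
    also have "\<dots> \<le> (\<Sum>l\<in>K - {k}. - Q k l * It x n r l) + C * \<rho> ^ n * (\<rho> * (Q k k * v k))"
      using contr[OF Suc.prems(1)] C(1) \<rho> by (intro add_left_mono mult_left_mono) auto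
    also have "C * \<rho> ^ n * (\<rho> * (Q k k * v k)) = e" by (simp add: e_def)
    finally have "demand x y r k \<le> demand x (It x n) r k + e"
      by (simp add: demand_def sum_negf)
    then show "demand x y r k \<le> Q k k * It x (Suc n) s k + e"
      using demand_le_It_Suc[OF w Suc.prems(1) r, of n] by linarith
  qed
  then have "Q k k * y s k \<le> Q k k * (It x (Suc n) s k + C * \<rho> ^ Suc n * v k)"
    by (simp add: e_def algebra_simps)
  then show ?case using diag[OF Suc.prems(1)] by (simp only: mult_le_cancel_left_pos)
qed

text \<open>Positivity of \<open>Q v\<close> says that in each row the diagonal term outweighs the
  others when weighted by \<open>v\<close>; finitely many rows give a uniform ratio. Inserting 0
  makes it nonnegative and covers an empty \<open>K\<close>.\<close>

lemma contraction_factor: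
  assumes v: "\<And>k. k \<in> K \<Longrightarrow> 0 < v k" "\<And>k. k \<in> K \<Longrightarrow> 0 < (\<Sum>l\<in>K. Q k l * v l)"
  shows "\<exists>\<rho>. 0 \<le> \<rho> \<and> \<rho> < 1 \<and> (\<forall>k\<in>K. (\<Sum>l\<in>K - {k}. - Q k l * v l) \<le> \<rho> * (Q k k * v k))"
proof -
  define q where "q k = (\<Sum>l\<in>K - {k}. - Q k l * v l) / (Q k k * v k)" for k
  define \<rho> where "\<rho> = Max (insert 0 (q ` K))"
  have q: "q k < 1" if k: "k \<in> K" for k
  proof -
    have "(\<Sum>l\<in>K. Q k l * v l) = Q k k * v k + (\<Sum>l\<in>K - {k}. Q k l * v l)"
      using k finite_K by (simp add: sum.remove)
    then have "(\<Sum>l\<in>K - {k}. - Q k l * v l) < Q k k * v k"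
      using v(2)[OF k] by (simp add: sum_negf)
    then show ?thesis using diag[OF k] v(1)[OF k] by (simp add: q_def)
  qed
  have "0 \<le> \<rho>" "\<rho> < 1" using q finite_K by (auto simp: \<rho>_def)
  moreover have "q k \<le> \<rho>" if "k \<in> K" for k using that finite_K by (simp add: \<rho>_def)
  then have "\<forall>k\<in>K. (\<Sum>l\<in>K - {k}. - Q k l * v l) \<le> \<rho> * (Q k k * v k)"
    using diag v(1) by (auto simp: q_def divide_le_eq)
  ultimately show ?thesis by blast
qed

text \<open>By \<open>It_contraction\<close> and \<open>It_bounds\<close> the iterates for
  \<open>x'\<close> converge to \<open>y\<close> itself, so the comparison of iterates passes to
  \<open>y\<close> and the regulator of the lower path. This replaces a uniqueness theorem for the
  Skorokhod problem.\<close>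

lemma regulator_increment_comparison:
  assumes w: "regulator_bound D K Q x w" and y: "regulator_bound D K Q x' y"
    and x': "\<And>s k. s \<in> D \<Longrightarrow> k \<in> K \<Longrightarrow> x' s k = x s k + h k"
    and h: "\<And>k. k \<in> K \<Longrightarrow> 0 \<le> h k"
    and v: "\<And>k. k \<in> K \<Longrightarrow> 0 < v k" "\<And>k. k \<in> K \<Longrightarrow> 0 < (\<Sum>l\<in>K. Q k l * v l)"
    and least: "\<And>k s c. k \<in> K \<Longrightarrow> s \<in> D \<Longrightarrow> 0 \<le> c \<Longrightarrow> (\<And>r. r \<in> D \<Longrightarrow> r \<le> s \<Longrightarrow> demand x' y r k \<le> c)
       \<Longrightarrow> Q k k * y s k \<le> c"
    and k: "k \<in> K" and rs: "r \<in> D" "s \<in> D" "r \<le> s"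
  shows "y s k - y r k \<le> regulator D K Q x s k - regulator D K Q x r k"
proof -
  obtain \<rho> where \<rho>: "0 \<le> \<rho>" "\<rho> < 1"
    "\<And>k. k \<in> K \<Longrightarrow> (\<Sum>l\<in>K - {k}. - Q k l * v l) \<le> \<rho> * (Q k k * v k)"
    using contraction_factor[OF v] by blast
  obtain b where b: "b \<in> D" "\<And>s. s \<in> D \<Longrightarrow> s \<le> b" using bdd by blast
  define C where "C = (\<Sum>k\<in>K. y b k / v k)"
  have y0: "0 \<le> y s k" "y s k \<le> y b k" if "k \<in> K" "s \<in> D" for s k
    using y that b unfolding regulator_bound_def by auto
  have C0: "0 \<le> C" unfolding C_def using y0 b v(1) by (intro sum_nonneg divide_nonneg_pos) auto
  have C: "y s k \<le> C * v k" if "k \<in> K" "s \<in> D" for k s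
  proof -
    have "y b k / v k \<le> C"
      unfolding C_def using that y0 b v(1) finite_K by (intro member_le_sum) (auto intro!: divide_nonneg_pos)
    then have "y b k \<le> C * v k" using v(1)[OF that(1)] by (simp add: divide_le_eq)
    with y0(2)[OF that] show ?thesis by linarith
  qed
  have lim: "(\<lambda>n. It x' n s k) \<longlonglongrightarrow> y s k" if "s \<in> D" for s
  proof (rule tendsto_sandwich)
    have "(\<lambda>n. y s k - C * \<rho> ^ n * v k) \<longlonglongrightarrow> y s k - C * 0 * v k"
      using \<rho> by (intro tendsto_intros LIMSEQ_power_zero) auto
    then show "(\<lambda>n. y s k - C * \<rho> ^ n * v k) \<longlonglongrightarrow> y s k" by simp
    show "\<forall>\<^sub>F n in sequentially. y s k - C * \<rho> ^ n * v k \<le> It x' n s k"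
    proof (rule always_eventually, rule allI)
      fix n
      have "y s k \<le> It x' n s k + C * \<rho> ^ n * v k"
        by (rule It_contraction[OF y \<rho>(1) C0 C less_imp_le[OF v(1)] \<rho>(3) least k that])
      then show "y s k - C * \<rho> ^ n * v k \<le> It x' n s k" by simp
    qed
    show "\<forall>\<^sub>F n in sequentially. It x' n s k \<le> y s k"
      using It_bounds(2)[OF y k that] by simp
  qed auto
  have "(\<lambda>n. It x' n s k - It x' n r k) \<longlonglongrightarrow> y s k - y r k"
    using lim rs by (intro tendsto_intros) auto
  moreover have "(\<lambda>n. It x n s k - It x n r k) \<longlonglongrightarrow> regulator D K Q x s k - regulator D K Q x r k"
    using regulator_LIMSEQ[OF w k] rs by (intro tendsto_intros) auto
  moreover have "It x' n s k - It x' n r k \<le> It x n s k - It x n r k" for n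
    using It_increment_comparison[OF w y x' h k rs, of n] by auto
  ultimately show ?thesis by (intro LIMSEQ_le) auto
qed

end

section \<open>Consequences of complementarity\<close>

text \<open>The measure \<open>dy\<close> does not charge the set where \<open>z > 0\<close>, hence \<open>q * y\<close> cannot rise above the
  level \<open>q * y a + c\<close>, as \<open>z\<close> would be bounded away from 0 there.\<close>

lemma complementarity_increment_le:
  fixes y z :: "real \<Rightarrow> real"
  assumes q: "0 < q" and mono: "mono_on {0..} y"
    and cont: "\<And>t. 0 \<le> t \<Longrightarrow> (y \<longlongrightarrow> y t) (at_right t)"
    and comp: "(\<integral>\<^sup>+t\<in>{0..}. ennreal (z t) \<partial>interval_measure (\<lambda>t. y (max 0 t))) = 0"
    and a: "0 \<le> a" "a \<le> t" and c: "0 \<le> c"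
    and z: "\<And>s. a \<le> s \<Longrightarrow> s \<le> t \<Longrightarrow> q * (y s - y a) \<le> c + z s"
  shows "q * (y t - y a) \<le> c"
proof (rule ccontr)
  assume "\<not> q * (y t - y a) \<le> c"
  \<comment> \<open>The gap between \<open>c\<close> and \<open>c'\<close> keeps \<open>z\<close>
    above the positive number \<open>c' - c\<close> from the time \<open>b\<close> on at which the
    level \<open>c'\<close> is reached.\<close>
  then obtain c' where c': "c < c'" "c' < q * (y t - y a)" using dense[of c] by (auto simp: not_le)
  define F where "F = (\<lambda>t. y (max 0 t))"
  let ?I = "interval_measure F"
  have F_mono: "F r \<le> F s" if "r \<le> s" for r s
    using that mono unfolding F_def by (auto simp: mono_on_def)
  have F_cont: "continuous (at_right x) F" for x
  proof (cases "x < 0")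
    case True
    have "eventually (\<lambda>s. s \<in> {..<0}) (at_right x)"
      using True by (intro eventually_at_right_less[THEN eventually_mono] order_tendstoD(2)[OF tendsto_ident_at, of x 0, THEN eventually_mono]) auto
    then have "eventually (\<lambda>s. F s = F x) (at_right x)"
      by eventually_elim (use True in \<open>auto simp: F_def\<close>)
    then show ?thesis unfolding continuous_within by (rule tendsto_eventually)
  next
    case False
    then have "(y \<longlongrightarrow> F x) (at_right x)" using cont[of x] by (simp add: F_def)
    moreover have "eventually (\<lambda>s. y s = F s) (at_right x)"
      using eventually_at_right_less[of x] by eventually_elim (use False in \<open>auto simp: F_def\<close>)
    ultimately show ?thesis unfolding continuous_within by (rule Lim_transform_eventually)
  qed
  note Ioc = emeasure_interval_measure_Ioc[OF _ F_mono F_cont]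
  define S where "S = {s\<in>{a..t}. c' \<le> q * (y s - y a)}"
  define b where "b = Inf S"
  have tS: "t \<in> S" using a c' by (auto simp: S_def)
  have bS: "bdd_below S" by (auto simp: S_def)
  have b: "a \<le> b" "b \<le> t"
    using tS bS by (auto simp: b_def S_def intro: cInf_greatest cInf_lower)
  have "b \<in> S"
  proof (rule ccontr)
    assume "b \<notin> S"
    then have lt: "q * (y b - y a) < c'" using b by (auto simp: S_def)
    have "((\<lambda>s. q * (y s - y a)) \<longlongrightarrow> q * (y b - y a)) (at_right b)"
      using cont[of b] a b by (intro tendsto_intros) auto
    from order_tendstoD(2)[OF this lt] obtain e where e: "e > b" "\<And>s. b < s \<Longrightarrow> s < e \<Longrightarrow> q * (y s - y a) < c'"
      unfolding eventually_at_right_field by blast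
    obtain s where s: "s \<in> S" "s < e" using e(1) cInf_lessD[of S e] tS by (auto simp: b_def)
    have "b \<le> s" unfolding b_def using s bS by (auto intro: cInf_lower)
    with \<open>b \<notin> S\<close> s have "b < s" by (cases "b = s") auto
    from e(2)[OF this s(2)] s show False by (auto simp: S_def)
  qed
  then have qb: "c' \<le> q * (y b - y a)" by (simp add: S_def)
  have "a \<noteq> b" using qb c c' by auto
  with b have ab: "a < b" by simp
  have below: "q * (y s - y a) < c'" if "a \<le> s" "s < b" for s
    using that b bS cInf_lower[of s S] by (force simp: S_def b_def)
  have above: "c' - c \<le> z s" if "b \<le> s" "s \<le> t" for s
  proof -
    have "y b \<le> y s" using mono that a b by (auto simp: mono_on_def)
    then have "q * (y b - y a) \<le> q * (y s - y a)" using q by simp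
    with qb z[of s] that b show ?thesis by simp
  qed
  have "(\<integral>\<^sup>+s. ennreal (c' - c) * indicator {b..t} s \<partial>?I) \<le> (\<integral>\<^sup>+s\<in>{0..}. ennreal (z s) \<partial>?I)"
    using above a b by (intro nn_integral_mono) (auto simp: indicator_def intro!: ennreal_leI)
  then have "ennreal (c' - c) * emeasure ?I {b..t} = 0"
    using comp by (simp add: F_def nn_integral_cmult)
  \<comment> \<open>The closed interval includes a possible jump of \<open>y\<close> at
    \<open>b\<close>. What is left is the growth before \<open>b\<close>, which is at most
    \<open>c' / q\<close>.\<close>
  then have null: "emeasure ?I {b..t} = 0" using c' by (simp add: ennreal_eq_0_iff)
  have "emeasure ?I {a<..<b} \<le> ennreal (c' / q)"
  proof -
    have "{a<..<b} = (\<Union>n. {a<..b - inverse (Suc n)})"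
    proof (intro equalityI subsetI)
      fix s assume "s \<in> {a<..<b}"
      then have s: "a < s" "0 < b - s" by auto
      from reals_Archimedean[OF s(2)] obtain n where "inverse (Suc n) < b - s" by auto
      with s show "s \<in> (\<Union>n. {a<..b - inverse (Suc n)})" by (auto intro!: exI[of _ n])
    next
      fix s assume "s \<in> (\<Union>n. {a<..b - inverse (Suc n)})"
      then obtain n where "a < s" "s \<le> b - inverse (Suc n)" by auto
      then show "s \<in> {a<..<b}" by (smt (verit) greaterThanLessThan_iff inverse_positive_iff_positive of_nat_0_less_iff zero_less_Suc)
    qed
    then have "emeasure ?I {a<..<b} = (SUP n. emeasure ?I {a<..b - inverse (Suc n)})"
      by (subst SUP_emeasure_incseq) (auto simp: incseq_def intro!: diff_left_mono le_imp_inverse_le elim!: order_trans)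
    also have "\<dots> \<le> ennreal (c' / q)"
    proof (rule SUP_least)
      fix n
      define s where "s = b - inverse (Suc n)"
      have "s < b" by (simp add: s_def)
      show "emeasure ?I {a<..b - inverse (Suc n)} \<le> ennreal (c' / q)"
      proof (cases "a \<le> s")
        case True
        have "y s - y a \<le> c' / q" using below[OF True \<open>s < b\<close>] q by (simp add: field_simps)
        then show ?thesis using Ioc[OF True] True a unfolding s_def[symmetric]
          by (auto simp: F_def intro!: ennreal_leI)
      next
        case False
        then have "{a<..b - inverse (Suc n)} = {}" by (auto simp: s_def)
        then show ?thesis by (simp only: emeasure_empty zero_le)
      qed
    qed
    finally show ?thesis .
  qed
  moreover have "{a<..t} = {a<..<b} \<union> {b..t}" using ab b by auto
  moreover have "emeasure ?I ({a<..<b} \<union> {b..t}) \<le> emeasure ?I {a<..<b} + emeasure ?I {b..t}"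
    by (intro emeasure_subadditive) auto
  ultimately have "emeasure ?I {a<..t} \<le> ennreal (c' / q)" using null by simp
  then have "ennreal (y t - y a) \<le> ennreal (c' / q)"
    using Ioc[OF a(2)] a by (simp add: F_def)
  then have "y t - y a \<le> c' / q" using c c' q by (subst (asm) ennreal_le_iff) auto
  with c' q show False by (simp add: field_simps)
qed

section \<open>Bounds along a single reflected path\<close>

locale reflected_path =
  fixes K :: "nat set" and Q :: "nat \<Rightarrow> nat \<Rightarrow> real" and x z y :: "real \<Rightarrow> nat \<Rightarrow> real"
  assumes finite_K: "finite K"
    and M_matrix: "M_matrix_on K Q"
    and x_cadlag: "x \<in> cadlag_paths K" and z_cadlag: "z \<in> cadlag_paths K" and y_cadlag: "y \<in> cadlag_paths K"
    and nonneg: "\<And>i t. i \<in> K \<Longrightarrow> 0 \<le> t \<Longrightarrow> 0 \<le> z t i \<and> 0 \<le> y t i"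
    and zxy: "\<And>i t. i \<in> K \<Longrightarrow> 0 \<le> t \<Longrightarrow> z t i = x t i + (\<Sum>k\<in>K. Q i k * y t k)"
    and y_mono: "\<And>i. i \<in> K \<Longrightarrow> mono_on {0..} (\<lambda>t. y t i)"
    and y_0: "\<And>i. i \<in> K \<Longrightarrow> y 0 i = 0"
    and complementarity: "\<And>i. i \<in> K \<Longrightarrow>
      (\<integral>\<^sup>+t\<in>{0..}. ennreal (z t i) \<partial>interval_measure (\<lambda>t. y (max 0 t) i)) = 0"
begin

lemma Q_off_diag: "k \<in> K \<Longrightarrow> l \<in> K \<Longrightarrow> k \<noteq> l \<Longrightarrow> Q k l \<le> 0"
  using M_matrix_off_diagonal[OF M_matrix] by blast

lemma Q_diag:
  assumes "k \<in> K"
  shows "0 < Q k k"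
proof -
  obtain v where v: "\<And>k. k \<in> K \<Longrightarrow> 0 < v k \<and> 1 \<le> (\<Sum>l\<in>K. Q k l * v l)"
    using M_matrix_positive_vector[OF finite_K M_matrix] by blast
  have "(\<Sum>l\<in>K. Q k l * v l) = Q k k * v k + (\<Sum>l\<in>K - {k}. Q k l * v l)"
    using assms finite_K by (simp add: sum.remove)
  moreover have "(\<Sum>l\<in>K - {k}. Q k l * v l) \<le> 0"
    using v Q_off_diag[OF assms] by (intro sum_nonpos mult_nonpos_nonneg) (auto intro: less_imp_le)
  ultimately have "0 < Q k k * v k" using v[OF assms] by linarith
  then show ?thesis using v[OF assms] by (simp add: zero_less_mult_iff)
qed

lemma right_continuous:
  assumes "w \<in> cadlag_paths K" "i \<in> K" "0 \<le> t"
  shows "((\<lambda>s. w s i) \<longlongrightarrow> w t i) (at_right t)"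
  using assms unfolding cadlag_paths_def by auto

lemma y_monoD: "k \<in> K \<Longrightarrow> 0 \<le> r \<Longrightarrow> r \<le> s \<Longrightarrow> y r k \<le> y s k"
  using y_mono[of k] by (auto simp: mono_on_def)

lemma increment_le:
  assumes "k \<in> K" "0 \<le> a" "a \<le> t" "0 \<le> c"
    and "\<And>s. a \<le> s \<Longrightarrow> s \<le> t \<Longrightarrow> Q k k * (y s k - y a k) \<le> c + z s k"
  shows "Q k k * (y t k - y a k) \<le> c"
  using complementarity_increment_le[OF Q_diag[OF assms(1)] y_mono[OF assms(1)]
      right_continuous[OF y_cadlag assms(1)] complementarity[OF assms(1)] assms(2-)] .

text \<open>The amount by which the other regulators have pushed coordinate \<open>k\<close> down by
  time \<open>t\<close>.\<close>

definition pushing :: "nat \<Rightarrow> real \<Rightarrow> real" where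
  "pushing k t = (\<Sum>l\<in>K - {k}. - Q k l * y t l)"

lemma z_eq_pushing: "k \<in> K \<Longrightarrow> 0 \<le> t \<Longrightarrow> z t k = x t k - pushing k t + Q k k * y t k"
  using zxy[of k t] finite_K by (simp add: pushing_def sum.remove sum_negf)

lemma pushing_mono: "k \<in> K \<Longrightarrow> 0 \<le> r \<Longrightarrow> r \<le> s \<Longrightarrow> pushing k r \<le> pushing k s"
  unfolding pushing_def using y_monoD Q_off_diag[of k] by (intro sum_mono mult_left_mono) auto

text \<open>The other regulators only lower coordinate \<open>k\<close>. In the bound on its own
  regulator, the pushing at earlier times is replaced by the larger value at \<open>t\<close>, which
  then cancels against the pushing contained in \<open>z t k\<close>.\<close>

lemma coordinate_upper_bound:
  assumes k: "k \<in> K" and t: "0 \<le> t"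
    and M: "x t k \<le> M" "\<And>s. 0 \<le> s \<Longrightarrow> s \<le> t \<Longrightarrow> x t k - x s k \<le> M"
  shows "z t k \<le> M"
proof -
  have p0: "pushing k 0 = 0" by (simp add: pushing_def y_0)
  have pt: "0 \<le> pushing k t" using pushing_mono[OF k, of 0 t] t by (simp add: p0)
  have "Q k k * (y t k - y 0 k) \<le> M - x t k + pushing k t"
  proof (rule increment_le[OF k _ t])
    fix s assume s: "0 \<le> s" "s \<le> t"
    show "Q k k * (y s k - y 0 k) \<le> M - x t k + pushing k t + z s k"
      using z_eq_pushing[OF k s(1)] M(2)[OF s] pushing_mono[OF k s] y_0[OF k] by simp
  qed (use M pt in auto)
  then show ?thesis using z_eq_pushing[OF k t] y_0[OF k] by simp
qed

text \<open>From \<open>s\<close> to \<open>t\<close> the coordinate's own regulator can only add,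
  and \<open>z s k\<close> is nonnegative. The loss against the free driver is the pushing since
  \<open>r\<close>, uniformly over \<open>s\<close> in the window; this is why increments over
  windows are to be estimated.\<close>

lemma coordinate_lower_bound:
  assumes k: "k \<in> K" and s: "0 \<le> r" "r \<le> s" "s \<le> t"
  shows "x t k - x s k - (pushing k t - pushing k r) \<le> z t k"
proof -
  have "Q k k * y s k \<le> Q k k * y t k"
    using y_monoD[OF k, of s t] s Q_diag[OF k] by (intro mult_left_mono) auto
  then show ?thesis
    using z_eq_pushing[OF k, of s] z_eq_pushing[OF k, of t] pushing_mono[OF k, of r s] nonneg[OF k, of s] s
    by linarith
qed

text \<open>After time \<open>a\<close> the increments of \<open>y\<close> solve the problem with
  start \<open>z a\<close> instead of 0, and a lower start needs at least as much regulation in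
  every later window. As the comparison is made on \<open>D\<close>, minimality has to be brought
  from continuous time to \<open>D\<close>.\<close>

lemma increment_le_restarted_regulator:
  assumes D: "D \<subseteq> {0..}" "\<exists>b\<in>D. \<forall>s\<in>D. s \<le> b"
    and dense: "\<And>r e s. 0 \<le> r \<Longrightarrow> r < e \<Longrightarrow> e \<le> s \<Longrightarrow> s \<in> D \<Longrightarrow> \<exists>d\<in>D. r < d \<and> d < e"
    and a: "0 \<le> a"
    and w: "regulator_bound D K Q (\<lambda>s k. x (a + s) k - x a k) w"
    and k: "k \<in> K" and rs: "r \<in> D" "s \<in> D" "r \<le> s"
  shows "y (a + s) k - y (a + r) k \<le>
     regulator D K Q (\<lambda>s k. x (a + s) k - x a k) s k - regulator D K Q (\<lambda>s k. x (a + s) k - x a k) r k"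
proof -
  interpret reflection_matrix K Q D
    using finite_K Q_diag Q_off_diag D(2) by unfold_locales auto
  define x' where "x' = (\<lambda>s k. z a k + (x (a + s) k - x a k))"
  define y' where "y' = (\<lambda>s k. y (a + s) k - y a k)"
  have Qy': "x' s k + (\<Sum>l\<in>K. Q k l * y' s l) = z (a + s) k" if "k \<in> K" "0 \<le> s" for s k
    using zxy[OF that(1), of a] zxy[OF that(1), of "a + s"] a that
    by (simp add: x'_def y'_def right_diff_distrib sum_subtractf)
  have dem: "demand x' y' s k = Q k k * (y (a + s) k - y a k) - z (a + s) k" if "k \<in> K" "0 \<le> s" for s k
  proof -
    have "(\<Sum>l\<in>K. Q k l * y' s l) = Q k k * y' s k + (\<Sum>l\<in>K - {k}. Q k l * y' s l)"
      using that finite_K by (simp add: sum.remove)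
    then show ?thesis using Qy'[OF that] by (simp add: demand_def y'_def)
  qed
  obtain v where v: "\<And>k. k \<in> K \<Longrightarrow> 0 < v k \<and> 1 \<le> (\<Sum>l\<in>K. Q k l * v l)"
    using M_matrix_positive_vector[OF finite_K M_matrix] by blast
  have "y' s k - y' r k \<le>
     regulator D K Q (\<lambda>s k. x (a + s) k - x a k) s k - regulator D K Q (\<lambda>s k. x (a + s) k - x a k) r k"
  proof (rule regulator_increment_comparison[OF w, where x' = x' and h = "z a" and v = v])
    show "regulator_bound D K Q x' y'"
      unfolding regulator_bound_def
    proof (intro conjI ballI impI)
      fix k s assume ks: "k \<in> K" "s \<in> D"
      then have s: "0 \<le> s" using D by auto
      show "0 \<le> y' s k" using y_monoD[OF ks(1) a, of "a + s"] s by (simp add: y'_def)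
      show "0 \<le> x' s k + (\<Sum>l\<in>K. Q k l * y' s l)"
        unfolding Qy'[OF ks(1) s] using nonneg[OF ks(1), of "a + s"] a s by simp
    next
      fix k r s assume "k \<in> K" "r \<in> D" "s \<in> D" "r \<le> s"
      then show "y' r k \<le> y' s k" using y_monoD[of k "a + r" "a + s"] a D by (auto simp: y'_def)
    qed
    fix k s c assume k: "k \<in> K" and s: "s \<in> D" and c: "0 \<le> c"
      and le: "\<And>r. r \<in> D \<Longrightarrow> r \<le> s \<Longrightarrow> demand x' y' r k \<le> c"
    have s0: "0 \<le> s" using s D by auto
    show "Q k k * y' s k \<le> c"
      unfolding y'_def
    proof (rule increment_le[OF k a _ c])
      fix q assume q: "a \<le> q" "q \<le> a + s"
      have "demand x' y' (q - a) k \<le> c"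
      proof (cases "q - a \<in> D")
        case True
        then show ?thesis using le[of "q - a"] q by simp
      next
        case False
        with s have "q - a \<noteq> s" by auto
        with q have qs: "q - a < s" by simp
        \<comment> \<open>The demand is controlled at times in \<open>D\<close> only. A violation at
          another time would persist on a right neighbourhood, by right-continuity, and
          \<open>D\<close> meets that neighbourhood.\<close>
        have lim: "((\<lambda>r. Q k k * (y r k - y a k) - z r k) \<longlongrightarrow> Q k k * (y q k - y a k) - z q k) (at_right q)"
          using q a by (intro tendsto_intros right_continuous[OF y_cadlag k] right_continuous[OF z_cadlag k]) auto
        show ?thesis
        proof (rule ccontr)
          assume "\<not> demand x' y' (q - a) k \<le> c"
          then have "c < Q k k * (y q k - y a k) - z q k" using dem[OF k, of "q - a"] q by simp
          from order_tendstoD(1)[OF lim this] obtain e where e: "e > q"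
            "\<And>r. q < r \<Longrightarrow> r < e \<Longrightarrow> c < Q k k * (y r k - y a k) - z r k"
            unfolding eventually_at_right_field by blast
          obtain d where d: "d \<in> D" "q - a < d" "d < min (e - a) s"
            using dense[of "q - a" "min (e - a) s" s] q qs e(1) s by auto
          have "c < Q k k * (y (a + d) k - y a k) - z (a + d) k" using e(2)[of "a + d"] d by auto
          also have "\<dots> = demand x' y' d k" using dem[OF k, of d] d q by simp
          also have "\<dots> \<le> c" using le[of d] d by simp
          finally show False by simp
        qed
      qed
      then show "Q k k * (y q k - y a k) \<le> c + z q k" using dem[OF k, of "q - a"] q by simp
    qed (use s0 in auto)
  qed (use v nonneg[OF _ a] k rs in \<open>force simp: x'_def\<close>)+
  then show ?thesis by (simp add: y'_def)
qed

end

lemma is_reflection_of_reflected_path: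
  assumes "finite K" "M_matrix_on K Q" "is_reflection_of K Q x z"
  obtains y where "reflected_path K Q x z y"
  using assms unfolding is_reflection_of_def reflected_path_def by blast

section \<open>Tails of the Lindley recursion\<close>

primrec lindley :: "(nat \<Rightarrow> real) \<Rightarrow> nat \<Rightarrow> real" where
  "lindley u 0 = 0"
| "lindley u (Suc n) = max 0 (lindley u n + u n)"

lemma lindley_nonneg: "0 \<le> lindley u n"
  by (cases n) auto

lemma sum_le_lindley: "m \<le> n \<Longrightarrow> sum u {m..<n} \<le> lindley u n"
proof (induction n)
  case (Suc n)
  then show ?case by (cases "m = Suc n") (auto simp: le_Suc_eq)
qed simp

text \<open>\<open>m\<close> is the last time at which the cut at 0 has been active, or 0 if there
  is none. With \<open>sum_le_lindley\<close> this makes the recursion a maximum of partial sums,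
  the discrete reflection formula.\<close>

lemma lindley_eq_sum: "\<exists>m\<le>n. lindley u n = sum u {m..<n}"
proof (induction n)
  case (Suc n)
  then obtain m where m: "m \<le> n" "lindley u n = sum u {m..<n}" by blast
  show ?case
  proof (cases "0 \<le> lindley u n + u n")
    case True
    with m show ?thesis by (intro exI[of _ m]) auto
  next
    case False
    then show ?thesis by (intro exI[of _ "Suc n"]) auto
  qed
qed simp

lemma lindley_cong: "(\<And>i. i < n \<Longrightarrow> u i = u' i) \<Longrightarrow> lindley u n = lindley u' n"
  by (induction n) auto

lemma borel_measurable_lindley:
  assumes "\<And>i. i < n \<Longrightarrow> (\<lambda>\<omega>. u \<omega> i) \<in> borel_measurable M"
  shows "(\<lambda>\<omega>. lindley (u \<omega>) n) \<in> borel_measurable M"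
  using assms by (induction n) (auto intro!: borel_measurable_max borel_measurable_add)

context prob_space
begin

text \<open>Fubini: given \<open>Y\<close>, the event asks \<open>R\<close> to exceed
  \<open>x - Y\<close>. The inner probability is measurable because it is monotone in the
  level.\<close>

lemma prob_less_indep_sum:
  fixes R Y :: "'a \<Rightarrow> real"
  assumes ind: "indep_var borel R borel Y"
  shows "integrable M (\<lambda>\<omega>. prob {\<omega>'\<in>space M. x - Y \<omega> < R \<omega>'})" (is ?I)
    and "\<P>(\<omega> in M. x < R \<omega> + Y \<omega>) = (\<integral>\<omega>. prob {\<omega>'\<in>space M. x - Y \<omega> < R \<omega>'} \<partial>M)" (is ?E)
proof -
  have [measurable]: "R \<in> borel_measurable M" "Y \<in> borel_measurable M"
    using indep_var_rv1[OF ind] indep_var_rv2[OF ind] by auto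
  define f where "f y = prob {\<omega>'\<in>space M. y < R \<omega>'}" for y :: real
  have "mono (\<lambda>y. - f y)" unfolding f_def by (intro monoI) (auto intro!: finite_measure_mono)
  then have "(\<lambda>y. - f y) \<in> borel_measurable borel" by (rule borel_measurable_mono)
  then have f[measurable]: "f \<in> borel_measurable borel" using borel_measurable_uminus_eq by blast
  have int: "integrable M (\<lambda>\<omega>. f (x - Y \<omega>))"
    by (rule integrable_const_bound[of _ 1]) (auto simp: f_def)
  then show ?I by (simp add: f_def)
  interpret R: prob_space "distr M borel R" by (rule prob_space_distr) simp
  interpret Y: prob_space "distr M borel Y" by (rule prob_space_distr) simp
  interpret pair_sigma_finite "distr M borel R" "distr M borel Y" ..
  let ?A = "{p :: real \<times> real. x < fst p + snd p}"
  have "{p \<in> space (borel \<Otimes>\<^sub>M borel). x < fst p + snd p} \<in> sets (borel \<Otimes>\<^sub>M (borel :: real measure))"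
    by measurable
  then have A[measurable, simp]: "?A \<in> sets (borel \<Otimes>\<^sub>M borel)" by (simp add: space_pair_measure)
  have "emeasure M {\<omega>\<in>space M. x < R \<omega> + Y \<omega>}
      = emeasure (distr M (borel \<Otimes>\<^sub>M borel) (\<lambda>\<omega>. (R \<omega>, Y \<omega>))) ?A"
    by (subst emeasure_distr) (auto intro!: arg_cong[where f="emeasure M"])
  also have "distr M (borel \<Otimes>\<^sub>M borel) (\<lambda>\<omega>. (R \<omega>, Y \<omega>)) = distr M borel R \<Otimes>\<^sub>M distr M borel Y"
    using ind unfolding indep_var_distribution_eq by simp
  also have "emeasure \<dots> ?A = (\<integral>\<^sup>+y. emeasure (distr M borel R) ((\<lambda>r. (r, y)) -` ?A) \<partial>distr M borel Y)"
    by (rule emeasure_pair_measure_alt2) (simp add: sets_pair_measure_cong[of "distr M borel R" borel "distr M borel Y" borel])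
  also have "\<dots> = (\<integral>\<^sup>+\<omega>. emeasure (distr M borel R) ((\<lambda>r. (r, Y \<omega>)) -` ?A) \<partial>M)"
    by (subst nn_integral_distr) (auto intro!: measurable_emeasure_Pair2)
  also have "\<dots> = (\<integral>\<^sup>+\<omega>. ennreal (f (x - Y \<omega>)) \<partial>M)"
  proof (rule nn_integral_cong)
    fix \<omega>
    have "(\<lambda>r. (r, Y \<omega>)) -` ?A = {x - Y \<omega> <..}" by auto
    then have "emeasure (distr M borel R) ((\<lambda>r. (r, Y \<omega>)) -` ?A) = emeasure M (R -` {x - Y \<omega> <..} \<inter> space M)"
      by (simp add: emeasure_distr)
    also have "R -` {x - Y \<omega> <..} \<inter> space M = {\<omega>'\<in>space M. x - Y \<omega> < R \<omega>'}" by auto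
    finally show "emeasure (distr M borel R) ((\<lambda>r. (r, Y \<omega>)) -` ?A) = ennreal (f (x - Y \<omega>))"
      by (simp add: emeasure_eq_measure f_def)
  qed
  also have "\<dots> = ennreal (\<integral>\<omega>. f (x - Y \<omega>) \<partial>M)"
    using int by (rule nn_integral_eq_integral) (simp add: f_def)
  finally have "ennreal (\<P>(\<omega> in M. x < R \<omega> + Y \<omega>)) = ennreal (\<integral>\<omega>. f (x - Y \<omega>) \<partial>M)"
    by (simp add: emeasure_eq_measure)
  then show ?E unfolding f_def by (subst (asm) ennreal_inj) (auto intro!: integral_nonneg_AE)
qed

text \<open>The exponential tail is preserved under adding \<open>Y\<close> when
  \<open>\<theta>\<close> is its Cramer exponent. Asking for the bound at negative levels too, where
  it is trivial if \<open>\<theta> \<ge> 0\<close>, allows integrating it without a case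
  distinction.\<close>

lemma exponential_tail_step:
  fixes R Y :: "'a \<Rightarrow> real"
  assumes ind: "indep_var borel R borel Y"
    and R: "\<And>y. \<P>(\<omega> in M. y < R \<omega>) \<le> exp (- \<theta> * y)"
    and Y: "integrable M (\<lambda>\<omega>. exp (\<theta> * Y \<omega>))" "expectation (\<lambda>\<omega>. exp (\<theta> * Y \<omega>)) = 1"
  shows "\<P>(\<omega> in M. x < R \<omega> + Y \<omega>) \<le> exp (- \<theta> * x)"
proof -
  have eq: "exp (- \<theta> * (x - Y \<omega>)) = exp (- \<theta> * x) * exp (\<theta> * Y \<omega>)" for \<omega>
    by (simp add: exp_add[symmetric] algebra_simps)
  have "integrable M (\<lambda>\<omega>. exp (- \<theta> * (x - Y \<omega>)))" unfolding eq using Y(1) by simp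
  then have "\<P>(\<omega> in M. x < R \<omega> + Y \<omega>) \<le> (\<integral>\<omega>. exp (- \<theta> * (x - Y \<omega>)) \<partial>M)"
    unfolding prob_less_indep_sum(2)[OF ind]
    by (intro integral_mono prob_less_indep_sum(1)[OF ind] R)
  also have "\<dots> = exp (- \<theta> * x)" unfolding eq using Y by simp
  finally show ?thesis .
qed

text \<open>The event \<open>Y > \<delta>\<close> accounts for overshooting the level 0 by more than \<open>\<delta>\<close>.\<close>

lemma exponential_tail_lower_step:
  fixes R Y :: "'a \<Rightarrow> real"
  assumes ind: "indep_var borel R borel Y" and nn: "\<And>\<omega>. \<omega> \<in> space M \<Longrightarrow> 0 \<le> R \<omega>"
    and R: "\<And>y. 0 \<le> y \<Longrightarrow> a * exp (- \<theta> * y) - b * exp (- \<kappa> * y) \<le> \<P>(\<omega> in M. y < R \<omega>)"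
    and a: "a \<le> exp (- \<theta> * \<delta>)" and b: "0 \<le> b" and pos: "0 \<le> \<theta>" "0 \<le> \<delta>" "0 \<le> x"
    and Y: "integrable M (\<lambda>\<omega>. exp (\<theta> * Y \<omega>))" "expectation (\<lambda>\<omega>. exp (\<theta> * Y \<omega>)) = 1"
    and Y\<kappa>: "integrable M (\<lambda>\<omega>. exp (\<kappa> * Y \<omega>))" "expectation (\<lambda>\<omega>. exp (\<kappa> * Y \<omega>)) = \<rho>"
    and \<eta>: "expectation (\<lambda>\<omega>. exp (\<theta> * Y \<omega>) * indicator {\<delta><..} (Y \<omega>)) \<le> \<eta>"
  shows "(a - exp (- \<theta> * \<delta>) * \<eta>) * exp (- \<theta> * x) - b * \<rho> * exp (- \<kappa> * x)
    \<le> \<P>(\<omega> in M. x < R \<omega> + Y \<omega>)"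
proof -
  have [measurable]: "R \<in> borel_measurable M" "Y \<in> borel_measurable M"
    using indep_var_rv1[OF ind] indep_var_rv2[OF ind] by auto
  define I where "I \<omega> = exp (\<theta> * Y \<omega>) * indicator {\<delta><..} (Y \<omega>)" for \<omega>
  have I: "integrable M I" unfolding I_def
    by (rule Bochner_Integration.integrable_bound[OF Y(1)]) (auto simp: indicator_def)
  \<comment> \<open>At nonnegative levels \<open>x - Y\<close> the bound for \<open>R\<close>
    applies. At negative ones the probability is 1: if \<open>Y \<le> \<delta>\<close>, the
    assumption on \<open>a\<close> keeps the bound below 1; if \<open>Y > \<delta>\<close>, the last
    term of \<open>g\<close> cancels the main one.\<close>
  define g where "g \<omega> = (a * exp (- \<theta> * x)) * exp (\<theta> * Y \<omega>) - (b * exp (- \<kappa> * x)) * exp (\<kappa> * Y \<omega>)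
      - (exp (- \<theta> * \<delta>) * exp (- \<theta> * x)) * I \<omega>" for \<omega>
  have le: "g \<omega> \<le> prob {\<omega>'\<in>space M. x - Y \<omega> < R \<omega>'}" for \<omega>
  proof -
    define y where "y = x - Y \<omega>"
    have ey: "exp (- \<theta> * x) * exp (\<theta> * Y \<omega>) = exp (- \<theta> * y)" "exp (- \<kappa> * x) * exp (\<kappa> * Y \<omega>) = exp (- \<kappa> * y)"
      by (simp_all add: exp_add[symmetric] algebra_simps y_def)
    have g: "g \<omega> = a * exp (- \<theta> * y) - b * exp (- \<kappa> * y)
        - exp (- \<theta> * \<delta>) * exp (- \<theta> * y) * indicator {\<delta><..} (Y \<omega>)"
      unfolding g_def I_def ey[symmetric] by (simp add: algebra_simps)
    show ?thesis
    proof (cases "0 \<le> y")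
      case True
      have "0 \<le> exp (- \<theta> * \<delta>) * exp (- \<theta> * y) * indicator {\<delta><..} (Y \<omega>)" by simp
      with R[OF True] g show ?thesis unfolding y_def[symmetric] by linarith
    next
      case False
      have "{\<omega>'\<in>space M. x - Y \<omega> < R \<omega>'} = space M"
        using nn False unfolding y_def[symmetric] by force
      then have p: "prob {\<omega>'\<in>space M. x - Y \<omega> < R \<omega>'} = 1" by (simp add: prob_space)
      have ae: "a * exp (- \<theta> * y) \<le> exp (- \<theta> * \<delta>) * exp (- \<theta> * y)"
        using a by (intro mult_right_mono) auto
      have b0: "0 \<le> b * exp (- \<kappa> * y)" using b by simp
      show ?thesis
      proof (cases "\<delta> < Y \<omega>")
        case True
        then have "g \<omega> = a * exp (- \<theta> * y) - b * exp (- \<kappa> * y) - exp (- \<theta> * \<delta>) * exp (- \<theta> * y)"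
          using g by simp
        with ae b0 p show ?thesis by linarith
      next
        case False
        have "exp (- \<theta> * \<delta>) * exp (- \<theta> * y) = exp (\<theta> * (- \<delta> - y))"
          by (simp add: exp_add[symmetric] algebra_simps)
        also have "\<dots> \<le> 1" using False pos by (simp add: y_def mult_nonneg_nonpos)
        finally have "exp (- \<theta> * \<delta>) * exp (- \<theta> * y) \<le> 1" .
        moreover have "g \<omega> = a * exp (- \<theta> * y) - b * exp (- \<kappa> * y)"
          using g False by simp
        ultimately show ?thesis using ae b0 p by linarith
      qed
    qed
  qed
  have gi: "integrable M g" unfolding g_def using Y Y\<kappa> I by simp
  have eg: "expectation g = a * exp (- \<theta> * x) - b * exp (- \<kappa> * x) * \<rho> - exp (- \<theta> * \<delta>) * exp (- \<theta> * x) * expectation I"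
    unfolding g_def using Y Y\<kappa> I by simp
  have "exp (- \<theta> * \<delta>) * exp (- \<theta> * x) * expectation I \<le> exp (- \<theta> * \<delta>) * exp (- \<theta> * x) * \<eta>"
    using \<eta> unfolding I_def by (intro mult_left_mono) auto
  then have "(a - exp (- \<theta> * \<delta>) * \<eta>) * exp (- \<theta> * x) - b * \<rho> * exp (- \<kappa> * x) \<le> expectation g"
    unfolding eg by (simp add: algebra_simps)
  also have "\<dots> \<le> \<P>(\<omega> in M. x < R \<omega> + Y \<omega>)"
    unfolding prob_less_indep_sum(2)[OF ind]
    by (intro integral_mono prob_less_indep_sum(1)[OF ind] gi le)
  finally show ?thesis .
qed

lemma indep_var_lindley:
  assumes ind: "indep_vars (\<lambda>_. borel) Y UNIV"
  shows "indep_var borel (\<lambda>\<omega>. lindley (\<lambda>i. Y i \<omega>) n) borel (Y n)"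
proof -
  have "indep_var (Pi\<^sub>M {..<n} (\<lambda>_. borel)) (\<lambda>\<omega>. restrict (\<lambda>i. Y i \<omega>) {..<n})
      (Pi\<^sub>M {n} (\<lambda>_. borel)) (\<lambda>\<omega>. restrict (\<lambda>i. Y i \<omega>) {n})"
    by (rule indep_var_restrict[OF ind]) auto
  moreover have "(\<lambda>u. lindley u n) \<in> borel_measurable (Pi\<^sub>M {..<n} (\<lambda>_. borel))"
    by (rule borel_measurable_lindley) (rule measurable_component_singleton, simp)
  moreover have "(\<lambda>u. u n) \<in> borel_measurable (Pi\<^sub>M {n} (\<lambda>_. borel))"
    by (rule measurable_component_singleton) simp
  ultimately have "indep_var borel ((\<lambda>u. lindley u n) \<circ> (\<lambda>\<omega>. restrict (\<lambda>i. Y i \<omega>) {..<n}))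
      borel ((\<lambda>u. u n) \<circ> (\<lambda>\<omega>. restrict (\<lambda>i. Y i \<omega>) {n}))"
    by (rule indep_var_compose)
  moreover have "(\<lambda>u. lindley u n) \<circ> (\<lambda>\<omega>. restrict (\<lambda>i. Y i \<omega>) {..<n}) = (\<lambda>\<omega>. lindley (\<lambda>i. Y i \<omega>) n)"
    by (auto simp: fun_eq_iff intro: lindley_cong)
  ultimately show ?thesis by (simp add: comp_def)
qed

lemma lindley_tail_le:
  assumes ind: "indep_vars (\<lambda>_. borel) Y UNIV" and "0 \<le> \<theta>"
    and Y: "\<And>i. integrable M (\<lambda>\<omega>. exp (\<theta> * Y i \<omega>))" "\<And>i. expectation (\<lambda>\<omega>. exp (\<theta> * Y i \<omega>)) = 1"
  shows "\<P>(\<omega> in M. x < lindley (\<lambda>i. Y i \<omega>) n) \<le> exp (- \<theta> * x)"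
proof (induction n arbitrary: x)
  case 0
  show ?case using \<open>0 \<le> \<theta>\<close>
    by (cases "x < 0") (auto simp: prob_space mult_nonneg_nonpos zero_le_mult_iff)
next
  case (Suc n)
  show ?case
  proof (cases "x < 0")
    case True
    then have "1 \<le> exp (- \<theta> * x)" using \<open>0 \<le> \<theta>\<close> by (simp add: mult_nonneg_nonpos)
    then show ?thesis by (meson order_trans prob_le_1)
  next
    case False
    then have "{\<omega>\<in>space M. x < lindley (\<lambda>i. Y i \<omega>) (Suc n)} =
      {\<omega>\<in>space M. x < lindley (\<lambda>i. Y i \<omega>) n + Y n \<omega>}" by auto
    then show ?thesis using exponential_tail_step[OF indep_var_lindley[OF ind] Suc Y] by simp
  qed
qed

text \<open>At \<open>n = 0\<close> there is no mass above \<open>x\<close>, so the bound must start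
  nonpositive; subtracting \<open>exp (- \<kappa> * x)\<close> with
  \<open>\<kappa> \<le> \<theta>\<close> achieves this. That term is multiplied by
  \<open>\<rho>\<close> in each step, which is below 1 in the application, whereas the main term
  loses only the overshoot error \<open>\<eta>\<close>.\<close>

lemma lindley_tail_ge:
  assumes ind: "indep_vars (\<lambda>_. borel) Y UNIV" and pos: "0 \<le> \<kappa>" "\<kappa> \<le> \<theta>" "0 \<le> \<delta>" "0 \<le> \<rho>" "0 \<le> \<eta>"
    and Y: "\<And>i. integrable M (\<lambda>\<omega>. exp (\<theta> * Y i \<omega>))" "\<And>i. expectation (\<lambda>\<omega>. exp (\<theta> * Y i \<omega>)) = 1"
    and Y\<kappa>: "\<And>i. integrable M (\<lambda>\<omega>. exp (\<kappa> * Y i \<omega>))" "\<And>i. expectation (\<lambda>\<omega>. exp (\<kappa> * Y i \<omega>)) = \<rho>"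
    and \<eta>: "\<And>i. expectation (\<lambda>\<omega>. exp (\<theta> * Y i \<omega>) * indicator {\<delta><..} (Y i \<omega>)) \<le> \<eta>"
    and "0 \<le> x"
  shows "exp (- \<theta> * \<delta>) * ((1 - n * \<eta>) * exp (- \<theta> * x) - \<rho> ^ n * exp (- \<kappa> * x))
    \<le> \<P>(\<omega> in M. x < lindley (\<lambda>i. Y i \<omega>) n)"
  using \<open>0 \<le> x\<close>
proof (induction n arbitrary: x)
  case 0
  then have "exp (- \<theta> * x) \<le> exp (- \<kappa> * x)" using pos by (simp add: mult_right_mono)
  with 0 show ?case by (simp add: mult_nonneg_nonpos)
next
  case (Suc n)
  have *: "{\<omega>\<in>space M. x < lindley (\<lambda>i. Y i \<omega>) (Suc n)} =
      {\<omega>\<in>space M. x < lindley (\<lambda>i. Y i \<omega>) n + Y n \<omega>}" using Suc by auto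
  have "(exp (- \<theta> * \<delta>) * (1 - n * \<eta>) - exp (- \<theta> * \<delta>) * \<eta>) * exp (- \<theta> * x)
      - exp (- \<theta> * \<delta>) * \<rho> ^ n * \<rho> * exp (- \<kappa> * x)
    \<le> \<P>(\<omega> in M. x < lindley (\<lambda>i. Y i \<omega>) n + Y n \<omega>)"
  proof (rule exponential_tail_lower_step[OF indep_var_lindley[OF ind] lindley_nonneg])
    show "exp (- \<theta> * \<delta>) * (1 - n * \<eta>) * exp (- \<theta> * y) - exp (- \<theta> * \<delta>) * \<rho> ^ n * exp (- \<kappa> * y)
        \<le> prob {\<omega> \<in> space M. y < lindley (\<lambda>i. Y i \<omega>) n}" if "0 \<le> y" for y
      using Suc.IH[OF that] by (simp add: algebra_simps)
    show "exp (- \<theta> * \<delta>) * (1 - n * \<eta>) \<le> exp (- \<theta> * \<delta>)"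
      using pos by (simp add: mult_left_le)
  qed (use pos Suc.prems Y Y\<kappa> \<eta> in auto)
  then show ?case unfolding * by (simp add: algebra_simps)
qed

lemma normal_exp_moment:
  assumes X: "distributed M lborel X (normal_density 0 s)" and s: "0 < s"
  shows "integrable M (\<lambda>\<omega>. exp (a * X \<omega>))" "expectation (\<lambda>\<omega>. exp (a * X \<omega>)) = exp (a\<^sup>2 * s\<^sup>2 / 2)"
proof -
  have eq: "normal_density 0 s x * exp (a * x) = exp (a\<^sup>2 * s\<^sup>2 / 2) * normal_density (a * s\<^sup>2) s x" for x
  proof -
    have "exp (- (x\<^sup>2 / (2 * s\<^sup>2))) * exp (a * x) = exp (a\<^sup>2 * s\<^sup>2 / 2) * exp (- ((x - a * s\<^sup>2)\<^sup>2 / (2 * s\<^sup>2)))"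
      using s unfolding exp_add[symmetric]
      by (intro arg_cong[where f=exp]) (simp add: field_simps power2_eq_square)
    then show ?thesis by (simp add: normal_density_def field_simps)
  qed
  have int: "integrable lborel (\<lambda>x. normal_density 0 s x * exp (a * x))"
    unfolding eq using s by simp
  then show "integrable M (\<lambda>\<omega>. exp (a * X \<omega>))"
    by (subst distributed_integrable[OF X, symmetric]) auto
  have "expectation (\<lambda>\<omega>. exp (a * X \<omega>)) = (\<integral>x. normal_density 0 s x * exp (a * x) \<partial>lborel)"
    by (subst distributed_integral[OF X]) auto
  also have "\<dots> = exp (a\<^sup>2 * s\<^sup>2 / 2)" unfolding eq using s by simp
  finally show "expectation (\<lambda>\<omega>. exp (a * X \<omega>)) = exp (a\<^sup>2 * s\<^sup>2 / 2)" .
qed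

end

section \<open>Suprema of Brownian motion with drift\<close>

definition grid_increment :: "real \<Rightarrow> real \<Rightarrow> (real \<Rightarrow> real) \<Rightarrow> real \<Rightarrow> real \<Rightarrow> nat \<Rightarrow> real" where
  "grid_increment \<sigma> \<mu> w c h m = \<sigma> * (w (c + real (Suc m) * h) - w (c + real m * h)) - \<mu> * h"

lemma sum_grid_increment:
  assumes "m \<le> n"
  shows "sum (grid_increment \<sigma> \<mu> w c h) {m..<n}
    = \<sigma> * (w (c + n * h) - w (c + m * h)) - \<mu> * ((real n - real m) * h)"
proof -
  have "sum (grid_increment \<sigma> \<mu> w c h) {m..<n}
      = \<sigma> * (\<Sum>i\<in>{m..<n}. w (c + real (Suc i) * h) - w (c + real i * h)) - (\<Sum>i\<in>{m..<n}. \<mu> * h)"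
    unfolding sum_distrib_left sum_subtractf[symmetric]
    by (intro sum.cong refl) (simp only: grid_increment_def)
  also have "(\<Sum>i\<in>{m..<n}. w (c + real (Suc i) * h) - w (c + real i * h)) = w (c + n * h) - w (c + m * h)"
    by (rule sum_Suc_diff'[OF assms])
  finally show ?thesis using assms by (simp add: of_nat_diff algebra_simps)
qed

lemma lindley_grid_increment_le:
  assumes "0 \<le> L" "\<And>m. m \<le> n \<Longrightarrow> \<sigma> * (w (c + n * h) - w (c + m * h)) - \<mu> * ((real n - real m) * h) \<le> L"
  shows "lindley (grid_increment \<sigma> \<mu> w c h) n \<le> L"
  using lindley_eq_sum[of n "grid_increment \<sigma> \<mu> w c h"] assms sum_grid_increment[of _ n \<sigma> \<mu> w c h] by auto

lemma le_lindley_grid_increment: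
  assumes "m \<le> n"
  shows "\<sigma> * (w (c + n * h) - w (c + m * h)) - \<mu> * ((real n - real m) * h)
    \<le> lindley (grid_increment \<sigma> \<mu> w c h) n"
  using sum_le_lindley[OF assms, of "grid_increment \<sigma> \<mu> w c h"] sum_grid_increment[OF assms, of \<sigma> \<mu> w c h] by simp

section \<open>Brownian motion with drift along a time grid\<close>

locale brownian_motion =
  fixes M :: "'a measure" and K :: "nat set" and W :: "real \<Rightarrow> 'a \<Rightarrow> nat \<Rightarrow> real"
  assumes BM: "standard_brownian_motion M K W"

sublocale brownian_motion \<subseteq> prob_space M
  using BM unfolding standard_brownian_motion_def by blast

context brownian_motion
begin

abbreviation "coord \<omega> i \<equiv> (\<lambda>t. W t \<omega> i)"

lemma measurable_W: "i \<in> K \<Longrightarrow> 0 \<le> t \<Longrightarrow> (\<lambda>\<omega>. W t \<omega> i) \<in> borel_measurable M"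
  using BM unfolding standard_brownian_motion_def by blast

lemma AE_continuous: "AE \<omega> in M. \<forall>i\<in>K. W 0 \<omega> i = 0 \<and> continuous_on {0..} (coord \<omega> i)"
  using BM unfolding standard_brownian_motion_def by blast

lemma increment_distributed:
  "i \<in> K \<Longrightarrow> 0 \<le> s \<Longrightarrow> s < t \<Longrightarrow>
    distributed M lborel (\<lambda>\<omega>. W t \<omega> i - W s \<omega> i) (normal_density 0 (sqrt (t - s)))"
  using BM unfolding standard_brownian_motion_def by blast

lemma grid_increments_indep:
  assumes i: "i \<in> K" and c: "0 \<le> c" and h: "0 < h"
  shows "indep_vars (\<lambda>_. borel) (\<lambda>n \<omega>. W (c + real (Suc n) * h) \<omega> i - W (c + real n * h) \<omega> i) UNIV"
proof -
  have "strict_mono (\<lambda>n. c + real n * h)" using h by (auto simp: strict_mono_def)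
  with c have pre: "0 \<le> (\<lambda>n. c + real n * h) 0 \<and> strict_mono (\<lambda>n. c + real n * h)" by simp
  have "\<forall>a :: nat \<Rightarrow> real. 0 \<le> a 0 \<and> strict_mono a \<longrightarrow>
      indep_vars (\<lambda>_. borel) (\<lambda>n \<omega>. W (a (Suc n)) \<omega> i - W (a n) \<omega> i) UNIV"
    using BM i unfolding standard_brownian_motion_def by blast
  from mp[OF spec[OF this] pre] show ?thesis .
qed

lemma grid_indep:
  assumes "i \<in> K" "0 \<le> c" "0 < h"
  shows "indep_vars (\<lambda>_. borel) (\<lambda>n \<omega>. grid_increment \<sigma> \<mu> (coord \<omega> i) c h n) UNIV"
  unfolding grid_increment_def
  by (rule indep_vars_compose2[OF grid_increments_indep[OF assms], where Y = "\<lambda>_ d. \<sigma> * d - \<mu> * h"]) simp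

lemma grid_exp_moment:
  assumes i: "i \<in> K" and c: "0 \<le> c" and h: "0 < h"
  shows "integrable M (\<lambda>\<omega>. exp (\<beta> * grid_increment \<sigma> \<mu> (coord \<omega> i) c h n))"
    and "expectation (\<lambda>\<omega>. exp (\<beta> * grid_increment \<sigma> \<mu> (coord \<omega> i) c h n))
      = exp ((\<beta>\<^sup>2 * \<sigma>\<^sup>2 / 2 - \<beta> * \<mu>) * h)"
proof -
  have D: "distributed M lborel (\<lambda>\<omega>. W (c + real (Suc n) * h) \<omega> i - W (c + real n * h) \<omega> i)
      (normal_density 0 (sqrt h))"
    using increment_distributed[OF i, of "c + real n * h" "c + real (Suc n) * h"] c h
    by (simp add: algebra_simps)
  note E = normal_exp_moment[OF D, of "\<beta> * \<sigma>"]
  have eq: "exp (\<beta> * grid_increment \<sigma> \<mu> (coord \<omega> i) c h n) =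
      exp (- \<beta> * \<mu> * h) * exp ((\<beta> * \<sigma>) * (W (c + real (Suc n) * h) \<omega> i - W (c + real n * h) \<omega> i))" for \<omega>
    unfolding grid_increment_def exp_add[symmetric] by (simp add: algebra_simps)
  show "integrable M (\<lambda>\<omega>. exp (\<beta> * grid_increment \<sigma> \<mu> (coord \<omega> i) c h n))"
    unfolding eq using E(1) h by simp
  have "expectation (\<lambda>\<omega>. exp (\<beta> * grid_increment \<sigma> \<mu> (coord \<omega> i) c h n))
      = exp (- \<beta> * \<mu> * h) * exp ((\<beta> * \<sigma>)\<^sup>2 * (sqrt h)\<^sup>2 / 2)"
    unfolding eq using E h by simp
  also have "\<dots> = exp ((\<beta>\<^sup>2 * \<sigma>\<^sup>2 / 2 - \<beta> * \<mu>) * h)"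
    using h unfolding exp_add[symmetric] by (simp add: algebra_simps power_mult_distrib)
  finally show "expectation (\<lambda>\<omega>. exp (\<beta> * grid_increment \<sigma> \<mu> (coord \<omega> i) c h n))
      = exp ((\<beta>\<^sup>2 * \<sigma>\<^sup>2 / 2 - \<beta> * \<mu>) * h)" .
qed

text \<open>The rate is the nonzero root of the exponent in \<open>grid_exp_moment\<close>. It is
  the same for every mesh \<open>h\<close>, so the bound survives refinement of the grid.\<close>

lemma grid_lindley_tail_le:
  assumes i: "i \<in> K" and c: "0 \<le> c" and h: "0 < h" and "\<sigma> \<noteq> 0" "0 < \<mu>"
  shows "\<P>(\<omega> in M. x < lindley (grid_increment \<sigma> \<mu> (coord \<omega> i) c h) n) \<le> exp (- (2 * \<mu> / \<sigma>\<^sup>2) * x)"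
proof (rule lindley_tail_le[OF grid_indep[OF i c h]])
  fix n
  have "(2 * \<mu> / \<sigma>\<^sup>2)\<^sup>2 * \<sigma>\<^sup>2 / 2 - (2 * \<mu> / \<sigma>\<^sup>2) * \<mu> = 0"
    using \<open>\<sigma> \<noteq> 0\<close> by (simp add: field_simps power2_eq_square)
  then show "expectation (\<lambda>\<omega>. exp (2 * \<mu> / \<sigma>\<^sup>2 * grid_increment \<sigma> \<mu> (coord \<omega> i) c h n)) = 1"
    unfolding grid_exp_moment(2)[OF i c h] by simp
  show "integrable M (\<lambda>\<omega>. exp (2 * \<mu> / \<sigma>\<^sup>2 * grid_increment \<sigma> \<mu> (coord \<omega> i) c h n))"
    by (rule grid_exp_moment(1)[OF i c h])
qed (use assms in auto)

text \<open>Taking \<open>\<kappa> = \<theta> / 2\<close> minimizes the exponent of the moment, and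
  the resulting \<open>\<rho> ^ n\<close> depends on \<open>T\<close> but not on the mesh. It is the
  price of starting the walk at 0 a time \<open>T\<close> ago.\<close>

lemma grid_lindley_tail_ge:
  assumes i: "i \<in> K" and T: "0 < T" "T \<le> t" and \<sigma>: "\<sigma> \<noteq> 0" and \<mu>: "0 < \<mu>" and \<delta>: "0 < \<delta>" and x: "0 \<le> x"
    and n: "0 < n" and \<theta>: "\<theta> = 2 * \<mu> / \<sigma>\<^sup>2"
    and h: "h = T / real n"
    and \<eta>: "\<eta> = exp (- \<delta> / sqrt h) * exp (((\<theta> + 1 / sqrt h)\<^sup>2 * \<sigma>\<^sup>2 / 2 - (\<theta> + 1 / sqrt h) * \<mu>) * h)"
  shows "exp (- \<theta> * \<delta>) * ((1 - n * \<eta>) * exp (- \<theta> * x) - exp (- (\<mu>\<^sup>2 * T / (2 * \<sigma>\<^sup>2))) * exp (- (\<theta> / 2) * x))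
    \<le> \<P>(\<omega> in M. x < lindley (grid_increment \<sigma> \<mu> (coord \<omega> i) (t - T) h) n)"
proof -
  have h0: "0 < h" using T n h by simp
  have c: "0 \<le> t - T" using T by simp
  let ?Y = "\<lambda>n \<omega>. grid_increment \<sigma> \<mu> (coord \<omega> i) (t - T) h n"
  note E = grid_exp_moment[OF i c h0, where \<sigma> = \<sigma> and \<mu> = \<mu>]
  define \<rho> where "\<rho> = exp (- (\<mu>\<^sup>2 / (2 * \<sigma>\<^sup>2)) * h)"
  have "\<rho> ^ n = exp (real n * (- (\<mu>\<^sup>2 / (2 * \<sigma>\<^sup>2)) * h))" unfolding \<rho>_def by (simp only: exp_of_nat_mult)
  also have "real n * (- (\<mu>\<^sup>2 / (2 * \<sigma>\<^sup>2)) * h) = - (\<mu>\<^sup>2 * T / (2 * \<sigma>\<^sup>2))" using n h by (simp add: field_simps)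
  finally have \<rho>n: "\<rho> ^ n = exp (- (\<mu>\<^sup>2 * T / (2 * \<sigma>\<^sup>2)))" .
  have "exp (- \<theta> * \<delta>) * ((1 - n * \<eta>) * exp (- \<theta> * x) - \<rho> ^ n * exp (- (\<theta> / 2) * x))
    \<le> \<P>(\<omega> in M. x < lindley (grid_increment \<sigma> \<mu> (coord \<omega> i) (t - T) h) n)"
  proof (rule lindley_tail_ge[OF grid_indep[OF i c h0]])
    fix k
    have "\<theta>\<^sup>2 * \<sigma>\<^sup>2 / 2 - \<theta> * \<mu> = 0"
      using \<sigma> by (simp add: \<theta> field_simps power2_eq_square)
    then show "expectation (\<lambda>\<omega>. exp (\<theta> * ?Y k \<omega>)) = 1" unfolding E(2) by simp
    show "integrable M (\<lambda>\<omega>. exp (\<theta> * ?Y k \<omega>))" "integrable M (\<lambda>\<omega>. exp (\<theta> / 2 * ?Y k \<omega>))"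
      by (rule E(1))+
    have "(\<theta> / 2)\<^sup>2 * \<sigma>\<^sup>2 / 2 - (\<theta> / 2) * \<mu> = - (\<mu>\<^sup>2 / (2 * \<sigma>\<^sup>2))"
      using \<sigma> by (simp add: \<theta> field_simps power2_eq_square)
    then show "expectation (\<lambda>\<omega>. exp (\<theta> / 2 * ?Y k \<omega>)) = \<rho>" unfolding E(2) \<rho>_def by simp
    have Ym[measurable]: "?Y k \<in> borel_measurable M"
      using grid_indep[OF i c h0, of \<sigma> \<mu>] unfolding indep_vars_def by auto
    \<comment> \<open>Chernoff bound with the additional exponent \<open>1 / sqrt h\<close>, the
      inverse scale of one increment: the exponential moment stays bounded, while
      \<open>exp (- \<delta> / sqrt h)\<close> beats the number of steps.\<close>
    define a where "a = 1 / sqrt h"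
    have a: "0 < a" using h0 by (simp add: a_def)
    have "expectation (\<lambda>\<omega>. exp (\<theta> * ?Y k \<omega>) * indicator {\<delta><..} (?Y k \<omega>))
        \<le> expectation (\<lambda>\<omega>. exp (- \<delta> * a) * exp ((\<theta> + a) * ?Y k \<omega>))"
    proof (rule integral_mono)
      show "integrable M (\<lambda>\<omega>. exp (\<theta> * ?Y k \<omega>) * indicator {\<delta><..} (?Y k \<omega>))"
        by (rule Bochner_Integration.integrable_bound[OF E(1)[of \<theta> k]]) (auto simp: indicator_def)
      show "integrable M (\<lambda>\<omega>. exp (- \<delta> * a) * exp ((\<theta> + a) * ?Y k \<omega>))"
        using E(1) by simp
      fix \<omega>
      have "exp (\<theta> * ?Y k \<omega>) \<le> exp (- \<delta> * a) * exp ((\<theta> + a) * ?Y k \<omega>)" if "\<delta> < ?Y k \<omega>"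
      proof -
        have "0 \<le> (?Y k \<omega> - \<delta>) * a" using that a by simp
        then show ?thesis unfolding exp_add[symmetric] exp_le_cancel_iff by (simp add: algebra_simps)
      qed
      then show "exp (\<theta> * ?Y k \<omega>) * indicator {\<delta><..} (?Y k \<omega>) \<le> exp (- \<delta> * a) * exp ((\<theta> + a) * ?Y k \<omega>)"
        by (simp add: indicator_def)
    qed
    also have "\<dots> = \<eta>" by (simp add: E(2) \<eta> a_def)
    finally show "expectation (\<lambda>\<omega>. exp (\<theta> * ?Y k \<omega>) * indicator {\<delta><..} (?Y k \<omega>)) \<le> \<eta>" .
    have "0 < \<theta>" using \<sigma> \<mu> by (simp add: \<theta>)
    then show "0 \<le> \<theta> / 2" "\<theta> / 2 \<le> \<theta>" by auto
  qed (use \<delta> x in \<open>auto simp: \<rho>_def \<eta>\<close>)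
  then show ?thesis by (simp only: \<rho>n)
qed

end

text \<open>The second exponential tends to \<open>exp (\<sigma>\<^sup>2 / 2)\<close>, as its
  exponent is a polynomial in \<open>sqrt (T / n)\<close>. The first one is of the form
  \<open>exp (- c * sqrt n)\<close> and absorbs the factor \<open>n\<close>.\<close>

lemma overshoot_vanishes:
  fixes T \<delta> \<theta> \<sigma> \<mu> :: real
  assumes "0 < T" "0 < \<delta>"
  shows "((\<lambda>n::nat. n * (exp (- \<delta> / sqrt (T / real n)) *
      exp (((\<theta> + 1 / sqrt (T / real n))\<^sup>2 * \<sigma>\<^sup>2 / 2 - (\<theta> + 1 / sqrt (T / real n)) * \<mu>) * (T / real n))))
    \<longlongrightarrow> 0) sequentially"
proof -
  have "((\<lambda>x. x * (exp (- \<delta> / sqrt (T / x)) *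
      exp (((\<theta> + 1 / sqrt (T / x))\<^sup>2 * \<sigma>\<^sup>2 / 2 - (\<theta> + 1 / sqrt (T / x)) * \<mu>) * (T / x))))
    \<longlongrightarrow> 0) at_top"
  proof -
    have lim1: "((\<lambda>x. x * exp (- \<delta> / sqrt (T / x))) \<longlongrightarrow> 0) at_top"
      using assms by real_asymp
    have lim2: "((\<lambda>x. exp (((\<theta> + 1 / sqrt (T / x))\<^sup>2 * \<sigma>\<^sup>2 / 2 - (\<theta> + 1 / sqrt (T / x)) * \<mu>) * (T / x)))
        \<longlongrightarrow> exp (\<sigma>\<^sup>2 / 2)) at_top"
    proof (rule tendsto_exp)
      have "((\<lambda>x. (\<theta> * sqrt (T / x) + 1)\<^sup>2 * \<sigma>\<^sup>2 / 2 - (\<theta> * (T / x) + sqrt (T / x)) * \<mu>) \<longlongrightarrow>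
          (\<theta> * 0 + 1)\<^sup>2 * \<sigma>\<^sup>2 / 2 - (\<theta> * 0 + 0) * \<mu>) at_top"
      proof -
        have "((\<lambda>x. T / x) \<longlongrightarrow> 0) at_top" "((\<lambda>x. sqrt (T / x)) \<longlongrightarrow> 0) at_top" using assms by real_asymp+
        then show ?thesis by (intro tendsto_intros)  auto
      qed
      moreover have "eventually (\<lambda>x. (\<theta> * sqrt (T / x) + 1)\<^sup>2 * \<sigma>\<^sup>2 / 2 - (\<theta> * (T / x) + sqrt (T / x)) * \<mu> =
          ((\<theta> + 1 / sqrt (T / x))\<^sup>2 * \<sigma>\<^sup>2 / 2 - (\<theta> + 1 / sqrt (T / x)) * \<mu>) * (T / x)) at_top"
        using eventually_gt_at_top[of 0]
      proof eventually_elim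
        case (elim x)
        define s where "s = sqrt (T / x)"
        have s: "0 < s" "T / x = s\<^sup>2" using elim assms by (auto simp: s_def)
        have "s * (1 / s) = 1" using s by simp
        moreover have "(\<theta> * s + 1)\<^sup>2 * \<sigma>\<^sup>2 / 2 - (\<theta> * s\<^sup>2 + s) * \<mu> =
            ((\<theta> + u)\<^sup>2 * \<sigma>\<^sup>2 / 2 - (\<theta> + u) * \<mu>) * s\<^sup>2" if "s * u = 1" for u
        proof -
          have e: "(\<theta> + u) * s = \<theta> * s + 1" using that by (simp add: algebra_simps)
          have "(\<theta> + u)\<^sup>2 * s\<^sup>2 = (\<theta> * s + 1)\<^sup>2" unfolding power_mult_distrib[symmetric] e ..
          moreover have "(\<theta> + u) * s\<^sup>2 = \<theta> * s\<^sup>2 + s"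
            using arg_cong[OF e, of "\<lambda>a. a * s"] by (simp add: power2_eq_square algebra_simps)
          moreover have "((\<theta> + u)\<^sup>2 * \<sigma>\<^sup>2 / 2 - (\<theta> + u) * \<mu>) * s\<^sup>2
              = ((\<theta> + u)\<^sup>2 * s\<^sup>2) * \<sigma>\<^sup>2 / 2 - ((\<theta> + u) * s\<^sup>2) * \<mu>"
            by (simp add: algebra_simps)
          ultimately show ?thesis by (simp only:)
        qed
        ultimately show ?case unfolding s_def[symmetric] unfolding s(2) by blast
      qed
      ultimately show "((\<lambda>x. ((\<theta> + 1 / sqrt (T / x))\<^sup>2 * \<sigma>\<^sup>2 / 2 - (\<theta> + 1 / sqrt (T / x)) * \<mu>) * (T / x))
        \<longlongrightarrow> \<sigma>\<^sup>2 / 2) at_top"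
        by (auto intro: Lim_transform_eventually)
    qed
    from tendsto_mult[OF lim1 lim2] show ?thesis by (simp add: mult.assoc)
  qed
  from filterlim_compose[OF this filterlim_real_sequentially] show ?thesis .
qed

abbreviation dyadic_workload :: "real \<Rightarrow> real \<Rightarrow> (real \<Rightarrow> real) \<Rightarrow> real \<Rightarrow> nat \<Rightarrow> real" where
  "dyadic_workload \<sigma> \<mu> w t p \<equiv> lindley (grid_increment \<sigma> \<mu> w 0 (t / 2 ^ p)) (2 ^ p)"

text \<open>For continuous \<open>w\<close> this is the supremum over \<open>s\<close> in
  \<open>[0, t]\<close> of \<open>\<sigma> * (w t - w s) - \<mu> * (t - s)\<close>, the
  one-dimensional reflection started at 0. As an increasing limit over dyadic grids it is measurable
  and inherits the tail bound of the walks.\<close>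

definition workload_sup :: "real \<Rightarrow> real \<Rightarrow> (real \<Rightarrow> real) \<Rightarrow> real \<Rightarrow> real" where
  "workload_sup \<sigma> \<mu> w t =
     real_of_ereal (SUP p. ereal (dyadic_workload \<sigma> \<mu> w t p))"

lemma dyadic_lindley_mono:
  "dyadic_workload \<sigma> \<mu> w t p
    \<le> dyadic_workload \<sigma> \<mu> w t (Suc p)"
proof (rule lindley_grid_increment_le[OF lindley_nonneg])
  fix m :: nat assume "m \<le> 2 ^ p"
  then have "2 * m \<le> 2 ^ Suc p" by simp
  from le_lindley_grid_increment[OF this, of \<sigma> w 0 "t / 2 ^ Suc p" \<mu>]
  show "\<sigma> * (w (0 + real (2 ^ p) * (t / 2 ^ p)) - w (0 + real m * (t / 2 ^ p)))
      - \<mu> * ((real (2 ^ p) - real m) * (t / 2 ^ p))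
    \<le> dyadic_workload \<sigma> \<mu> w t (Suc p)"
    by (simp add: field_simps)
qed

lemma workload_sup_nonneg: "0 \<le> workload_sup \<sigma> \<mu> w t"
  unfolding workload_sup_def
  by (intro real_of_ereal_pos SUP_upper2[of 0]) (auto simp: lindley_nonneg simp del: lindley.simps)

text \<open>Continuity bounds the grid values; without a bound \<open>real_of_ereal\<close> would
  turn an infinite supremum into 0.\<close>

lemma dyadic_lindley_le_workload_sup:
  assumes "0 \<le> t" "0 \<le> \<mu>" and cont: "continuous_on {0..t} w"
  shows "dyadic_workload \<sigma> \<mu> w t p \<le> workload_sup \<sigma> \<mu> w t"
proof -
  let ?L = "\<lambda>p. dyadic_workload \<sigma> \<mu> w t p"
  have "bounded (w ` {0..t})" using compact_continuous_image[OF cont] compact_imp_bounded by blast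
  then obtain C where C: "\<And>s. s \<in> {0..t} \<Longrightarrow> \<bar>w s\<bar> \<le> C" by (force simp: bounded_iff)
  then have C0: "0 \<le> C" using \<open>0 \<le> t\<close> by force
  have bnd: "?L p \<le> \<bar>\<sigma>\<bar> * (2 * C)" for p
  proof (rule lindley_grid_increment_le)
    show "0 \<le> \<bar>\<sigma>\<bar> * (2 * C)" using C0 by simp
    fix m :: nat assume m: "m \<le> 2 ^ p"
    then have mp: "real m \<le> 2 ^ p" by (metis of_nat_le_iff of_nat_numeral of_nat_power)
    have "\<sigma> * (w (0 + real (2 ^ p) * (t / 2 ^ p)) - w (0 + real m * (t / 2 ^ p)))
        \<le> \<bar>\<sigma>\<bar> * \<bar>w (0 + real (2 ^ p) * (t / 2 ^ p)) - w (0 + real m * (t / 2 ^ p))\<bar>"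
      by (metis abs_ge_self abs_mult)
    also have "\<dots> \<le> \<bar>\<sigma>\<bar> * (2 * C)"
    proof (rule mult_left_mono)
      have "0 + real (2 ^ p) * (t / 2 ^ p) \<in> {0..t}" using \<open>0 \<le> t\<close> by simp
      moreover have "real m * t \<le> 2 ^ p * t" using mp \<open>0 \<le> t\<close> by (rule mult_right_mono)
      then have "0 + real m * (t / 2 ^ p) \<in> {0..t}" using \<open>0 \<le> t\<close> by (simp add: field_simps)
      ultimately show "\<bar>w (0 + real (2 ^ p) * (t / 2 ^ p)) - w (0 + real m * (t / 2 ^ p))\<bar> \<le> 2 * C"
        using C by (smt (verit))
    qed simp
    finally have "\<sigma> * (w (0 + real (2 ^ p) * (t / 2 ^ p)) - w (0 + real m * (t / 2 ^ p))) \<le> \<bar>\<sigma>\<bar> * (2 * C)" .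
    moreover have "0 \<le> \<mu> * ((real (2 ^ p) - real m) * (t / 2 ^ p))"
      using mp \<open>0 \<le> t\<close> \<open>0 \<le> \<mu>\<close> by simp
    ultimately show "\<sigma> * (w (0 + real (2 ^ p) * (t / 2 ^ p)) - w (0 + real m * (t / 2 ^ p)))
      - \<mu> * ((real (2 ^ p) - real m) * (t / 2 ^ p)) \<le> \<bar>\<sigma>\<bar> * (2 * C)" by linarith
  qed
  define S where "S = (SUP p. ereal (?L p))"
  have "S \<le> ereal (\<bar>\<sigma>\<bar> * (2 * C))" unfolding S_def using bnd by (intro SUP_least) simp
  moreover have "ereal (?L p) \<le> S" unfolding S_def by (intro SUP_upper) simp
  ultimately show ?thesis unfolding workload_sup_def S_def[symmetric] by (cases S) auto
qed

lemma dyadic_approximation: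
  fixes s t :: real
  assumes "0 < t" "0 \<le> s" "s \<le> t"
  shows "(\<lambda>p. t * \<lfloor>s / t * 2 ^ p\<rfloor> / 2 ^ p) \<longlonglongrightarrow> s"
    and "t * \<lfloor>s / t * 2 ^ p\<rfloor> / 2 ^ p \<le> s" "0 \<le> t * \<lfloor>s / t * 2 ^ p\<rfloor> / 2 ^ p"
proof -
  have up: "t * \<lfloor>s / t * 2 ^ p\<rfloor> / 2 ^ p \<le> s" for p
  proof -
    have "t * \<lfloor>s / t * 2 ^ p\<rfloor> \<le> t * (s / t * 2 ^ p)" using assms by (intro mult_left_mono) auto
    then show ?thesis using assms by (simp add: field_simps)
  qed
  have lo: "s - t / 2 ^ p \<le> t * \<lfloor>s / t * 2 ^ p\<rfloor> / 2 ^ p" for p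
  proof -
    have "s / t * 2 ^ p - 1 \<le> \<lfloor>s / t * 2 ^ p\<rfloor>" by linarith
    then have "t * (s / t * 2 ^ p - 1) \<le> t * \<lfloor>s / t * 2 ^ p\<rfloor>" using assms by (intro mult_left_mono) auto
    then have "(t * (s / t * 2 ^ p - 1)) / 2 ^ p \<le> t * \<lfloor>s / t * 2 ^ p\<rfloor> / 2 ^ p"
      by (rule divide_right_mono) simp
    moreover have "(t * (s / t * 2 ^ p - 1)) / 2 ^ p = s - t / 2 ^ p" using assms by (simp add: field_simps)
    ultimately show ?thesis by simp
  qed
  show "t * \<lfloor>s / t * 2 ^ p\<rfloor> / 2 ^ p \<le> s" by (rule up)
  show "0 \<le> t * \<lfloor>s / t * 2 ^ p\<rfloor> / 2 ^ p" using assms by simp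
  have lim: "(\<lambda>p. s - t / 2 ^ p) \<longlonglongrightarrow> s" by real_asymp
  show "(\<lambda>p. t * \<lfloor>s / t * 2 ^ p\<rfloor> / 2 ^ p) \<longlonglongrightarrow> s"
    by (rule tendsto_sandwich[OF _ _ lim tendsto_const]) (use lo up in \<open>auto intro!: always_eventually\<close>)
qed

lemma le_workload_sup:
  assumes t: "0 < t" and \<mu>: "0 \<le> \<mu>" and cont: "continuous_on {0..t} w" and s: "0 \<le> s" "s \<le> t"
  shows "\<sigma> * (w t - w s) - \<mu> * (t - s) \<le> workload_sup \<sigma> \<mu> w t"
proof -
  define a where "a p = t * \<lfloor>s / t * 2 ^ p\<rfloor> / 2 ^ p" for p :: nat
  note a = dyadic_approximation[OF t s, folded a_def]
  have "((\<lambda>p. w (a p)) \<longlonglongrightarrow> w s)"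
    using cont s a order_trans[OF a(2) s(2)]
    by (intro continuous_on_tendsto_compose[OF cont a(1)]) auto
  then have lim: "(\<lambda>p. \<sigma> * (w t - w (a p)) - \<mu> * (t - a p)) \<longlonglongrightarrow> \<sigma> * (w t - w s) - \<mu> * (t - s)"
    using a(1) by (intro tendsto_intros)
  have "\<sigma> * (w t - w (a p)) - \<mu> * (t - a p) \<le> workload_sup \<sigma> \<mu> w t" for p
  proof -
    define m where "m = nat \<lfloor>s / t * 2 ^ p\<rfloor>"
    have "s / t * 2 ^ p \<le> 2 ^ p" "0 \<le> s / t * 2 ^ p" using t s by (auto simp: field_simps)
    then have f: "0 \<le> \<lfloor>s / t * 2 ^ p\<rfloor>" "of_int \<lfloor>s / t * 2 ^ p\<rfloor> \<le> (2 ^ p :: real)"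
      using of_int_floor_le[of "s / t * 2 ^ p"] by (simp, linarith)
    then have "real m \<le> real (2 ^ p)" unfolding m_def by simp
    then have m: "m \<le> 2 ^ p" by simp
    have am: "a p = 0 + real m * (t / 2 ^ p)" using f by (simp add: a_def m_def)
    have "\<sigma> * (w (0 + real (2 ^ p) * (t / 2 ^ p)) - w (0 + real m * (t / 2 ^ p)))
      - \<mu> * ((real (2 ^ p) - real m) * (t / 2 ^ p)) \<le> workload_sup \<sigma> \<mu> w t"
      using le_lindley_grid_increment[OF m] dyadic_lindley_le_workload_sup[OF less_imp_le[OF t] \<mu> cont]
      by (rule order_trans)
    moreover have "(real (2 ^ p) - real m) * (t / 2 ^ p) = t - a p" by (simp add: am field_simps)
    moreover have "0 + real (2 ^ p) * (t / 2 ^ p) = t" by simp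
    ultimately show ?thesis unfolding am[symmetric] by (simp only:)
  qed
  with lim show ?thesis by (intro LIMSEQ_le_const2) auto
qed

section \<open>Tail and mean of the continuous-time workload\<close>

context brownian_motion
begin

lemma measurable_grid_increment:
  assumes "i \<in> K" "0 \<le> c" "0 \<le> h"
  shows "(\<lambda>\<omega>. grid_increment \<sigma> \<mu> (coord \<omega> i) c h m) \<in> borel_measurable M"
  unfolding grid_increment_def using assms
  by (intro borel_measurable_diff borel_measurable_times borel_measurable_const measurable_W) auto

lemma measurable_grid_lindley:
  assumes "i \<in> K" "0 \<le> c" "0 \<le> h"
  shows "(\<lambda>\<omega>. lindley (grid_increment \<sigma> \<mu> (coord \<omega> i) c h) n) \<in> borel_measurable M"
  using measurable_grid_increment[OF assms] by (intro borel_measurable_lindley) auto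

lemma measurable_workload_sup:
  assumes "i \<in> K" "0 \<le> t"
  shows "(\<lambda>\<omega>. workload_sup \<sigma> \<mu> (coord \<omega> i) t) \<in> borel_measurable M"
proof -
  have [measurable]: "(\<lambda>\<omega>. dyadic_workload \<sigma> \<mu> (coord \<omega> i) t p) \<in> borel_measurable M" for p
    using assms by (intro measurable_grid_lindley) auto
  show ?thesis unfolding workload_sup_def by measurable
qed

lemma workload_sup_tail:
  assumes i: "i \<in> K" and t: "0 < t" and \<sigma>: "\<sigma> \<noteq> 0" and \<mu>: "0 < \<mu>" and x: "0 \<le> x"
  shows "\<P>(\<omega> in M. x < workload_sup \<sigma> \<mu> (coord \<omega> i) t) \<le> exp (- (2 * \<mu> / \<sigma>\<^sup>2) * x)"
proof -
  define A where "A p = {\<omega>\<in>space M. x < dyadic_workload \<sigma> \<mu> (coord \<omega> i) t p}" for p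
  have [measurable]: "(\<lambda>\<omega>. dyadic_workload \<sigma> \<mu> (coord \<omega> i) t p) \<in> borel_measurable M" for p
    using i t by (intro measurable_grid_lindley) auto
  have A: "A p \<in> sets M" for p unfolding A_def by measurable
  have inc: "incseq A"
    unfolding A_def using less_le_trans[OF _ dyadic_lindley_mono] by (intro incseq_SucI) blast
  have "{\<omega>\<in>space M. x < workload_sup \<sigma> \<mu> (coord \<omega> i) t} \<subseteq> (\<Union>p. A p)"
  proof
    fix \<omega> assume \<omega>: "\<omega> \<in> {\<omega>\<in>space M. x < workload_sup \<sigma> \<mu> (coord \<omega> i) t}"
    let ?L = "\<lambda>p. dyadic_workload \<sigma> \<mu> (coord \<omega> i) t p"
    have "ereal x < (SUP p. ereal (?L p))"
      using \<omega> x unfolding workload_sup_def by (cases "SUP p. ereal (?L p)") auto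
    then obtain p where "ereal x < ereal (?L p)" by (auto simp: less_SUP_iff)
    with \<omega> show "\<omega> \<in> (\<Union>p. A p)" by (auto simp: A_def)
  qed
  then have "\<P>(\<omega> in M. x < workload_sup \<sigma> \<mu> (coord \<omega> i) t) \<le> prob (\<Union>p. A p)"
    using A by (intro finite_measure_mono) auto
  also have "\<dots> \<le> exp (- (2 * \<mu> / \<sigma>\<^sup>2) * x)"
  proof (rule LIMSEQ_le_const2)
    show "(\<lambda>p. prob (A p)) \<longlonglongrightarrow> prob (\<Union>p. A p)"
      using A inc by (intro finite_Lim_measure_incseq) auto
    show "\<exists>N. \<forall>n\<ge>N. prob (A n) \<le> exp (- (2 * \<mu> / \<sigma>\<^sup>2) * x)"
      unfolding A_def using t by (intro exI[of _ 0] allI impI grid_lindley_tail_le[OF i _ _ \<sigma> \<mu>]) auto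
  qed
  finally show ?thesis .
qed

text \<open>Summing the tail over integer levels gives a geometric series. The bound is free of
  \<open>t\<close>, so that the mean of \<open>range_bound\<close> grows at rate at most
  \<open>2 * \<mu>\<close>.\<close>

lemma workload_sup_expectation:
  assumes i: "i \<in> K" and t: "0 < t" and \<sigma>: "\<sigma> \<noteq> 0" and \<mu>: "0 < \<mu>"
  shows "integrable M (\<lambda>\<omega>. workload_sup \<sigma> \<mu> (coord \<omega> i) t)"
    and "expectation (\<lambda>\<omega>. workload_sup \<sigma> \<mu> (coord \<omega> i) t) \<le> 1 / (1 - exp (- (2 * \<mu> / \<sigma>\<^sup>2)))"
proof -
  define X where "X \<omega> = workload_sup \<sigma> \<mu> (coord \<omega> i) t" for \<omega>
  define q where "q = exp (- (2 * \<mu> / \<sigma>\<^sup>2))"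
  have q: "0 < q" "q < 1" using \<sigma> \<mu> by (auto simp: q_def)
  have [measurable]: "X \<in> borel_measurable M"
    unfolding X_def using i t by (intro measurable_workload_sup) auto
  have X0: "0 \<le> X \<omega>" for \<omega> unfolding X_def by (rule workload_sup_nonneg)
  have le: "ennreal x \<le> (\<Sum>m. indicator {real m <..} x)" if "0 \<le> x" for x :: real
  proof -
    have "ennreal x \<le> ennreal (\<Sum>m<nat \<lceil>x\<rceil>. 1)" using that by (intro ennreal_leI) simp
    also have "\<dots> = (\<Sum>m<nat \<lceil>x\<rceil>. indicator {real m <..} x)"
    proof -
      have "real m < x" if "m < nat \<lceil>x\<rceil>" for m using that by linarith
      then have "(\<Sum>m<nat \<lceil>x\<rceil>. indicator {real m <..} x) = (\<Sum>m<nat \<lceil>x\<rceil>. 1 :: ennreal)"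
        by (intro sum.cong) auto
      then show ?thesis by (simp add: ennreal_of_nat_eq_real_of_nat)
    qed
    also have "\<dots> \<le> (\<Sum>m. indicator {real m <..} x)" by (rule sum_le_suminf) auto
    finally show ?thesis .
  qed
  have "(\<integral>\<^sup>+\<omega>. ennreal (X \<omega>) \<partial>M) \<le> (\<integral>\<^sup>+\<omega>. (\<Sum>m. indicator {real m <..} (X \<omega>)) \<partial>M)"
    by (intro nn_integral_mono le X0)
  also have "\<dots> = (\<Sum>m. \<integral>\<^sup>+\<omega>. indicator {real m <..} (X \<omega>) \<partial>M)"
    by (rule nn_integral_suminf) measurable
  also have "\<dots> \<le> (\<Sum>m. ennreal (q ^ m))"
  proof (rule suminf_le)
    fix m
    have "(\<integral>\<^sup>+\<omega>. indicator {real m <..} (X \<omega>) \<partial>M) = (\<integral>\<^sup>+\<omega>. indicator {\<omega>\<in>space M. real m < X \<omega>} \<omega> \<partial>M)"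
      by (intro nn_integral_cong) (auto simp: indicator_def)
    also have "\<dots> = ennreal (\<P>(\<omega> in M. real m < X \<omega>))"
      by (simp add: emeasure_eq_measure)
    also have "\<dots> \<le> ennreal (exp (- (2 * \<mu> / \<sigma>\<^sup>2) * real m))"
      unfolding X_def by (intro ennreal_leI workload_sup_tail[OF i t \<sigma> \<mu>]) simp
    also have "exp (- (2 * \<mu> / \<sigma>\<^sup>2) * real m) = q ^ m"
      unfolding q_def by (metis exp_of_nat2_mult)
    finally show "(\<integral>\<^sup>+\<omega>. indicator {real m <..} (X \<omega>) \<partial>M) \<le> ennreal (q ^ m)" .
  qed auto
  also have "\<dots> = ennreal (\<Sum>m. q ^ m)"
    using q by (intro suminf_ennreal2) (auto intro: summable_geometric)
  also have "(\<Sum>m. q ^ m) = 1 / (1 - q)" using q by (intro suminf_geometric) auto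
  finally have fin: "(\<integral>\<^sup>+\<omega>. ennreal (X \<omega>) \<partial>M) \<le> ennreal (1 / (1 - q))" .
  show int: "integrable M (\<lambda>\<omega>. workload_sup \<sigma> \<mu> (coord \<omega> i) t)"
    unfolding X_def[symmetric] using fin X0
    by (intro integrableI_nonneg) (auto simp: less_top[symmetric] top_unique intro: le_less_trans)
  have "ennreal (expectation X) \<le> ennreal (1 / (1 - q))"
    using fin nn_integral_eq_integral[of M X] int X0 unfolding X_def[symmetric] by simp
  then show "expectation (\<lambda>\<omega>. workload_sup \<sigma> \<mu> (coord \<omega> i) t) \<le> 1 / (1 - exp (- (2 * \<mu> / \<sigma>\<^sup>2)))"
    using q unfolding X_def[symmetric] q_def[symmetric] by (subst (asm) ennreal_le_iff) auto
qed

text \<open>Dominates the path on all of \<open>[0, t]\<close>: \<open>W t\<close> and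
  \<open>W t - W s\<close> are both at most \<open>\<mu> * t\<close> plus a workload in absolute
  value, with one workload for each sign. As \<open>\<mu>\<close> remains free, the mean is of
  smaller order than \<open>t\<close>.\<close>

definition range_bound :: "nat \<Rightarrow> real \<Rightarrow> real \<Rightarrow> 'a \<Rightarrow> real" where
  "range_bound i \<mu> t \<omega> = 2 * \<mu> * t
     + 2 * (workload_sup 1 \<mu> (coord \<omega> i) t + workload_sup (-1) \<mu> (coord \<omega> i) t)"

lemma range_bound_nonneg: "0 \<le> \<mu> \<Longrightarrow> 0 \<le> t \<Longrightarrow> 0 \<le> range_bound i \<mu> t \<omega>"
  unfolding range_bound_def by (intro add_nonneg_nonneg mult_nonneg_nonneg workload_sup_nonneg) auto

lemma range_bound_expectation:
  assumes i: "i \<in> K" and t: "0 < t" and \<mu>: "0 < \<mu>"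
  shows "integrable M (range_bound i \<mu> t)"
    and "expectation (range_bound i \<mu> t) \<le> 2 * \<mu> * t + 4 / (1 - exp (- (2 * \<mu>)))"
  using workload_sup_expectation[OF i t _ \<mu>, of 1] workload_sup_expectation[OF i t _ \<mu>, of "-1"]
  unfolding range_bound_def[abs_def] by (auto simp: prob_space field_simps)

lemma abs_le_range_bound:
  assumes cont: "W 0 \<omega> i = 0" "continuous_on {0..} (coord \<omega> i)"
    and t: "0 < t" "0 < \<mu>" and s: "0 \<le> s" "s \<le> t"
  shows "\<bar>W s \<omega> i\<bar> \<le> range_bound i \<mu> t \<omega>"
proof -
  have c: "continuous_on {0..t} (coord \<omega> i)" using cont(2) by (rule continuous_on_subset) auto
  have "W t \<omega> i - W s \<omega> i - \<mu> * (t - s) \<le> workload_sup 1 \<mu> (coord \<omega> i) t"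
    "- (W t \<omega> i - W s \<omega> i) - \<mu> * (t - s) \<le> workload_sup (-1) \<mu> (coord \<omega> i) t"
    "W t \<omega> i - \<mu> * t \<le> workload_sup 1 \<mu> (coord \<omega> i) t"
    "- W t \<omega> i - \<mu> * t \<le> workload_sup (-1) \<mu> (coord \<omega> i) t"
    using le_workload_sup[OF t(1) less_imp_le[OF t(2)] c s, of 1] le_workload_sup[OF t(1) less_imp_le[OF t(2)] c s, of "-1"]
      le_workload_sup[OF t(1) less_imp_le[OF t(2)] c, of 0 1] le_workload_sup[OF t(1) less_imp_le[OF t(2)] c, of 0 "-1"] cont(1) t
    by auto
  moreover have "\<mu> * (t - s) \<le> \<mu> * t" using t s by simp
  ultimately have "\<bar>W t \<omega> i - W s \<omega> i\<bar> \<le> \<mu> * t + max (workload_sup 1 \<mu> (coord \<omega> i) t) (workload_sup (-1) \<mu> (coord \<omega> i) t)"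
    "\<bar>W t \<omega> i\<bar> \<le> \<mu> * t + max (workload_sup 1 \<mu> (coord \<omega> i) t) (workload_sup (-1) \<mu> (coord \<omega> i) t)"
    by linarith+
  moreover have "\<bar>b\<bar> \<le> 2 * x + 2 * (p + q)"
    if "\<bar>a - b\<bar> \<le> x + max p q" "\<bar>a\<bar> \<le> x + max p q" "0 \<le> p" "0 \<le> q" for a b x p q :: real
    using that by (auto simp: max_def abs_if split: if_splits)
  ultimately show ?thesis
    unfolding range_bound_def mult.assoc using workload_sup_nonneg by blast
qed

end

section \<open>Stationarity of the increments\<close>

text \<open>Three demands meet here: countability for measurability, density for right-continuous
  paths, and a common uniform grid for any finitely many of the times, which reduces
  finite-dimensional laws to i.i.d. increments. The multiples of \<open>T\<close> up to
  \<open>b\<close> are included as ends of windows.\<close>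

definition dyadic_times :: "real \<Rightarrow> real \<Rightarrow> real set" where
  "dyadic_times T b = {real i * (T / 2 ^ p) | i p. real i * (T / 2 ^ p) \<le> b}"

lemma countable_dyadic_times: "countable (dyadic_times T b)"
proof -
  have "dyadic_times T b \<subseteq> (\<lambda>(i, p). real i * (T / 2 ^ p)) ` (UNIV :: (nat \<times> nat) set)"
    unfolding dyadic_times_def by auto
  then show ?thesis by (rule countable_subset) auto
qed

lemma dyadic_times_nonneg: "0 < T \<Longrightarrow> dyadic_times T b \<subseteq> {0..}"
  unfolding dyadic_times_def by auto

lemma multiple_in_dyadic_times: "real i * T \<le> b \<Longrightarrow> real i * T \<in> dyadic_times T b"
  unfolding dyadic_times_def by (rule CollectI, rule exI[of _ i], rule exI[of _ 0]) simp

lemma dyadic_times_dense: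
  assumes T: "0 < T" and r: "0 \<le> r" "r < e" and e: "e \<le> s" "s \<in> dyadic_times T b"
  shows "\<exists>d\<in>dyadic_times T b. r < d \<and> d < e"
proof -
  have "0 < (e - r) / T" using T r by simp
  then obtain p :: nat where p: "(1 / 2) ^ p < (e - r) / T" using real_arch_pow_inv[of "(e - r) / T" "1 / 2"] by auto
  define h where "h = T / 2 ^ p"
  have h: "0 < h" "h < e - r" using T p by (auto simp: h_def field_simps)
  define i where "i = nat (\<lfloor>r / h\<rfloor> + 1)"
  have "0 \<le> r / h" using r h by simp
  then have i: "real i = of_int \<lfloor>r / h\<rfloor> + 1" by (simp add: i_def)
  have "r / h < real i" "real i \<le> r / h + 1" unfolding i by linarith+
  then have "r < real i * h" "real i * h \<le> r + h" using h by (auto simp: field_simps)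
  moreover have "s \<le> b" using e(2) by (auto simp: dyadic_times_def)
  ultimately have i: "r < real i * h" "real i * h < e" "real i * h \<le> b" using h e by auto
  then have "real i * h \<in> dyadic_times T b" unfolding dyadic_times_def h_def by blast
  with i show ?thesis by blast
qed

lemma finite_dyadic_common_grid:
  assumes "finite J" "J \<subseteq> dyadic_times T b"
  shows "\<exists>p. \<forall>q\<in>J. \<exists>i. q = real i * (T / 2 ^ p)"
  using assms
proof (induction J)
  case (insert q J)
  then obtain p where p: "\<forall>q\<in>J. \<exists>i. q = real i * (T / 2 ^ p)" by auto
  from insert obtain i p' where q: "q = real i * (T / 2 ^ p')" by (auto simp: dyadic_times_def)
  have refine: "\<exists>i'. real i * (T / 2 ^ r) = real i' * (T / 2 ^ (r + r'))" for i r r' :: nat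
    by (rule exI[of _ "i * 2 ^ r'"]) (simp add: power_add)
  show ?case
  proof (rule exI[of _ "p + p'"], rule ballI)
    fix x assume "x \<in> insert q J"
    then show "\<exists>i. x = real i * (T / 2 ^ (p + p'))"
      using p refine[of _ p p'] refine[of i p' p] q by (auto simp: add.commute)
  qed
qed auto

section \<open>Regulators as measurable functions of countably many values\<close>

lemma regulator_iterate_cong:
  assumes "\<And>s k. s \<in> D \<Longrightarrow> k \<in> K \<Longrightarrow> x s k = x' s k" "k \<in> K"
  shows "regulator_iterate D K Q x n t k = regulator_iterate D K Q x' n t k"
  using \<open>k \<in> K\<close>
proof (induction n arbitrary: t k)
  case (Suc n)
  have "(\<Sum>l\<in>K - {k}. Q k l * regulator_iterate D K Q x n s l) = (\<Sum>l\<in>K - {k}. Q k l * regulator_iterate D K Q x' n s l)" for s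
    using Suc.IH by (intro sum.cong) auto
  then show ?case using assms(1)[OF _ Suc.prems] by (simp add: running_max_def cong: SUP_cong_simp)
qed simp

lemma regulator_cong:
  assumes "\<And>s k. s \<in> D \<Longrightarrow> k \<in> K \<Longrightarrow> x s k = x' s k" "k \<in> K"
  shows "regulator D K Q x t k = regulator D K Q x' t k"
  unfolding regulator_def using regulator_iterate_cong[OF assms] by simp

lemma borel_measurable_regulator:
  fixes x :: "'a \<Rightarrow> real \<Rightarrow> nat \<Rightarrow> real"
  assumes D: "countable D"
    and x: "\<And>s k. s \<in> D \<Longrightarrow> k \<in> K \<Longrightarrow> (\<lambda>\<omega>. x \<omega> s k) \<in> borel_measurable M" and "k \<in> K"
  shows "(\<lambda>\<omega>. regulator D K Q (x \<omega>) t k) \<in> borel_measurable M"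
proof -
  have "(\<lambda>\<omega>. regulator_iterate D K Q (x \<omega>) n t k) \<in> borel_measurable M" for n
    using \<open>k \<in> K\<close>
  proof (induction n arbitrary: t k)
    case (Suc n)
    have 1: "(\<lambda>\<omega>. - x \<omega> s k - (\<Sum>l\<in>K - {k}. Q k l * regulator_iterate D K Q (x \<omega>) n s l)) \<in> borel_measurable M"
      if "s \<in> D" for s
      using x[OF that Suc.prems] Suc.IH by (intro borel_measurable_diff borel_measurable_uminus borel_measurable_sum borel_measurable_times) auto
    have "(\<lambda>\<omega>. SUP s\<in>{s\<in>D. s \<le> t}. ereal (max 0 (- x \<omega> s k - (\<Sum>l\<in>K - {k}. Q k l * regulator_iterate D K Q (x \<omega>) n s l)))) \<in> borel_measurable M"
      using 1 by (intro borel_measurable_SUP borel_measurable_ereal borel_measurable_max)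
        (auto intro: countable_subset[OF _ D])
    then show ?case unfolding regulator_iterate.simps running_max_def
      by (intro borel_measurable_divide borel_measurable_real_of_ereal borel_measurable_const)
  qed simp
  then show ?thesis unfolding regulator_def by (rule borel_measurable_lim_metric)
qed

context brownian_motion
begin

definition increments_from :: "real set \<Rightarrow> real \<Rightarrow> 'a \<Rightarrow> nat \<Rightarrow> real \<Rightarrow> real" where
  "increments_from D a \<omega> = (\<lambda>i\<in>K. \<lambda>q\<in>D. W (a + q) \<omega> i - W a \<omega> i)"

lemma grid_increments_distr:
  assumes i: "i \<in> K" and a: "0 \<le> a" and h: "0 < h"
  shows "distr M (\<Pi>\<^sub>M n\<in>UNIV. borel) (\<lambda>\<omega>. \<lambda>n. W (a + real (Suc n) * h) \<omega> i - W (a + real n * h) \<omega> i)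
    = (\<Pi>\<^sub>M n\<in>UNIV. density lborel (normal_density 0 (sqrt h)))"
proof -
  have D: "distributed M lborel (\<lambda>\<omega>. W (a + real (Suc n) * h) \<omega> i - W (a + real n * h) \<omega> i)
      (normal_density 0 (sqrt h))" for n
    using increment_distributed[OF i, of "a + real n * h" "a + real (Suc n) * h"] a h
    by (simp add: algebra_simps)
  have "distr M (\<Pi>\<^sub>M n\<in>UNIV. borel) (\<lambda>\<omega>. \<lambda>n\<in>UNIV. W (a + real (Suc n) * h) \<omega> i - W (a + real n * h) \<omega> i)
    = (\<Pi>\<^sub>M n\<in>UNIV. distr M borel (\<lambda>\<omega>. W (a + real (Suc n) * h) \<omega> i - W (a + real n * h) \<omega> i))"
    using grid_increments_indep[OF assms]
    by (subst indep_vars_iff_distr_eq_PiM[symmetric]) (auto simp: indep_vars_def)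
  also have "\<dots> = (\<Pi>\<^sub>M n\<in>(UNIV::nat set). density lborel (normal_density 0 (sqrt h)))"
  proof (rule PiM_cong[OF refl])
    fix n
    have "distr M borel (\<lambda>\<omega>. W (a + real (Suc n) * h) \<omega> i - W (a + real n * h) \<omega> i)
        = distr M lborel (\<lambda>\<omega>. W (a + real (Suc n) * h) \<omega> i - W (a + real n * h) \<omega> i)"
      by (rule distr_cong) auto
    then show "distr M borel (\<lambda>\<omega>. W (a + real (Suc n) * h) \<omega> i - W (a + real n * h) \<omega> i)
        = density lborel (normal_density 0 (sqrt h))"
      using distributed_distr_eq_density[OF D] by simp
  qed
  finally show ?thesis unfolding restrict_UNIV .
qed

lemma measurable_path_increments:
  assumes "i \<in> K" "0 \<le> a" "D \<subseteq> {0..}"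
  shows "(\<lambda>\<omega>. \<lambda>q\<in>D. W (a + q) \<omega> i - W a \<omega> i) \<in> measurable M (\<Pi>\<^sub>M q\<in>D. borel)"
  using assms by (intro measurable_restrict borel_measurable_diff measurable_W) auto

text \<open>Finite-dimensional events determine the law. On a common grid such an event becomes an
  event \<open>B\<close> of the sequence of grid increments, and neither \<open>B\<close> nor the
  law of that sequence depends on \<open>a\<close>.\<close>

lemma path_increments_stationary:
  assumes i: "i \<in> K" and a: "0 \<le> a" and T: "0 < T" and D: "D = dyadic_times T b"
  shows "distr M (\<Pi>\<^sub>M q\<in>D. borel) (\<lambda>\<omega>. \<lambda>q\<in>D. W (a + q) \<omega> i - W a \<omega> i)
    = distr M (\<Pi>\<^sub>M q\<in>D. borel) (\<lambda>\<omega>. \<lambda>q\<in>D. W (0 + q) \<omega> i - W 0 \<omega> i)"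
proof (rule measure_eqI_PiM_infinite)
  have D0: "D \<subseteq> {0..}" using dyadic_times_nonneg[OF T] D by simp
  fix A :: "real \<Rightarrow> real set" and J assume J: "finite J" "J \<subseteq> D" and A: "\<And>q. q \<in> J \<Longrightarrow> A q \<in> sets borel"
  obtain p k where k: "\<And>q. q \<in> J \<Longrightarrow> q = real (k q) * (T / 2 ^ p)"
    using finite_dyadic_common_grid[OF J(1)] J(2) D by metis
  define h where "h = T / 2 ^ p"
  have h: "0 < h" using T by (simp add: h_def)
  define B where "B = {u \<in> space (\<Pi>\<^sub>M n\<in>(UNIV::nat set). borel). \<forall>q\<in>J. (\<Sum>m<k q. u m) \<in> A q}"
  have B: "B \<in> sets (\<Pi>\<^sub>M n\<in>(UNIV::nat set). (borel :: real measure))"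
    unfolding B_def
  proof (rule sets.sets_Collect_finite_All[OF _ J(1)])
    show "{u \<in> space (\<Pi>\<^sub>M n\<in>(UNIV::nat set). borel). (\<Sum>m<k q. u m) \<in> A q} \<in> sets (\<Pi>\<^sub>M n\<in>(UNIV::nat set). borel)"
      if "q \<in> J" for q
    proof -
      have "(\<lambda>u. \<Sum>m<k q. u m) \<in> borel_measurable (\<Pi>\<^sub>M n\<in>(UNIV::nat set). (borel :: real measure))" by measurable
      from measurable_sets[OF this A[OF that]] show ?thesis by (simp add: vimage_def Int_def conj_commute)
    qed
  qed
  have *: "emeasure (distr M (\<Pi>\<^sub>M q\<in>D. borel) (\<lambda>\<omega>. \<lambda>q\<in>D. W (a + q) \<omega> i - W a \<omega> i))
      (prod_emb D (\<lambda>_. borel) J (Pi\<^sub>E J A)) = emeasure (\<Pi>\<^sub>M n\<in>(UNIV::nat set). density lborel (normal_density 0 (sqrt h))) B"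
    if a: "0 \<le> a" for a
  proof -
    have "W (a + q) \<omega> i - W a \<omega> i = (\<Sum>m<k q. W (a + real (Suc m) * h) \<omega> i - W (a + real m * h) \<omega> i)" if "q \<in> J" for q \<omega>
      using sum_lessThan_telescope[of "\<lambda>m. W (a + real m * h) \<omega> i" "k q"] k[OF that] by (simp add: h_def)
    then have eq: "(\<lambda>\<omega>. \<lambda>q\<in>D. W (a + q) \<omega> i - W a \<omega> i) -` prod_emb D (\<lambda>_. borel) J (Pi\<^sub>E J A) \<inter> space M
        = (\<lambda>\<omega>. \<lambda>n. W (a + real (Suc n) * h) \<omega> i - W (a + real n * h) \<omega> i) -` B \<inter> space M"
      using J(2) by (auto simp: prod_emb_def B_def space_PiM PiE_def Pi_def subset_eq)
    have "(\<lambda>\<omega>. \<lambda>n\<in>UNIV. W (a + real (Suc n) * h) \<omega> i - W (a + real n * h) \<omega> i) \<in> measurable M (\<Pi>\<^sub>M n\<in>UNIV. borel)"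
      using a h by (intro measurable_restrict borel_measurable_diff measurable_W i) auto
    then have m: "(\<lambda>\<omega>. \<lambda>n. W (a + real (Suc n) * h) \<omega> i - W (a + real n * h) \<omega> i) \<in> measurable M (\<Pi>\<^sub>M n\<in>UNIV. borel)"
      unfolding restrict_UNIV .
    have "emeasure (distr M (\<Pi>\<^sub>M q\<in>D. borel) (\<lambda>\<omega>. \<lambda>q\<in>D. W (a + q) \<omega> i - W a \<omega> i))
        (prod_emb D (\<lambda>_. borel) J (Pi\<^sub>E J A)) = emeasure M ((\<lambda>\<omega>. \<lambda>q\<in>D. W (a + q) \<omega> i - W a \<omega> i) -` prod_emb D (\<lambda>_. borel) J (Pi\<^sub>E J A) \<inter> space M)"
      using J A by (intro emeasure_distr measurable_path_increments[OF i a D0] sets_PiM_I) auto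
    also have "\<dots> = emeasure (distr M (\<Pi>\<^sub>M n\<in>UNIV. borel)
        (\<lambda>\<omega>. \<lambda>n. W (a + real (Suc n) * h) \<omega> i - W (a + real n * h) \<omega> i)) B"
      unfolding eq by (rule emeasure_distr[OF m B, symmetric])
    finally show ?thesis unfolding grid_increments_distr[OF i a h] .
  qed
  show "emeasure (distr M (\<Pi>\<^sub>M q\<in>D. borel) (\<lambda>\<omega>. \<lambda>q\<in>D. W (a + q) \<omega> i - W a \<omega> i))
      (prod_emb D (\<lambda>_. borel) J (Pi\<^sub>E J A)) =
    emeasure (distr M (\<Pi>\<^sub>M q\<in>D. borel) (\<lambda>\<omega>. \<lambda>q\<in>D. W (0 + q) \<omega> i - W 0 \<omega> i))
      (prod_emb D (\<lambda>_. borel) J (Pi\<^sub>E J A))"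
    unfolding *[OF a] *[OF order_refl] ..
next
  have D0: "D \<subseteq> {0..}" using dyadic_times_nonneg[OF T] D by simp
  show "finite_measure (distr M (\<Pi>\<^sub>M q\<in>D. borel) (\<lambda>\<omega>. \<lambda>q\<in>D. W (a + q) \<omega> i - W a \<omega> i))"
    by (rule finite_measure_distr[OF measurable_path_increments[OF i a D0]])
qed auto

lemma increments_from_stationary:
  assumes K: "K \<noteq> {}" and a: "0 \<le> a" and T: "0 < T" and D: "D = dyadic_times T b"
  shows "distr M (\<Pi>\<^sub>M i\<in>K. \<Pi>\<^sub>M q\<in>D. borel) (increments_from D a)
    = distr M (\<Pi>\<^sub>M i\<in>K. \<Pi>\<^sub>M q\<in>D. borel) (increments_from D 0)"
proof -
  have D0: "D \<subseteq> {0..}" using dyadic_times_nonneg[OF T] D by simp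
  have *: "distr M (\<Pi>\<^sub>M i\<in>K. \<Pi>\<^sub>M q\<in>D. borel) (increments_from D a)
      = (\<Pi>\<^sub>M i\<in>K. distr M (\<Pi>\<^sub>M q\<in>D. borel) (\<lambda>\<omega>. \<lambda>q\<in>D. W (a + q) \<omega> i - W a \<omega> i))" if a: "0 \<le> a" for a
  proof -
    have "indep_vars (\<lambda>_. path_space) (coord_path W) K"
      using BM unfolding standard_brownian_motion_def by blast
    then have "indep_vars (\<lambda>_. \<Pi>\<^sub>M q\<in>D. borel) (\<lambda>i \<omega>. (\<lambda>u. \<lambda>q\<in>D. u (a + q) - u a) (coord_path W i \<omega>)) K"
    proof (rule indep_vars_compose2)
      show "(\<lambda>u. \<lambda>q\<in>D. u (a + q) - u a) \<in> path_space \<rightarrow>\<^sub>M (\<Pi>\<^sub>M q\<in>D. borel)"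
        using a D0 by (intro measurable_restrict borel_measurable_diff measurable_component_singleton) auto
    qed
    moreover have "(\<lambda>u. \<lambda>q\<in>D. u (a + q) - u a) (coord_path W i \<omega>) = (\<lambda>q\<in>D. W (a + q) \<omega> i - W a \<omega> i)" for i \<omega>
      using a D0 by (auto simp: coord_path_def fun_eq_iff restrict_def)
    ultimately have "indep_vars (\<lambda>_. \<Pi>\<^sub>M q\<in>D. borel) (\<lambda>i \<omega>. \<lambda>q\<in>D. W (a + q) \<omega> i - W a \<omega> i) K"
      by simp
    then show ?thesis
      using indep_vars_iff_distr_eq_PiM'[OF K, where M' = "\<lambda>_. \<Pi>\<^sub>M q\<in>D. borel"
          and X = "\<lambda>i \<omega>. \<lambda>q\<in>D. W (a + q) \<omega> i - W a \<omega> i"]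
        measurable_path_increments[OF _ a D0] unfolding increments_from_def[abs_def] by auto
  qed
  show ?thesis
    unfolding *[OF a] *[OF order_refl]
    by (rule PiM_cong[OF refl]) (rule path_increments_stationary[OF _ a T D])
qed

lemma measurable_increments_from:
  assumes "0 \<le> a" "D \<subseteq> {0..}"
  shows "increments_from D a \<in> measurable M (\<Pi>\<^sub>M i\<in>K. \<Pi>\<^sub>M q\<in>D. borel)"
  unfolding increments_from_def[abs_def]
  by (rule measurable_restrict) (rule measurable_path_increments[OF _ assms])

lemma integral_increments_from:
  fixes f :: "(nat \<Rightarrow> real \<Rightarrow> real) \<Rightarrow> real"
  assumes K: "K \<noteq> {}" and a: "0 \<le> a" and T: "0 < T" and D: "D = dyadic_times T b"
    and f: "f \<in> borel_measurable (\<Pi>\<^sub>M i\<in>K. \<Pi>\<^sub>M q\<in>D. borel)"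
  shows "expectation (\<lambda>\<omega>. f (increments_from D a \<omega>)) = expectation (\<lambda>\<omega>. f (increments_from D 0 \<omega>))"
    and "integrable M (\<lambda>\<omega>. f (increments_from D a \<omega>)) \<longleftrightarrow> integrable M (\<lambda>\<omega>. f (increments_from D 0 \<omega>))"
proof -
  have D0: "D \<subseteq> {0..}" using dyadic_times_nonneg[OF T] D by simp
  note m = measurable_increments_from[OF a D0] measurable_increments_from[OF order_refl D0]
  show "expectation (\<lambda>\<omega>. f (increments_from D a \<omega>)) = expectation (\<lambda>\<omega>. f (increments_from D 0 \<omega>))"
    unfolding integral_distr[OF m(1) f, symmetric] integral_distr[OF m(2) f, symmetric]
      increments_from_stationary[OF K a T D] ..
  show "integrable M (\<lambda>\<omega>. f (increments_from D a \<omega>)) \<longleftrightarrow> integrable M (\<lambda>\<omega>. f (increments_from D 0 \<omega>))"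
    unfolding integrable_distr_eq[OF m(1) f, symmetric] integrable_distr_eq[OF m(2) f, symmetric]
      increments_from_stationary[OF K a T D] ..
qed

end

section \<open>The first coordinate of the reflected process\<close>

text \<open>The drift minus column \<open>j\<close> of \<open>Q\<close> is built in.
  \<open>L_j\<close> holds for a lower triangular factor when \<open>j\<close> is the first index;
  coordinate \<open>j\<close> is then driven by a single Brownian motion.\<close>

locale driven_reflection = brownian_motion M K W
  for M :: "'a measure" and K :: "nat set" and W :: "real \<Rightarrow> 'a \<Rightarrow> nat \<Rightarrow> real" +
  fixes Q L :: "nat \<Rightarrow> nat \<Rightarrow> real" and j :: nat and x0 :: "'a \<Rightarrow> nat \<Rightarrow> real"
    and Z :: "real \<Rightarrow> 'a \<Rightarrow> nat \<Rightarrow> real"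
  assumes finite_K: "finite K" and j: "j \<in> K" and M_matrix: "M_matrix_on K Q"
    and L_j: "\<And>k. k \<in> K \<Longrightarrow> k \<noteq> j \<Longrightarrow> L j k = 0" and L_pos: "0 < L j j"
    and x0_measurable: "(\<lambda>\<omega>. x0 \<omega> j) \<in> borel_measurable M"
    and Z_measurable: "\<And>t. 0 \<le> t \<Longrightarrow> (\<lambda>\<omega>. Z t \<omega> j) \<in> borel_measurable M"
    and reflection: "AE \<omega> in M. is_reflection_of K Q
        (\<lambda>t i. x0 \<omega> i + - Q i j * t + (\<Sum>k\<in>K. L i k * W t \<omega> k)) (\<lambda>t. Z t \<omega>)"
begin

definition driver :: "'a \<Rightarrow> real \<Rightarrow> nat \<Rightarrow> real" where
  "driver \<omega> t i = x0 \<omega> i + - Q i j * t + (\<Sum>k\<in>K. L i k * W t \<omega> k)"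

abbreviation "reflected \<omega> y \<equiv> reflected_path K Q (driver \<omega>) (\<lambda>t. Z t \<omega>) y"

lemma AE_reflected_path:
  "AE \<omega> in M. (\<forall>i\<in>K. W 0 \<omega> i = 0 \<and> continuous_on {0..} (coord \<omega> i)) \<and>
     (\<exists>y. reflected \<omega> y)"
  using AE_continuous reflection
proof eventually_elim
  case (elim \<omega>)
  then have "is_reflection_of K Q (driver \<omega>) (\<lambda>t. Z t \<omega>)" by (simp add: driver_def[abs_def])
  with elim show ?case
    using is_reflection_of_reflected_path[OF finite_K M_matrix] by blast
qed

lemma driver_j: "driver \<omega> t j = x0 \<omega> j - Q j j * t + L j j * W t \<omega> j"
proof -
  have "(\<Sum>k\<in>K. L j k * W t \<omega> k) = L j j * W t \<omega> j + (\<Sum>k\<in>K - {j}. L j k * W t \<omega> k)"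
    using finite_K j by (simp add: sum.remove)
  also have "(\<Sum>k\<in>K - {j}. L j k * W t \<omega> k) = 0" using L_j by (intro sum.neutral) auto
  finally show ?thesis by (simp add: driver_def)
qed

lemma Q_jj_pos: "0 < Q j j"
proof -
  have "AE \<omega> in M. \<exists>y. reflected \<omega> y" using AE_reflected_path by eventually_elim blast
  then obtain \<omega> y where "reflected \<omega> y"
    using eventually_happens'[OF ae_filter_bot] by blast
  then interpret reflected_path K Q "driver \<omega>" "\<lambda>t. Z t \<omega>" y .
  show ?thesis by (rule Q_diag[OF j])
qed

lemma Z_upper_bound:
  assumes t: "0 < t"
  shows "AE \<omega> in M. Z t \<omega> j \<le> max (driver \<omega> t j) (workload_sup (L j j) (Q j j) (coord \<omega> j) t)"
  using AE_reflected_path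
proof eventually_elim
  case (elim \<omega>)
  then obtain y where "reflected \<omega> y" by blast
  then interpret reflected_path K Q "driver \<omega>" "\<lambda>t. Z t \<omega>" y .
  show ?case
  proof (rule coordinate_upper_bound[OF j])
    fix s assume s: "0 \<le> s" "s \<le> t"
    have "continuous_on {0..t} (coord \<omega> j)"
      using elim j by (auto intro: continuous_on_subset)
    from le_workload_sup[OF t less_imp_le[OF Q_jj_pos] this s, of "L j j"]
    show "driver \<omega> t j - driver \<omega> s j \<le> max (driver \<omega> t j) (workload_sup (L j j) (Q j j) (coord \<omega> j) t)"
      unfolding driver_j by (simp add: algebra_simps)
  qed (use t in auto)
qed

lemma AE_Z_nonneg:
  assumes "0 \<le> t"
  shows "AE \<omega> in M. 0 \<le> Z t \<omega> j"
  using AE_reflected_path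
proof eventually_elim
  case (elim \<omega>)
  then obtain y where "reflected \<omega> y" by blast
  then interpret reflected_path K Q "driver \<omega>" "\<lambda>t. Z t \<omega>" y .
  show ?case using nonneg[OF j assms] by simp
qed

text \<open>All regulators of the path are covered, since \<open>y\<close> comes from an existential
  for each outcome and no measurable choice of it is made.\<close>

abbreviation "increment_le_on T t l \<omega> h \<equiv> \<forall>y. reflected \<omega> y \<longrightarrow> y t l - y (t - T) l \<le> h"

abbreviation "Z_bounded_below T t \<omega> h \<equiv>
  \<forall>s. t - T \<le> s \<and> s \<le> t \<longrightarrow> L j j * (W t \<omega> j - W s \<omega> j) - Q j j * (t - s) - h \<le> Z t \<omega> j"

text \<open>The driver restarted at 0, written as a function of Brownian increments alone, so that
  its law can be shifted in time.\<close>

definition free_path :: "(nat \<Rightarrow> real \<Rightarrow> real) \<Rightarrow> real \<Rightarrow> nat \<Rightarrow> real" where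
  "free_path p s k = - Q k j * s + (\<Sum>i\<in>K. L k i * p i s)"

definition zero_regulator :: "real set \<Rightarrow> nat \<Rightarrow> real \<Rightarrow> real \<Rightarrow> 'a \<Rightarrow> real" where
  "zero_regulator D l \<tau> a \<omega> = regulator D K Q (free_path (increments_from D a \<omega>)) \<tau> l"

text \<open>The drift \<open>- Q\<^sub>\<bullet>\<^sub>j\<close> is compensated exactly by letting the \<open>j\<close>-th regulator grow at rate 1, so that
  the regulators of the other coordinates only have to compensate the Brownian fluctuations.\<close>

lemma free_path_regulator_bound:
  assumes D: "D \<subseteq> {0..}" and p: "\<And>i s. i \<in> K \<Longrightarrow> s \<in> D \<Longrightarrow> \<bar>p i s\<bar> \<le> b i"
    and b: "\<And>i. i \<in> K \<Longrightarrow> 0 \<le> b i"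
    and v: "\<And>k. k \<in> K \<Longrightarrow> 0 < v k \<and> 1 \<le> (\<Sum>l\<in>K. Q k l * v l)"
  shows "regulator_bound D K Q (free_path p)
    (\<lambda>s k. kron k j * s + (\<Sum>k\<in>K. \<Sum>i\<in>K. \<bar>L k i\<bar> * b i) * v k)"
proof -
  define c where "c = (\<Sum>k\<in>K. \<Sum>i\<in>K. \<bar>L k i\<bar> * b i)"
  have c: "0 \<le> c" unfolding c_def using b by (intro sum_nonneg) auto
  have le: "\<bar>\<Sum>i\<in>K. L k i * p i s\<bar> \<le> c" if "k \<in> K" "s \<in> D" for k s
  proof -
    have "\<bar>\<Sum>i\<in>K. L k i * p i s\<bar> \<le> (\<Sum>i\<in>K. \<bar>L k i\<bar> * b i)"
      using p[OF _ that(2)] by (intro order_trans[OF sum_abs] sum_mono) (auto simp: abs_mult intro!: mult_left_mono)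
    also have "\<dots> \<le> c" unfolding c_def
      using that finite_K b by (intro member_le_sum[of k K "\<lambda>k. \<Sum>i\<in>K. \<bar>L k i\<bar> * b i"]) (auto intro!: sum_nonneg)
    finally show ?thesis .
  qed
  show ?thesis
    unfolding regulator_bound_def c_def[symmetric]
  proof (intro conjI ballI impI)
    fix k s assume ks: "k \<in> K" "s \<in> D"
    then have s: "0 \<le> s" using D by auto
    show "0 \<le> kron k j * s + c * v k"
      using s c v[OF ks(1)] by (simp add: kron_def)
    have "(\<Sum>l\<in>K. Q k l * (kron l j * s)) = Q k j * s"
      using finite_K j by (simp add: kron_def if_distrib[of "\<lambda>a. a * _"] if_distrib[of "\<lambda>a. _ * a"] cong: if_cong)
    then have "(\<Sum>l\<in>K. Q k l * (kron l j * s + c * v l)) = Q k j * s + c * (\<Sum>l\<in>K. Q k l * v l)"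
      by (simp add: distrib_left sum.distrib sum_distrib_left mult_ac)
    moreover have "c * 1 \<le> c * (\<Sum>l\<in>K. Q k l * v l)" using v[OF ks(1)] c by (intro mult_left_mono) auto
    ultimately show "0 \<le> free_path p s k + (\<Sum>l\<in>K. Q k l * (kron l j * s + c * v l))"
      using le[OF ks] unfolding free_path_def by linarith
  next
    fix k r s assume "k \<in> K" "r \<in> D" "s \<in> D" "r \<le> s"
    then show "kron k j * r + c * v k \<le> kron k j * s + c * v k" by (simp add: kron_def)
  qed
qed

lemma measurable_free_path:
  assumes "s \<in> D" "k \<in> K"
  shows "(\<lambda>p. free_path p s k) \<in> borel_measurable (\<Pi>\<^sub>M i\<in>K. \<Pi>\<^sub>M q\<in>D. borel)"
proof -
  have [measurable]: "(\<lambda>p. p i s :: real) \<in> borel_measurable (\<Pi>\<^sub>M i\<in>K. \<Pi>\<^sub>M q\<in>D. borel)" if "i \<in> K" for i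
    using measurable_compose[OF measurable_component_singleton[OF that, of "\<lambda>_. \<Pi>\<^sub>M q\<in>D. (borel :: real measure)"]
      measurable_component_singleton[OF \<open>s \<in> D\<close>, of "\<lambda>_. borel"]] .
  show ?thesis unfolding free_path_def
    by (intro borel_measurable_add borel_measurable_sum borel_measurable_times borel_measurable_const) auto
qed

lemma measurable_regulator_free_path:
  assumes D: "D = dyadic_times T b" and "l \<in> K"
  shows "(\<lambda>p. regulator D K Q (free_path p) \<tau> l) \<in> borel_measurable (\<Pi>\<^sub>M i\<in>K. \<Pi>\<^sub>M q\<in>D. borel)"
  using countable_dyadic_times[of T b] measurable_free_path \<open>l \<in> K\<close> unfolding D[symmetric]
  by (intro borel_measurable_regulator) auto

section \<open>Increments of one regulator over a window of length \<open>T\<close>\<close>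

context
  fixes T :: real and n :: nat and D :: "real set" and v :: "nat \<Rightarrow> real" and l :: nat
  assumes T: "0 < T" and n: "0 < n" and D: "D = dyadic_times T (n * T)"
    and v: "\<And>k. k \<in> K \<Longrightarrow> 0 < v k \<and> 1 \<le> (\<Sum>l\<in>K. Q k l * v l)"
    and l: "l \<in> K" "l \<noteq> j"
begin

lemma D_nonneg: "D \<subseteq> {0..}"
  using dyadic_times_nonneg[OF T] D by simp

lemma D_max: "real n * T \<in> D" "\<And>s. s \<in> D \<Longrightarrow> s \<le> real n * T"
  using multiple_in_dyadic_times[of n T "n * T"] D by (auto simp: dyadic_times_def)

lemma D_bdd: "\<exists>b\<in>D. \<forall>s\<in>D. s \<le> b"
  using D_max by (intro bexI[of _ "real n * T"]) auto

lemma multiple_in_D: "k \<le> n \<Longrightarrow> real k * T \<in> D"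
  unfolding D using T by (intro multiple_in_dyadic_times) simp

text \<open>As \<open>l \<noteq> j\<close>, the linearly growing term of the supersolution vanishes
  in coordinate \<open>l\<close>, and only the multiple of \<open>v l\<close> remains.\<close>

lemma zero_regulator_le:
  assumes \<mu>: "0 < \<mu>"
  shows "AE \<omega> in M. \<forall>\<tau>\<in>D. 0 \<le> zero_regulator D l \<tau> 0 \<omega> \<and>
    zero_regulator D l \<tau> 0 \<omega> \<le> (\<Sum>k\<in>K. \<Sum>i\<in>K. \<bar>L k i\<bar> * range_bound i \<mu> (n * T) \<omega>) * v l"
  using AE_reflected_path
proof eventually_elim
  case (elim \<omega>)
  then obtain y where "reflected \<omega> y" by blast
  then interpret P: reflected_path K Q "driver \<omega>" "\<lambda>t. Z t \<omega>" y .
  interpret reflection_matrix K Q D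
    using finite_K P.Q_diag P.Q_off_diag D_bdd by unfold_locales
  have nT: "0 < real n * T" using n T by simp
  have bnd: "regulator_bound D K Q (free_path (increments_from D 0 \<omega>))
    (\<lambda>s k. kron k j * s + (\<Sum>k\<in>K. \<Sum>i\<in>K. \<bar>L k i\<bar> * range_bound i \<mu> (n * T) \<omega>) * v k)"
  proof (rule free_path_regulator_bound[OF D_nonneg _ _ v])
    fix i s assume "i \<in> K" "s \<in> D"
    then show "\<bar>increments_from D 0 \<omega> i s\<bar> \<le> range_bound i \<mu> (n * T) \<omega>"
      using elim D_nonneg D_max(2)[of s] abs_le_range_bound[of \<omega> i "real n * T" \<mu> s] nT \<mu>
      by (auto simp: increments_from_def)
  next
    show "0 \<le> range_bound i \<mu> (n * T) \<omega>" for i using range_bound_nonneg \<mu> nT by simp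
  qed
  show ?case
    unfolding zero_regulator_def using regulator_bounds[OF bnd l(1)] l(2) by (simp add: kron_def)
qed

lemma zero_regulator_integrable:
  assumes "\<tau> \<in> D"
  shows "integrable M (zero_regulator D l \<tau> 0)"
proof -
  have nT: "0 < real n * T" using n T by simp
  have "integrable M (\<lambda>\<omega>. (\<Sum>k\<in>K. \<Sum>i\<in>K. \<bar>L k i\<bar> * range_bound i 1 (n * T) \<omega>) * v l)"
    using range_bound_expectation(1)[OF _ nT, of _ 1] by simp
  moreover have "zero_regulator D l \<tau> 0 \<in> borel_measurable M"
    using measurable_compose[OF measurable_increments_from[OF order_refl D_nonneg] measurable_regulator_free_path[OF D l(1)]]
    by (simp add: zero_regulator_def[abs_def])
  ultimately show ?thesis
    by (rule Bochner_Integration.integrable_bound)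
      (use zero_regulator_le[of 1] assms in \<open>auto elim!: eventually_mono\<close>)
qed

lemma zero_regulator_expectation_le:
  assumes \<mu>: "0 < \<mu>"
  shows "expectation (zero_regulator D l (n * T) 0)
    \<le> (\<Sum>k\<in>K. \<Sum>i\<in>K. \<bar>L k i\<bar>) * (2 * \<mu> * (n * T) + 4 / (1 - exp (- (2 * \<mu>)))) * v l"
proof -
  have nT: "0 < real n * T" using n T by simp
  note r = range_bound_expectation[OF _ nT \<mu>]
  have "expectation (zero_regulator D l (n * T) 0)
      \<le> expectation (\<lambda>\<omega>. (\<Sum>k\<in>K. \<Sum>i\<in>K. \<bar>L k i\<bar> * range_bound i \<mu> (n * T) \<omega>) * v l)"
    using zero_regulator_le[OF \<mu>] D_max(1) r(1)
    by (intro integral_mono_AE zero_regulator_integrable) (auto elim!: eventually_mono)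
  also have "\<dots> = (\<Sum>k\<in>K. \<Sum>i\<in>K. \<bar>L k i\<bar> * expectation (range_bound i \<mu> (n * T))) * v l"
    using r(1) by simp
  also have "\<dots> \<le> (\<Sum>k\<in>K. \<Sum>i\<in>K. \<bar>L k i\<bar> * (2 * \<mu> * (n * T) + 4 / (1 - exp (- (2 * \<mu>))))) * v l"
    using r(2) v[OF l(1)] by (intro mult_right_mono sum_mono mult_left_mono) auto
  finally show ?thesis by (simp add: sum_distrib_right)
qed

lemma zero_regulator_stationary:
  assumes "\<tau> \<in> D" "0 \<le> a"
  shows "integrable M (zero_regulator D l \<tau> a)"
    and "expectation (zero_regulator D l \<tau> a) = expectation (zero_regulator D l \<tau> 0)"
  using integral_increments_from[OF _ assms(2) T D measurable_regulator_free_path[OF D l(1), of \<tau>]]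
    zero_regulator_integrable[OF assms(1)] j
  by (auto simp: zero_regulator_def[abs_def])

text \<open>The window \<open>[t - T, t]\<close> is the \<open>k\<close>-th one after a restart at
  time \<open>t - k * T\<close>. Thus one and the same increment has \<open>n\<close> bounds,
  distributed like the increments over \<open>n\<close> successive windows of a process started at
  0.\<close>

lemma increment_le_zero_regulator:
  assumes W: "\<And>i. i \<in> K \<Longrightarrow> W 0 \<omega> i = 0 \<and> continuous_on {0..} (coord \<omega> i)"
    and y: "reflected \<omega> y"
    and k: "1 \<le> k" "k \<le> n" and t: "n * T \<le> t"
  shows "y t l - y (t - T) l \<le> zero_regulator D l (k * T) (t - k * T) \<omega> - zero_regulator D l (real (k - 1) * T) (t - k * T) \<omega>"
proof -
  interpret P: reflected_path K Q "driver \<omega>" "\<lambda>t. Z t \<omega>" y by (rule y)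
  define a where "a = t - k * T"
  have nT: "0 < real n * T" using n T by simp
  have "real k * T \<le> real n * T" using k T by (intro mult_right_mono) auto
  then have a: "0 \<le> a" using t by (simp add: a_def)
  interpret reflection_matrix K Q D
    using finite_K P.Q_diag P.Q_off_diag D_bdd by unfold_locales
  have eq: "driver \<omega> (a + s) i - driver \<omega> a i = free_path (increments_from D a \<omega>) s i" if "s \<in> D" "i \<in> K" for s i
    using that by (simp add: driver_def free_path_def increments_from_def right_diff_distrib sum_subtractf algebra_simps)
  \<comment> \<open>This supersolution serves to make the Picard iterates of the restarted path
    converge, so the crude factor 2, from two values of the path, is harmless.\<close>
  have "regulator_bound D K Q (free_path (increments_from D a \<omega>))
    (\<lambda>s k. kron k j * s + (\<Sum>k\<in>K. \<Sum>i\<in>K. \<bar>L k i\<bar> * (2 * range_bound i 1 (a + n * T) \<omega>)) * v k)"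
  proof (rule free_path_regulator_bound[OF D_nonneg _ _ v])
    fix i s assume i: "i \<in> K" and s: "s \<in> D"
    have "\<bar>W (a + s) \<omega> i\<bar> \<le> range_bound i 1 (a + n * T) \<omega>" "\<bar>W a \<omega> i\<bar> \<le> range_bound i 1 (a + n * T) \<omega>"
      using W[OF i] D_nonneg s D_max(2)[OF s] nT a by (auto intro!: abs_le_range_bound)
    then show "\<bar>increments_from D a \<omega> i s\<bar> \<le> 2 * range_bound i 1 (a + n * T) \<omega>"
      using i s by (simp add: increments_from_def)
  next
    show "0 \<le> 2 * range_bound i 1 (a + n * T) \<omega>" for i using range_bound_nonneg[of 1 "a + n * T"] a nT by simp
  qed
  then have "regulator_bound D K Q (\<lambda>s i. driver \<omega> (a + s) i - driver \<omega> a i)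
    (\<lambda>s k. kron k j * s + (\<Sum>k\<in>K. \<Sum>i\<in>K. \<bar>L k i\<bar> * (2 * range_bound i 1 (a + n * T) \<omega>)) * v k)"
    unfolding regulator_bound_def using eq by simp
  note inc = P.increment_le_restarted_regulator[OF D_nonneg _ _ a this l(1)]
  have "y (a + k * T) l - y (a + real (k - 1) * T) l \<le>
      regulator D K Q (\<lambda>s i. driver \<omega> (a + s) i - driver \<omega> a i) (k * T) l -
      regulator D K Q (\<lambda>s i. driver \<omega> (a + s) i - driver \<omega> a i) (real (k - 1) * T) l"
  proof (rule inc)
    show "\<exists>b\<in>D. \<forall>s\<in>D. s \<le> b" by (rule D_bdd)
    show "\<exists>d\<in>D. r < d \<and> d < e" if "0 \<le> r" "r < e" "e \<le> s" "s \<in> D" for r e s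
      using dyadic_times_dense[OF T that(1-3)] that(4) unfolding D by blast
    show "real (k - 1) * T \<in> D" "real k * T \<in> D" by (rule multiple_in_D, use k in simp)+
    show "real (k - 1) * T \<le> real k * T" using T by (intro mult_right_mono) auto
  qed
  moreover have "a + k * T = t" "a + real (k - 1) * T = t - T" using k by (auto simp: a_def of_nat_diff algebra_simps)
  ultimately show ?thesis
    unfolding zero_regulator_def a_def[symmetric] using regulator_cong[OF eq l(1)] by simp
qed

text \<open>By stationarity the expected increments telescope: their average over \<open>k\<close> is the expectation of
  the regulator at time \<open>n * T\<close>, divided by \<open>n\<close>.\<close>

lemma increment_bound:
  assumes t: "n * T \<le> t" and \<mu>: "0 < \<mu>"
  shows "\<exists>H. integrable M H \<and>
    expectation H \<le> (\<Sum>k\<in>K. \<Sum>i\<in>K. \<bar>L k i\<bar>) * (2 * \<mu> * T + 4 / (1 - exp (- (2 * \<mu>))) / n) * v l \<and>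
    (AE \<omega> in M. increment_le_on T t l \<omega> (H \<omega>))"
proof -
  define d where "d k \<omega> = zero_regulator D l (k * T) (t - k * T) \<omega> - zero_regulator D l (real (k - 1) * T) (t - k * T) \<omega>"
    for k :: nat and \<omega>
  define e where "e k = expectation (zero_regulator D l (real k * T) 0)" for k
  define H where "H \<omega> = (\<Sum>k=1..n. d k \<omega>) / n" for \<omega>
  have a: "0 \<le> t - k * T" if "k \<le> n" for k :: nat
  proof -
    have "real k * T \<le> real n * T" using that T by (intro mult_right_mono) auto
    then show ?thesis using t by simp
  qed
  have kD: "real k * T \<in> D" "real (k - 1) * T \<in> D" if "k \<le> n" for k
    using multiple_in_D[of k] multiple_in_D[of "k - 1"] that by auto
  have di: "integrable M (d k)" and de: "expectation (d k) = e k - e (k - 1)" if "k \<le> n" for k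
    using zero_regulator_stationary[OF kD(1)[OF that] a[OF that]] zero_regulator_stationary[OF kD(2)[OF that] a[OF that]]
    by (auto simp: d_def[abs_def] e_def)
  have "integrable M H" unfolding H_def[abs_def] using di by (intro Bochner_Integration.integrable_divide integrable_sum) auto
  moreover have "expectation H \<le> (\<Sum>k\<in>K. \<Sum>i\<in>K. \<bar>L k i\<bar>) * (2 * \<mu> * T + 4 / (1 - exp (- (2 * \<mu>))) / n) * v l"
  proof -
    have "expectation H = (\<Sum>k=1..n. e k - e (k - 1)) / n"
      unfolding H_def[abs_def] using di de by simp
    also have "(\<Sum>k=1..n. e k - e (k - 1)) = e n - e 0"
      using sum_telescope''[of 0 n e] by simp
    also have "0 \<le> e 0"
      unfolding e_def using zero_regulator_le[of 1] multiple_in_D[of 0]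
      by (intro integral_nonneg_AE) (auto elim!: eventually_mono)
    then have "(e n - e 0) / n \<le> e n / n" by (intro divide_right_mono) auto
    also have "\<dots> \<le> ((\<Sum>k\<in>K. \<Sum>i\<in>K. \<bar>L k i\<bar>) * (2 * \<mu> * (n * T) + 4 / (1 - exp (- (2 * \<mu>)))) * v l) / n"
      unfolding e_def by (intro divide_right_mono zero_regulator_expectation_le[OF \<mu>]) auto
    also have "\<dots> = (\<Sum>k\<in>K. \<Sum>i\<in>K. \<bar>L k i\<bar>) * (2 * \<mu> * T + 4 / (1 - exp (- (2 * \<mu>))) / n) * v l"
      using n by (simp add: add_divide_distrib distrib_left distrib_right)
    finally show ?thesis .
  qed
  moreover have "AE \<omega> in M. increment_le_on T t l \<omega> (H \<omega>)"
    using AE_continuous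
  proof eventually_elim
    case (elim \<omega>)
    show ?case
    proof (intro allI impI)
      fix y assume y: "reflected \<omega> y"
      have "(\<Sum>k=1..n. y t l - y (t - T) l) \<le> (\<Sum>k=1..n. d k \<omega>)"
        unfolding d_def using elim by (intro sum_mono increment_le_zero_regulator[OF _ y _ _ t]) auto
      then show "y t l - y (t - T) l \<le> H \<omega>" using n by (simp add: H_def field_simps)
    qed
  qed
  ultimately show ?thesis by blast
qed

end

end

lemma (in prob_space) prob_greater_tendsto_0:
  fixes X :: "'a \<Rightarrow> real"
  assumes [measurable]: "X \<in> borel_measurable M"
  shows "((\<lambda>u. \<P>(\<omega> in M. u < X \<omega>)) \<longlongrightarrow> 0) at_top"
proof -
  interpret D: real_distribution "distr M borel X" by (rule real_distribution_distr) simp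
  have "\<P>(\<omega> in M. u < X \<omega>) = 1 - cdf (distr M borel X) u" for u
  proof -
    have "{\<omega>\<in>space M. u < X \<omega>} = space M - {\<omega>\<in>space M. X \<omega> \<le> u}" by auto
    moreover have "cdf (distr M borel X) u = \<P>(\<omega> in M. X \<omega> \<le> u)"
      unfolding cdf_def by (subst measure_distr) (auto intro!: arg_cong[where f=prob])
    ultimately show ?thesis using prob_compl[of "{\<omega>\<in>space M. X \<omega> \<le> u}"] by simp
  qed
  moreover have "((\<lambda>u. 1 - cdf (distr M borel X) u) \<longlongrightarrow> 1 - 1) at_top"
    by (intro tendsto_intros D.cdf_lim_at_top_prob)
  ultimately show ?thesis by simp
qed

section \<open>Tail of the first coordinate at large times\<close>

context driven_reflection
begin

lemma Z_lower_bound: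
  assumes T: "0 < T" and \<epsilon>: "0 < \<epsilon>"
  shows "\<exists>t0\<ge>T. \<forall>t\<ge>t0. \<exists>H. integrable M H \<and> (AE \<omega> in M. 0 \<le> H \<omega>) \<and> expectation H \<le> \<epsilon> \<and>
    (AE \<omega> in M. Z_bounded_below T t \<omega> (H \<omega>))"
proof -
  obtain v where v: "\<And>k. k \<in> K \<Longrightarrow> 0 < v k \<and> 1 \<le> (\<Sum>l\<in>K. Q k l * v l)"
    using M_matrix_positive_vector[OF finite_K M_matrix] by blast
  define B where "B \<mu> n l = (\<Sum>k\<in>K. \<Sum>i\<in>K. \<bar>L k i\<bar>) * (2 * \<mu> * T + 4 / (1 - exp (- (2 * \<mu>))) / real n) * v l" for \<mu> n l
  define S where "S \<mu> n = (\<Sum>l\<in>K - {j}. - Q j l * B \<mu> n l)" for \<mu> n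
  \<comment> \<open>\<open>S \<mu> n\<close> bounds the mean pushing over a window. It tends to
    \<open>S0 \<mu>\<close> as \<open>n\<close> grows, and \<open>S0 \<mu>\<close> tends to 0 with
    \<open>\<mu>\<close>; hence \<open>\<mu>\<close> is fixed first, then \<open>n\<close>. The time
    \<open>n * T\<close> makes room for \<open>n\<close> restarts.\<close>
  define S0 where "S0 \<mu> = (\<Sum>l\<in>K - {j}. - Q j l * ((\<Sum>k\<in>K. \<Sum>i\<in>K. \<bar>L k i\<bar>) * (2 * \<mu> * T + 0) * v l))" for \<mu>
  have lim0: "(S0 \<longlongrightarrow> S0 0) (at_right 0)" unfolding S0_def by (intro tendsto_intros)
  have S00: "S0 0 = 0" by (simp add: S0_def)
  have ev0: "eventually (\<lambda>\<mu>. S0 \<mu> < \<epsilon>) (at_right 0)"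
    using lim0 \<epsilon> unfolding S00 by (rule order_tendstoD(2))
  have "eventually (\<lambda>\<mu>. S0 \<mu> < \<epsilon> \<and> 0 < \<mu>) (at_right 0)"
    using ev0 eventually_at_right_less by (rule eventually_conj)
  from eventually_happens'[OF trivial_limit_at_right_real this]
  obtain \<mu> where \<mu>: "0 < \<mu>" "S0 \<mu> < \<epsilon>" by blast
  have "(\<lambda>n. S \<mu> n) \<longlonglongrightarrow> S0 \<mu>" unfolding S_def S0_def B_def
    by (intro tendsto_sum tendsto_mult tendsto_add tendsto_const lim_const_over_n)
  from order_tendstoD(2)[OF this \<mu>(2)] have "eventually (\<lambda>n. S \<mu> n < \<epsilon> \<and> 0 < n) sequentially"
    using eventually_gt_at_top[of 0] by eventually_elim auto
  from eventually_happens'[OF sequentially_bot this]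
  obtain n where n: "0 < n" "S \<mu> n < \<epsilon>" by blast
  show ?thesis
  proof (intro exI[of _ "n * T"] conjI allI impI)
    show "T \<le> n * T" using n T by simp
    fix t assume t: "n * T \<le> t"
    have "1 * T \<le> real n * T" using n T by (intro mult_right_mono) auto
    then have tT: "0 \<le> t - T" using t by simp
    have "\<forall>l\<in>K - {j}. \<exists>H. integrable M H \<and> expectation H \<le> B \<mu> n l \<and>
      (AE \<omega> in M. increment_le_on T t l \<omega> (H \<omega>))"
    proof
      fix l assume "l \<in> K - {j}"
      then have l: "l \<in> K" "l \<noteq> j" by auto
      show "\<exists>H. integrable M H \<and> expectation H \<le> B \<mu> n l \<and>
        (AE \<omega> in M. increment_le_on T t l \<omega> (H \<omega>))"
        unfolding B_def by (rule increment_bound[OF T n(1) refl v l t \<mu>(1)])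
    qed
    from bchoice[OF this] obtain H where H: "\<And>l. l \<in> K - {j} \<Longrightarrow> integrable M (H l)" "\<And>l. l \<in> K - {j} \<Longrightarrow> expectation (H l) \<le> B \<mu> n l"
      "\<And>l. l \<in> K - {j} \<Longrightarrow> AE \<omega> in M. increment_le_on T t l \<omega> (H l \<omega>)"
      by blast
    define G where "G \<omega> = (\<Sum>l\<in>K - {j}. - Q j l * H l \<omega>)" for \<omega>
    have off: "0 \<le> - Q j l" if "l \<in> K - {j}" for l using M_matrix_off_diagonal[OF M_matrix j, of l] that by auto
    have AEH: "AE \<omega> in M. \<forall>l\<in>K - {j}. increment_le_on T t l \<omega> (H l \<omega>)"
      using H(3) finite_K by (intro AE_finite_allI) auto
    have push: "AE \<omega> in M. \<exists>y. reflected \<omega> y \<and>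
        reflected_path.pushing K Q y j t - reflected_path.pushing K Q y j (t - T) \<le> G \<omega>"
      using AEH AE_reflected_path
    proof eventually_elim
      case (elim \<omega>)
      then obtain y where y: "reflected \<omega> y" by blast
      then interpret reflected_path K Q "driver \<omega>" "\<lambda>t. Z t \<omega>" y .
      have "pushing j t - pushing j (t - T) = (\<Sum>l\<in>K - {j}. - Q j l * (y t l - y (t - T) l))"
        unfolding pushing_def sum_subtractf[symmetric] by (simp add: right_diff_distrib)
      also have "\<dots> \<le> G \<omega>"
        unfolding G_def using elim(1) y off by (intro sum_mono mult_left_mono) auto
      finally show ?case using y by blast
    qed
    show "\<exists>H. integrable M H \<and> (AE \<omega> in M. 0 \<le> H \<omega>) \<and> expectation H \<le> \<epsilon> \<and>
      (AE \<omega> in M. Z_bounded_below T t \<omega> (H \<omega>))"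
    proof (intro exI[of _ G] conjI)
      show "integrable M G" unfolding G_def[abs_def] using H(1)
        by (intro Bochner_Integration.integrable_sum Bochner_Integration.integrable_mult_right) auto
      have "expectation G = (\<Sum>l\<in>K - {j}. - Q j l * expectation (H l))"
        unfolding G_def using H(1) by (subst Bochner_Integration.integral_sum) auto
      also have "\<dots> \<le> S \<mu> n" unfolding S_def using H(2) off by (intro sum_mono mult_left_mono) auto
      finally show "expectation G \<le> \<epsilon>" using n(2) by simp
      show "AE \<omega> in M. 0 \<le> G \<omega>"
        using push
      proof eventually_elim
        case (elim \<omega>)
        then obtain y where y: "reflected \<omega> y"
          and le: "reflected_path.pushing K Q y j t - reflected_path.pushing K Q y j (t - T) \<le> G \<omega>" by blast
        interpret reflected_path K Q "driver \<omega>" "\<lambda>t. Z t \<omega>" y by (rule y)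
        show ?case using pushing_mono[OF j tT, of t] T le by simp
      qed
      show "AE \<omega> in M. Z_bounded_below T t \<omega> (G \<omega>)"
        using push
      proof eventually_elim
        case (elim \<omega>)
        then obtain y where y: "reflected \<omega> y"
          and le: "reflected_path.pushing K Q y j t - reflected_path.pushing K Q y j (t - T) \<le> G \<omega>" by blast
        interpret reflected_path K Q "driver \<omega>" "\<lambda>t. Z t \<omega>" y by (rule y)
        show ?case
        proof (intro allI impI)
          fix s assume "t - T \<le> s \<and> s \<le> t"
          then have "driver \<omega> t j - driver \<omega> s j - (pushing j t - pushing j (t - T)) \<le> Z t \<omega> j"
            using coordinate_lower_bound[OF j tT, of s t] by simp
          moreover have "driver \<omega> t j - driver \<omega> s j = L j j * (W t \<omega> j - W s \<omega> j) - Q j j * (t - s)"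
            unfolding driver_j by (simp add: algebra_simps)
          ultimately show "L j j * (W t \<omega> j - W s \<omega> j) - Q j j * (t - s) - G \<omega> \<le> Z t \<omega> j"
            using le by linarith
        qed
      qed
    qed
  qed
qed

lemma tail_upper:
  assumes \<theta>: "\<theta> = 2 * Q j j / (L j j)\<^sup>2" and x: "0 \<le> x" and u: "exp (- \<theta> * x) < u"
  shows "\<forall>\<^sub>F t in at_top. \<P>(\<omega> in M. x < Z t \<omega> j) < u"
proof -
  define q where "q = Q j j"
  define \<sigma> where "\<sigma> = L j j"
  have q: "0 < q" and \<sigma>: "0 < \<sigma>" using Q_jj_pos L_pos by (simp_all add: q_def \<sigma>_def)
  have \<theta>': "\<theta> = 2 * q / \<sigma>\<^sup>2" using \<theta> by (simp add: q_def \<sigma>_def)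
  \<comment> \<open>Half of the drift is spent on comparing the driver with a workload of drift
    \<open>q / 2\<close>. The other half is split again: the driver can exceed
    \<open>x \<ge> 0\<close> only if the initial state or that workload exceeds
    \<open>q * t / 4\<close>, and both probabilities vanish.\<close>
  define b where "b t = exp (- \<theta> * x) + (\<P>(\<omega> in M. t * (q / 4) < x0 \<omega> j) + exp (- (q / \<sigma>\<^sup>2) * (q / 4 * t)))" for t
  have le: "\<P>(\<omega> in M. x < Z t \<omega> j) \<le> b t" if t: "0 < t" for t
  proof -
    let ?W = "\<lambda>\<omega> t. W t \<omega> j"
    have [measurable]: "(\<lambda>\<omega>. x0 \<omega> j) \<in> borel_measurable M" "(\<lambda>\<omega>. Z t \<omega> j) \<in> borel_measurable M"
      "(\<lambda>\<omega>. workload_sup \<sigma> q (?W \<omega>) t) \<in> borel_measurable M"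
      "(\<lambda>\<omega>. workload_sup \<sigma> (q / 2) (?W \<omega>) t) \<in> borel_measurable M"
      using x0_measurable Z_measurable measurable_workload_sup[OF j] t by auto
    define A1 where "A1 = {\<omega>\<in>space M. x < workload_sup \<sigma> q (?W \<omega>) t}"
    define A2 where "A2 = {\<omega>\<in>space M. t * (q / 4) < x0 \<omega> j}"
    define A3 where "A3 = {\<omega>\<in>space M. q / 4 * t < workload_sup \<sigma> (q / 2) (?W \<omega>) t}"
    have [measurable]: "A1 \<in> sets M" "A2 \<in> sets M" "A3 \<in> sets M" unfolding A1_def A2_def A3_def by measurable
    have "\<P>(\<omega> in M. x < Z t \<omega> j) \<le> prob (A1 \<union> (A2 \<union> A3))"
    proof (rule finite_measure_mono_AE)
      show "AE \<omega> in M. \<omega> \<in> {\<omega>\<in>space M. x < Z t \<omega> j} \<longrightarrow> \<omega> \<in> A1 \<union> (A2 \<union> A3)"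
        using Z_upper_bound[OF t] AE_continuous AE_space
      proof eventually_elim
        case (elim \<omega>)
        have "continuous_on {0..t} (?W \<omega>)" "W 0 \<omega> j = 0"
          using elim(2) j by (auto intro: continuous_on_subset)
        with le_workload_sup[OF t _ this(1), of "q / 2" 0 \<sigma>] q t
        have "\<sigma> * W t \<omega> j - q / 2 * t \<le> workload_sup \<sigma> (q / 2) (?W \<omega>) t" by simp
        then have "driver \<omega> t j \<le> x0 \<omega> j - q * t / 2 + workload_sup \<sigma> (q / 2) (?W \<omega>) t"
          unfolding driver_j q_def[symmetric] \<sigma>_def[symmetric] by (simp add: field_simps)
        with elim(1,3) x show ?case
          unfolding A1_def A2_def A3_def q_def[symmetric] \<sigma>_def[symmetric] by (auto simp: field_simps)
      qed
    qed measurable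
    also have "\<dots> \<le> prob A1 + (prob A2 + prob A3)"
      by (intro order_trans[OF measure_Un_le] add_left_mono measure_Un_le) measurable
    also have "prob A1 \<le> exp (- \<theta> * x)"
      unfolding A1_def \<theta>' using \<sigma> q x by (intro workload_sup_tail[OF j t]) auto
    also have "prob A3 \<le> exp (- (2 * (q / 2) / \<sigma>\<^sup>2) * (q / 4 * t))"
      unfolding A3_def using \<sigma> q t by (intro workload_sup_tail[OF j t]) auto
    finally show ?thesis unfolding b_def A2_def by simp
  qed
  have "(b \<longlongrightarrow> exp (- \<theta> * x) + (0 + 0)) at_top"
    unfolding b_def
  proof (intro tendsto_intros)
    have "filterlim (\<lambda>t. t * (q / 4)) at_top at_top" using q by real_asymp
    from filterlim_compose[OF prob_greater_tendsto_0[OF x0_measurable] this]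
    show "((\<lambda>t. \<P>(\<omega> in M. t * (q / 4) < x0 \<omega> j)) \<longlongrightarrow> 0) at_top" .
    define c where "c = q / \<sigma>\<^sup>2 * (q / 4)"
    have "0 < c" using q \<sigma> by (simp add: c_def)
    then have "((\<lambda>t. exp (- (c * t))) \<longlongrightarrow> 0) at_top" by real_asymp
    then show "((\<lambda>t. exp (- (q / \<sigma>\<^sup>2) * (q / 4 * t))) \<longlongrightarrow> 0) at_top" by (simp add: c_def mult.assoc)
  qed
  then have "\<forall>\<^sub>F t in at_top. b t < u" using u by (intro order_tendstoD(2)) auto
  with eventually_gt_at_top[of 0] show ?thesis
    by eventually_elim (use le in \<open>auto intro: le_less_trans\<close>)
qed

lemma tail_lower:
  assumes \<theta>: "\<theta> = 2 * Q j j / (L j j)\<^sup>2" and x: "0 \<le> x" and u: "u < exp (- \<theta> * x)"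
  shows "\<forall>\<^sub>F t in at_top. u < \<P>(\<omega> in M. x < Z t \<omega> j)"
proof -
  define q where "q = Q j j"
  define \<sigma> where "\<sigma> = L j j"
  have q: "0 < q" and \<sigma>: "0 < \<sigma>" using Q_jj_pos L_pos by (simp_all add: q_def \<sigma>_def)
  have \<theta>': "\<theta> = 2 * q / \<sigma>\<^sup>2" using \<theta> by (simp add: q_def \<sigma>_def)
  have \<theta>0: "0 < \<theta>" using q \<sigma> by (simp add: \<theta>')
  have "((\<lambda>\<delta>. exp (- \<theta> * \<delta>) * exp (- \<theta> * (x + \<delta>))) \<longlongrightarrow> exp (- \<theta> * 0) * exp (- \<theta> * (x + 0))) (at_right 0)"
    by (intro tendsto_intros)
  moreover have "u < exp (- \<theta> * 0) * exp (- \<theta> * (x + 0))" using u by simp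
  ultimately have ev0: "eventually (\<lambda>\<delta>. u < exp (- \<theta> * \<delta>) * exp (- \<theta> * (x + \<delta>))) (at_right 0)"
    by (rule order_tendstoD(1))
  have "eventually (\<lambda>\<delta>. u < exp (- \<theta> * \<delta>) * exp (- \<theta> * (x + \<delta>)) \<and> 0 < \<delta>) (at_right 0)"
    using ev0 eventually_at_right_less by (rule eventually_conj)
  from eventually_happens'[OF trivial_limit_at_right_real this]
  obtain \<delta> where \<delta>: "0 < \<delta>" "u < exp (- \<theta> * \<delta>) * exp (- \<theta> * (x + \<delta>))" by blast
  \<comment> \<open>A quarter of the gap: at most \<open>\<tau>\<close> each is lost to the start at
    0, to the overshoot and to the event \<open>\<delta> \<le> H\<close>, which leaves a strict
    inequality. The order of choices is \<open>\<delta>\<close>, \<open>T\<close>, \<open>n\<close>,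
    \<open>t0\<close>.\<close>
  define \<tau> where "\<tau> = (exp (- \<theta> * \<delta>) * exp (- \<theta> * (x + \<delta>)) - u) / 4"
  have \<tau>: "0 < \<tau>" using \<delta> by (simp add: \<tau>_def)
  define c where "c = q\<^sup>2 / (2 * \<sigma>\<^sup>2)"
  have "0 < c" using q \<sigma> by (simp add: c_def)
  then have "((\<lambda>T. exp (- (c * T))) \<longlongrightarrow> 0) at_top" by real_asymp
  then have ev1: "eventually (\<lambda>T. exp (- (c * T)) < \<tau>) at_top" using \<tau> by (rule order_tendstoD(2))
  have "eventually (\<lambda>T. exp (- (c * T)) < \<tau> \<and> 0 < T) at_top"
    using ev1 eventually_gt_at_top by (rule eventually_conj)
  from eventually_happens'[OF _ this] obtain T where "0 < T" "exp (- (c * T)) < \<tau>" by auto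
  then have T: "0 < T" "exp (- (q\<^sup>2 * T / (2 * \<sigma>\<^sup>2))) < \<tau>" by (simp_all add: c_def)
  define h where "h n = T / real n" for n :: nat
  define \<eta> where "\<eta> n = exp (- \<delta> / sqrt (h n)) * exp (((\<theta> + 1 / sqrt (h n))\<^sup>2 * \<sigma>\<^sup>2 / 2 - (\<theta> + 1 / sqrt (h n)) * q) * h n)" for n
  have "(\<lambda>n. real n * \<eta> n) \<longlonglongrightarrow> 0"
    unfolding \<eta>_def h_def by (rule overshoot_vanishes[OF T(1) \<delta>(1)])
  then have ev2: "eventually (\<lambda>n. real n * \<eta> n < \<tau>) sequentially" using \<tau> by (rule order_tendstoD(2))
  have "eventually (\<lambda>n. real n * \<eta> n < \<tau> \<and> 0 < n) sequentially"
    using ev2 eventually_gt_at_top by (rule eventually_conj)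
  from eventually_happens'[OF sequentially_bot this]
  obtain n where n: "0 < n" "real n * \<eta> n < \<tau>" by blast
  \<comment> \<open>Markov's inequality turns the mean bound \<open>\<delta> * \<tau>\<close> into
    probability at most \<open>\<tau>\<close> for \<open>\<delta> \<le> H\<close>.\<close>
  obtain t0 where t0: "T \<le> t0" "\<And>t. t0 \<le> t \<Longrightarrow> \<exists>H. integrable M H \<and> (AE \<omega> in M. 0 \<le> H \<omega>) \<and> expectation H \<le> \<delta> * \<tau> \<and>
    (AE \<omega> in M. \<forall>s. t - T \<le> s \<and> s \<le> t \<longrightarrow> \<sigma> * (W t \<omega> j - W s \<omega> j) - q * (t - s) - H \<omega> \<le> Z t \<omega> j)"
    using Z_lower_bound[OF T(1), of "\<delta> * \<tau>"] \<delta> \<tau> unfolding q_def \<sigma>_def by auto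
  show ?thesis
    unfolding eventually_at_top_linorder
  proof (intro exI[of _ t0] allI impI)
    fix t assume t: "t0 \<le> t"
    then have tT: "T \<le> t" using t0(1) by simp
    obtain H where H: "integrable M H" "AE \<omega> in M. 0 \<le> H \<omega>" "expectation H \<le> \<delta> * \<tau>"
      "AE \<omega> in M. \<forall>s. t - T \<le> s \<and> s \<le> t \<longrightarrow> \<sigma> * (W t \<omega> j - W s \<omega> j) - q * (t - s) - H \<omega> \<le> Z t \<omega> j"
      using t0(2)[OF t] by blast
    let ?R = "\<lambda>\<omega>. lindley (grid_increment \<sigma> q (coord \<omega> j) (t - T) (h n)) n"
    have h0: "0 < h n" using T n by (simp add: h_def)
    have [measurable]: "?R \<in> borel_measurable M" "(\<lambda>\<omega>. Z t \<omega> j) \<in> borel_measurable M" "H \<in> borel_measurable M"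
      using measurable_grid_lindley[OF j, of "t - T" "h n"] h0 tT Z_measurable[of t] T(1) H(1) by auto
    define E where "E = exp (- \<theta> * \<delta>) * exp (- \<theta> * (x + \<delta>))"
    have "E - 2 * \<tau> \<le> exp (- \<theta> * \<delta>) * ((1 - n * \<eta> n) * exp (- \<theta> * (x + \<delta>))
        - exp (- (q\<^sup>2 * T / (2 * \<sigma>\<^sup>2))) * exp (- (\<theta> / 2) * (x + \<delta>)))"
    proof -
      have 1: "exp (- \<theta> * \<delta>) \<le> 1" "exp (- \<theta> * (x + \<delta>)) \<le> 1" "exp (- (\<theta> / 2) * (x + \<delta>)) \<le> 1"
        using \<theta>0 \<delta> x by (auto simp: mult_nonneg_nonneg)
      have 2: "exp (- \<theta> * \<delta>) * exp (- \<theta> * (x + \<delta>)) * (n * \<eta> n) \<le> 1 * (n * \<eta> n)"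
        using 1 by (intro mult_right_mono mult_le_one) (auto simp: \<eta>_def)
      have 3: "exp (- \<theta> * \<delta>) * exp (- (\<theta> / 2) * (x + \<delta>)) * exp (- (q\<^sup>2 * T / (2 * \<sigma>\<^sup>2))) \<le> 1 * exp (- (q\<^sup>2 * T / (2 * \<sigma>\<^sup>2)))"
        using 1 by (intro mult_right_mono mult_le_one) auto
      have "exp (- \<theta> * \<delta>) * ((1 - n * \<eta> n) * exp (- \<theta> * (x + \<delta>))
        - exp (- (q\<^sup>2 * T / (2 * \<sigma>\<^sup>2))) * exp (- (\<theta> / 2) * (x + \<delta>))) =
        E - exp (- \<theta> * \<delta>) * exp (- \<theta> * (x + \<delta>)) * (n * \<eta> n)
          - exp (- \<theta> * \<delta>) * exp (- (\<theta> / 2) * (x + \<delta>)) * exp (- (q\<^sup>2 * T / (2 * \<sigma>\<^sup>2)))"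
        unfolding E_def by (simp only: algebra_simps)
      with 2 3 n(2) T(2) show ?thesis by linarith
    qed
    also have "\<dots> \<le> \<P>(\<omega> in M. x + \<delta> < ?R \<omega>)"
      using grid_lindley_tail_ge[OF j T(1) tT _ q \<delta>(1) _ n(1) \<theta>' h_def \<eta>_def, of "x + \<delta>"] \<sigma> x \<delta> by simp
    \<comment> \<open>The level \<open>x + \<delta>\<close> leaves room for \<open>H\<close>, as the
      workload over the window is at most \<open>Z t \<omega> j + H \<omega>\<close>.\<close>
    also have "\<dots> \<le> prob ({\<omega>\<in>space M. x < Z t \<omega> j} \<union> {\<omega>\<in>space M. \<delta> \<le> H \<omega>})"
    proof (rule finite_measure_mono_AE)
      show "AE \<omega> in M. \<omega> \<in> {\<omega>\<in>space M. x + \<delta> < ?R \<omega>} \<longrightarrow> \<omega> \<in> {\<omega>\<in>space M. x < Z t \<omega> j} \<union> {\<omega>\<in>space M. \<delta> \<le> H \<omega>}"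
        using H(4) H(2) AE_Z_nonneg[of t]
      proof (rule AE_mp[OF AE_conjI[OF _ AE_conjI]], goal_cases)
        case 1
        show ?case using tT T by simp
      next
        case 2
        show ?case
        proof (intro AE_I2 impI)
          fix \<omega> assume \<omega>: "\<omega> \<in> space M" "(\<forall>s. t - T \<le> s \<and> s \<le> t \<longrightarrow> \<sigma> * (W t \<omega> j - W s \<omega> j) - q * (t - s) - H \<omega> \<le> Z t \<omega> j)
              \<and> 0 \<le> H \<omega> \<and> 0 \<le> Z t \<omega> j" "\<omega> \<in> {\<omega>\<in>space M. x + \<delta> < ?R \<omega>}"
          have end_point: "t - T + real n * h n = t" using n by (simp add: h_def)
          have "?R \<omega> \<le> Z t \<omega> j + H \<omega>"
          proof (rule lindley_grid_increment_le)
            fix m assume m: "m \<le> n"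
            define s where "s = t - T + real m * h n"
            have "real m * h n \<le> real n * h n" using m h0 by (intro mult_right_mono) auto
            then have s: "t - T \<le> s" "s \<le> t" using h0 end_point by (auto simp: s_def)
            have "(real n - real m) * h n = t - s" using end_point by (simp add: s_def left_diff_distrib)
            then show "\<sigma> * (W (t - T + real n * h n) \<omega> j - W (t - T + real m * h n) \<omega> j) - q * ((real n - real m) * h n)
                \<le> Z t \<omega> j + H \<omega>"
              using \<omega>(2) s unfolding end_point s_def[symmetric] by (metis diff_le_eq)
          qed (use \<omega> in auto)
          with \<omega> show "\<omega> \<in> {\<omega>\<in>space M. x < Z t \<omega> j} \<union> {\<omega>\<in>space M. \<delta> \<le> H \<omega>}" by auto
        qed
      qed
    qed measurable
    also have "\<dots> \<le> \<P>(\<omega> in M. x < Z t \<omega> j) + \<P>(\<omega> in M. \<delta> \<le> H \<omega>)"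
      by (rule measure_Un_le) measurable
    also have "\<P>(\<omega> in M. \<delta> \<le> H \<omega>) \<le> expectation H / \<delta>"
      using integral_Markov_inequality_measure[OF H(1) sets.empty_sets H(2) \<delta>(1)] by simp
    also have "\<dots> \<le> \<tau>" using H(3) \<delta>(1) by (simp add: field_simps)
    finally show "u < \<P>(\<omega> in M. x < Z t \<omega> j)"
      using \<tau> by (simp add: E_def \<tau>_def field_simps)
  qed
qed

lemma tail_limit:
  assumes "\<theta> = 2 * Q j j / (L j j)\<^sup>2" "0 \<le> x"
  shows "((\<lambda>t. \<P>(\<omega> in M. x < Z t \<omega> j)) \<longlongrightarrow> exp (- \<theta> * x)) at_top"
  using tail_upper[OF assms] tail_lower[OF assms] by (intro order_tendstoI) auto

end

section \<open>Joint weak convergence\<close>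

text \<open>Points of \<open>euclidean_on K\<close> are extensional functions. Restriction to
  \<open>K\<close> and padding by 0 lead through functions on all of \<open>nat\<close>, where the
  Borel and the product sigma-algebra agree since the index set is countable.\<close>

lemma borel_measurable_euclidean_on:
  fixes f :: "(nat \<Rightarrow> real) \<Rightarrow> real"
  assumes f: "continuous_map (euclidean_on K) euclideanreal f"
  shows "f \<in> borel_measurable (\<Pi>\<^sub>M i\<in>K. borel)"
proof -
  define g where "g x = f (restrict x K)" for x :: "nat \<Rightarrow> real"
  have "continuous_map (product_topology (\<lambda>i. euclideanreal) UNIV) (euclidean_on K) (\<lambda>x. restrict x K)"
    unfolding euclidean_on_def by (auto simp: continuous_map_componentwise intro!: continuous_map_product_projection)
  from continuous_map_compose[OF this f] have "continuous_map euclidean euclideanreal g"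
    unfolding euclidean_product_topology by (simp add: g_def comp_def)
  then have "g \<in> borel_measurable borel" by (intro borel_measurable_continuous_onI) simp
  moreover have "(\<lambda>x i. if i \<in> K then x i else 0) \<in> measurable (\<Pi>\<^sub>M i\<in>K. borel) (\<Pi>\<^sub>M i\<in>(UNIV :: nat set). (borel :: real measure))"
  proof (rule measurable_PiM_single')
    fix i :: nat
    show "(\<lambda>x. if i \<in> K then x i else 0) \<in> (\<Pi>\<^sub>M i\<in>K. borel) \<rightarrow>\<^sub>M (borel :: real measure)"
      by (cases "i \<in> K") auto
  qed auto
  then have "(\<lambda>x i. if i \<in> K then x i else 0) \<in> borel_measurable (\<Pi>\<^sub>M i\<in>K. (borel :: real measure))"
    using measurable_cong_sets[OF refl sets_PiM_equal_borel[where ?'b = real]] by blast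
  ultimately have "(\<lambda>x. g (\<lambda>i. if i \<in> K then x i else 0)) \<in> borel_measurable (\<Pi>\<^sub>M i\<in>K. borel)"
    by (rule measurable_compose[rotated])
  moreover have "g (\<lambda>i. if i \<in> K then x i else 0) = f x" if "x \<in> space (\<Pi>\<^sub>M i\<in>K. (borel :: real measure))" for x
  proof -
    have "restrict (\<lambda>i. if i \<in> K then x i else 0) K = x"
      using that by (auto simp: space_PiM PiE_def extensional_def fun_eq_iff)
    then show ?thesis by (simp add: g_def)
  qed
  ultimately show ?thesis by (simp cong: measurable_cong)
qed

lemma distr_PiM_components:
  fixes g :: "'i \<Rightarrow> 'a \<Rightarrow> real"
  assumes N: "\<And>i. i \<in> K \<Longrightarrow> prob_space (N i)" and g: "\<And>i. i \<in> K \<Longrightarrow> g i \<in> borel_measurable (N i)"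
  shows "distr (\<Pi>\<^sub>M i\<in>K. N i) (\<Pi>\<^sub>M i\<in>K. borel) (\<lambda>\<omega>. \<lambda>i\<in>K. g i (\<omega> i)) = (\<Pi>\<^sub>M i\<in>K. distr (N i) borel (g i))"
proof (rule measure_eqI_PiM_infinite)
  have m: "(\<lambda>\<omega>. \<lambda>i\<in>K. g i (\<omega> i)) \<in> measurable (\<Pi>\<^sub>M i\<in>K. N i) (\<Pi>\<^sub>M i\<in>K. borel)"
    using g by (intro measurable_restrict) (auto intro: measurable_compose[OF measurable_component_singleton])
  have P: "prob_space (\<Pi>\<^sub>M i\<in>K. N i)" by (rule prob_space_PiM) (rule N)
  show "finite_measure (distr (\<Pi>\<^sub>M i\<in>K. N i) (\<Pi>\<^sub>M i\<in>K. borel) (\<lambda>\<omega>. \<lambda>i\<in>K. g i (\<omega> i)))"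
    using prob_space.prob_space_distr[OF P m] by (simp add: prob_space_def)
  fix A :: "'i \<Rightarrow> real set" and J assume J: "finite J" "J \<subseteq> K" and A: "\<And>i. i \<in> J \<Longrightarrow> A i \<in> sets borel"
  have eq: "(\<lambda>\<omega>. \<lambda>i\<in>K. g i (\<omega> i)) -` prod_emb K (\<lambda>_. borel) J (Pi\<^sub>E J A) \<inter> space (\<Pi>\<^sub>M i\<in>K. N i)
      = prod_emb K N J (\<Pi>\<^sub>E i\<in>J. g i -` A i \<inter> space (N i))"
    using J(2) by (auto simp: prod_emb_def space_PiM PiE_def Pi_def subset_eq)
  have gA: "g i -` A i \<inter> space (N i) \<in> sets (N i)" if "i \<in> J" for i
    using measurable_sets[OF g A] that J by auto
  have "emeasure (distr (\<Pi>\<^sub>M i\<in>K. N i) (\<Pi>\<^sub>M i\<in>K. borel) (\<lambda>\<omega>. \<lambda>i\<in>K. g i (\<omega> i))) (prod_emb K (\<lambda>_. borel) J (Pi\<^sub>E J A))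
      = emeasure (\<Pi>\<^sub>M i\<in>K. N i) (prod_emb K N J (\<Pi>\<^sub>E i\<in>J. g i -` A i \<inter> space (N i)))"
    unfolding eq[symmetric] using J A by (intro emeasure_distr m sets_PiM_I) auto
  also have "\<dots> = (\<Prod>i\<in>J. emeasure (N i) (g i -` A i \<inter> space (N i)))"
    using N J gA by (intro emeasure_PiM_emb) auto
  also have "\<dots> = (\<Prod>i\<in>J. emeasure (distr (N i) borel (g i)) (A i))"
    using J A g by (intro prod.cong refl emeasure_distr[symmetric]) auto
  also have "\<dots> = emeasure (\<Pi>\<^sub>M i\<in>K. distr (N i) borel (g i)) (prod_emb K (\<lambda>i. distr (N i) borel (g i)) J (Pi\<^sub>E J A))"
    using N J A g by (intro emeasure_PiM_emb[symmetric]) (auto intro: prob_space.prob_space_distr)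
  also have "prod_emb K (\<lambda>i. distr (N i) borel (g i)) J (Pi\<^sub>E J A) = prod_emb K (\<lambda>_. borel) J (Pi\<^sub>E J A)"
    by (simp add: prod_emb_def)
  finally show "emeasure (distr (\<Pi>\<^sub>M i\<in>K. N i) (\<Pi>\<^sub>M i\<in>K. borel) (\<lambda>\<omega>. \<lambda>i\<in>K. g i (\<omega> i))) (prod_emb K (\<lambda>_. borel) J (Pi\<^sub>E J A))
    = emeasure (\<Pi>\<^sub>M i\<in>K. distr (N i) borel (g i)) (prod_emb K (\<lambda>_. borel) J (Pi\<^sub>E J A))" .
qed (auto intro!: sets_PiM_cong)

text \<open>Each marginal sequence is realized on a space of its own. On the product of these spaces
  the coordinates are independent and converge pointwise, so dominated convergence applies to
  \<open>f\<close>.\<close>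

lemma weak_convergence_PiM:
  fixes \<mu> :: "nat \<Rightarrow> nat \<Rightarrow> real measure" and f :: "(nat \<Rightarrow> real) \<Rightarrow> real"
  assumes K: "finite K"
    and \<mu>: "\<And>n i. i \<in> K \<Longrightarrow> real_distribution (\<mu> i n)" and \<nu>: "\<And>i. i \<in> K \<Longrightarrow> real_distribution (\<nu> i)"
    and conv: "\<And>i. i \<in> K \<Longrightarrow> weak_conv_m (\<mu> i) (\<nu> i)"
    and f: "continuous_map (euclidean_on K) euclideanreal f" "bounded (f ` topspace (euclidean_on K))"
  shows "(\<lambda>n. \<integral>x. f x \<partial>(\<Pi>\<^sub>M i\<in>K. \<mu> i n)) \<longlonglongrightarrow> (\<integral>x. f x \<partial>(\<Pi>\<^sub>M i\<in>K. \<nu> i))"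
proof -
  have "\<forall>i\<in>K. \<exists>(\<Omega> :: real measure) (Ys :: nat \<Rightarrow> real \<Rightarrow> real) (Y :: real \<Rightarrow> real).
    prob_space \<Omega> \<and> (\<forall>n. Ys n \<in> measurable \<Omega> borel) \<and> (\<forall>n. distr \<Omega> borel (Ys n) = \<mu> i n) \<and>
    Y \<in> measurable \<Omega> lborel \<and> distr \<Omega> borel Y = \<nu> i \<and> (\<forall>x \<in> space \<Omega>. (\<lambda>n. Ys n x) \<longlonglongrightarrow> Y x)"
    by (intro ballI Skorohod[OF \<mu> \<nu> conv])
  then obtain \<Omega> :: "nat \<Rightarrow> real measure" and Ys :: "nat \<Rightarrow> nat \<Rightarrow> real \<Rightarrow> real" and Y :: "nat \<Rightarrow> real \<Rightarrow> real"
    where *: "\<forall>i\<in>K. prob_space (\<Omega> i) \<and> (\<forall>n. Ys i n \<in> measurable (\<Omega> i) borel) \<and> (\<forall>n. distr (\<Omega> i) borel (Ys i n) = \<mu> i n) \<and>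
      Y i \<in> measurable (\<Omega> i) lborel \<and> distr (\<Omega> i) borel (Y i) = \<nu> i \<and> (\<forall>x \<in> space (\<Omega> i). (\<lambda>n. Ys i n x) \<longlonglongrightarrow> Y i x)"
    unfolding bchoice_iff by (elim exE)
  then have \<Omega>: "\<And>i. i \<in> K \<Longrightarrow> prob_space (\<Omega> i)"
    and Ys: "\<And>i n. i \<in> K \<Longrightarrow> Ys i n \<in> borel_measurable (\<Omega> i)" "\<And>i n. i \<in> K \<Longrightarrow> distr (\<Omega> i) borel (Ys i n) = \<mu> i n"
    and Y: "\<And>i. i \<in> K \<Longrightarrow> Y i \<in> measurable (\<Omega> i) lborel" "\<And>i. i \<in> K \<Longrightarrow> distr (\<Omega> i) borel (Y i) = \<nu> i"
    and lim: "\<And>i x. i \<in> K \<Longrightarrow> x \<in> space (\<Omega> i) \<Longrightarrow> (\<lambda>n. Ys i n x) \<longlonglongrightarrow> Y i x"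
    by blast+
  let ?\<Omega> = "\<Pi>\<^sub>M i\<in>K. \<Omega> i"
  interpret \<Omega>: prob_space ?\<Omega> by (rule prob_space_PiM) (rule \<Omega>)
  have fm: "f \<in> borel_measurable (\<Pi>\<^sub>M i\<in>K. borel)" by (rule borel_measurable_euclidean_on[OF f(1)])
  have Ym: "Y i \<in> borel_measurable (\<Omega> i)" if "i \<in> K" for i using Y(1)[OF that] by simp
  have m: "(\<lambda>\<omega>. \<lambda>i\<in>K. g i (\<omega> i)) \<in> measurable ?\<Omega> (\<Pi>\<^sub>M i\<in>K. borel)"
    if "\<And>i. i \<in> K \<Longrightarrow> g i \<in> borel_measurable (\<Omega> i)" for g :: "nat \<Rightarrow> real \<Rightarrow> real"
    using that by (intro measurable_restrict) (auto intro: measurable_compose[OF measurable_component_singleton])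
  have \<mu>_eq: "(\<integral>x. f x \<partial>(\<Pi>\<^sub>M i\<in>K. \<mu> i n)) = (\<integral>\<omega>. f (\<lambda>i\<in>K. Ys i n (\<omega> i)) \<partial>?\<Omega>)" for n
  proof -
    have "(\<Pi>\<^sub>M i\<in>K. \<mu> i n) = distr ?\<Omega> (\<Pi>\<^sub>M i\<in>K. borel) (\<lambda>\<omega>. \<lambda>i\<in>K. Ys i n (\<omega> i))"
      using distr_PiM_components[OF \<Omega> Ys(1), of K "\<lambda>i. i" "\<lambda>_. n"] Ys(2) by (simp cong: PiM_cong)
    then show ?thesis using integral_distr[OF m[OF Ys(1)] fm] by simp
  qed
  have \<nu>_eq: "(\<integral>x. f x \<partial>(\<Pi>\<^sub>M i\<in>K. \<nu> i)) = (\<integral>\<omega>. f (\<lambda>i\<in>K. Y i (\<omega> i)) \<partial>?\<Omega>)"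
  proof -
    have "(\<Pi>\<^sub>M i\<in>K. \<nu> i) = distr ?\<Omega> (\<Pi>\<^sub>M i\<in>K. borel) (\<lambda>\<omega>. \<lambda>i\<in>K. Y i (\<omega> i))"
      using distr_PiM_components[OF \<Omega> Ym, of K "\<lambda>i. i"] Y(2) by (simp cong: PiM_cong)
    then show ?thesis using integral_distr[OF m[OF Ym] fm] by simp
  qed
  obtain C where C: "\<And>x. x \<in> topspace (euclidean_on K) \<Longrightarrow> norm (f x) \<le> C"
    using f(2) unfolding bounded_iff by auto
  have top: "(\<lambda>i\<in>K. u i) \<in> topspace (euclidean_on K)" for u :: "nat \<Rightarrow> real"
    by (simp add: euclidean_on_def)
  show ?thesis
    unfolding \<mu>_eq \<nu>_eq
  proof (rule integral_dominated_convergence[where w = "\<lambda>_. C"])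
    show "(\<lambda>\<omega>. f (\<lambda>i\<in>K. Y i (\<omega> i))) \<in> borel_measurable ?\<Omega>"
      by (rule measurable_compose[OF m[OF Ym] fm])
    show "(\<lambda>\<omega>. f (\<lambda>i\<in>K. Ys i n (\<omega> i))) \<in> borel_measurable ?\<Omega>" for n
      by (rule measurable_compose[OF m[OF Ys(1)] fm])
    show "AE \<omega> in ?\<Omega>. (\<lambda>n. f (\<lambda>i\<in>K. Ys i n (\<omega> i))) \<longlonglongrightarrow> f (\<lambda>i\<in>K. Y i (\<omega> i))"
    proof (rule AE_I2)
      fix \<omega> assume \<omega>: "\<omega> \<in> space ?\<Omega>"
      have "limitin (euclidean_on K) (\<lambda>n. \<lambda>i\<in>K. Ys i n (\<omega> i)) (\<lambda>i\<in>K. Y i (\<omega> i)) sequentially"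
        using \<omega> lim unfolding euclidean_on_def limitin_componentwise
        by (auto simp: space_PiM PiE_iff)
      from continuous_map_limit[OF f(1) this]
      show "(\<lambda>n. f (\<lambda>i\<in>K. Ys i n (\<omega> i))) \<longlonglongrightarrow> f (\<lambda>i\<in>K. Y i (\<omega> i))" by (simp add: comp_def)
    qed
    show "AE \<omega> in ?\<Omega>. norm (f (\<lambda>i\<in>K. Ys i n (\<omega> i))) \<le> C" for n using C[OF top] by simp
  qed simp
qed

section \<open>Exponential limit laws\<close>

lemma exponential_law_tail:
  assumes "0 < m"
  shows "prob_space (exponential_law m)"
    and "0 \<le> x \<Longrightarrow> measure (exponential_law m) {x<..} = exp (- x / m)"
proof -
  show P: "prob_space (exponential_law m)"
    unfolding exponential_law_def using assms by (intro prob_space_exponential_density) simp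
  interpret prob_space "exponential_law m" by (rule P)
  have D: "distributed (exponential_law m) lborel (\<lambda>x. x) (exponential_density (1 / m))"
    unfolding distributed_def exponential_law_def using assms
    by (auto simp: distr_id2 exponential_density_nonneg)
  show "measure (exponential_law m) {x<..} = exp (- x / m)" if "0 \<le> x"
    using exponential_distributedD_gt[OF D that] assms
    by (simp add: exponential_law_def greaterThan_def)
qed

lemma exponential_law_weak_conv:
  assumes m: "0 < m" and \<mu>: "\<And>n. real_distribution (\<mu> n)"
    and tail: "\<And>x. 0 \<le> x \<Longrightarrow> (\<lambda>n. measure (\<mu> n) {x<..}) \<longlonglongrightarrow> exp (- x / m)"
  shows "real_distribution (exponential_law m)" "weak_conv_m \<mu> (exponential_law m)"
proof -
  interpret E: prob_space "exponential_law m" by (rule exponential_law_tail(1)[OF m])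
  show "real_distribution (exponential_law m)"
    by unfold_locales (auto simp: exponential_law_def)
  then interpret E: real_distribution "exponential_law m" .
  have cdf: "cdf N x = 1 - measure N {x<..}" if "real_distribution N" for N x
  proof -
    interpret N: real_distribution N by fact
    have "{x<..} = space N - {..x}" by auto
    then show ?thesis using N.prob_compl[of "{..x}"] by (simp add: cdf_def)
  qed
  have lim: "(\<lambda>n. measure (\<mu> n) {x<..}) \<longlonglongrightarrow> measure (exponential_law m) {x<..}" for x
  proof (cases "0 \<le> x")
    case True
    then show ?thesis using tail exponential_law_tail(2)[OF m] by simp
  next
    case False
    \<comment> \<open>The tail at 0 tends to 1, which leaves no mass on the negative half-line in
      the limit.\<close>
    have sub: "{0<..} \<subseteq> {x<..}" using False by auto
    have "1 \<le> measure (exponential_law m) {x<..}"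
      using E.finite_measure_mono[OF sub] exponential_law_tail(2)[OF m, of 0] by simp
    then have "measure (exponential_law m) {x<..} = 1" by (simp add: antisym)
    moreover have "(\<lambda>n. measure (\<mu> n) {x<..}) \<longlonglongrightarrow> 1"
    proof (rule tendsto_sandwich[OF _ _ _ tendsto_const])
      show "(\<lambda>n. measure (\<mu> n) {0<..}) \<longlonglongrightarrow> 1" using tail[of 0] by simp
      have "measure (\<mu> n) {0<..} \<le> measure (\<mu> n) {x<..} \<and> measure (\<mu> n) {x<..} \<le> 1" for n
      proof -
        interpret N: real_distribution "\<mu> n" by (rule \<mu>)
        show ?thesis using N.finite_measure_mono[OF sub] by simp
      qed
      then show "\<forall>\<^sub>F n in sequentially. measure (\<mu> n) {0<..} \<le> measure (\<mu> n) {x<..}"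
        "\<forall>\<^sub>F n in sequentially. measure (\<mu> n) {x<..} \<le> 1" by auto
    qed
    ultimately show ?thesis by simp
  qed
  show "weak_conv_m \<mu> (exponential_law m)"
    unfolding weak_conv_m_def weak_conv_def cdf[OF \<mu>] cdf[OF E.real_distribution_axioms]
    by (intro allI impI tendsto_intros lim)
qed

lemma (in prob_space) independent_exponential_limit:
  fixes X :: "real \<Rightarrow> 'a \<Rightarrow> nat \<Rightarrow> real"
  assumes K: "finite K" "K \<noteq> {}" and m: "\<And>j. j \<in> K \<Longrightarrow> 0 < m j"
    and X: "\<And>t j. 0 \<le> t \<Longrightarrow> j \<in> K \<Longrightarrow> (\<lambda>\<omega>. X t \<omega> j) \<in> borel_measurable M"
    and indep: "\<And>t. 0 \<le> t \<Longrightarrow> indep_vars (\<lambda>_. borel) (\<lambda>j \<omega>. X t \<omega> j) K"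
    and tail: "\<And>j x. j \<in> K \<Longrightarrow> 0 \<le> x \<Longrightarrow> ((\<lambda>t. \<P>(\<omega> in M. x < X t \<omega> j)) \<longlongrightarrow> exp (- x / m j)) at_top"
  shows "converges_in_distribution (euclidean_on K) at_top M (\<lambda>t \<omega>. \<lambda>j\<in>K. X t \<omega> j)
    (\<Pi>\<^sub>M j\<in>K. exponential_law (m j)) (\<lambda>\<zeta>. \<zeta>)"
  unfolding converges_in_distribution_def
proof (intro allI impI)
  fix f :: "(nat \<Rightarrow> real) \<Rightarrow> real"
  assume f: "continuous_map (euclidean_on K) euclideanreal f \<and> bounded (f ` topspace (euclidean_on K))"
  have fm: "f \<in> borel_measurable (\<Pi>\<^sub>M i\<in>K. borel)" using borel_measurable_euclidean_on f by blast
  show "((\<lambda>t. \<integral>\<omega>. f (\<lambda>j\<in>K. X t \<omega> j) \<partial>M) \<longlongrightarrow> (\<integral>\<omega>. f \<omega> \<partial>(\<Pi>\<^sub>M j\<in>K. exponential_law (m j)))) at_top"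
  proof (rule tendsto_at_topI_sequentially)
    fix s :: "nat \<Rightarrow> real" assume s: "filterlim s at_top sequentially"
    \<comment> \<open>Measurability and independence are available at nonnegative times; the
      truncation changes only finitely many terms of the sequence.\<close>
    define t where "t n = max 0 (s n)" for n
    have ev: "\<forall>\<^sub>F n in sequentially. t n = s n"
      using filterlim_at_top[THEN iffD1, OF s, rule_format, of 0] by eventually_elim (simp add: t_def)
    have t0: "0 \<le> t n" for n by (simp add: t_def)
    have "filterlim t at_top sequentially"
      using filterlim_cong[OF refl refl ev] s by simp
    note tail_t = filterlim_compose[OF tail this]
    define \<mu> where "\<mu> j n = distr M borel (\<lambda>\<omega>. X (t n) \<omega> j)" for j n
    have \<mu>: "real_distribution (\<mu> j n)" if "j \<in> K" for j n
      unfolding \<mu>_def by (rule real_distribution_distr) (rule X[OF t0 that])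
    have \<mu>_tail: "measure (\<mu> j n) {x<..} = \<P>(\<omega> in M. x < X (t n) \<omega> j)" if "j \<in> K" for j n x
      unfolding \<mu>_def using X[OF t0 that] by (subst measure_distr) (auto intro!: arg_cong[where f=prob])
    have W: "real_distribution (exponential_law (m j))" "weak_conv_m (\<mu> j) (exponential_law (m j))" if "j \<in> K" for j
      using exponential_law_weak_conv[OF m[OF that], of "\<mu> j", OF \<mu>[OF that]] tail_t[OF that]
      by (auto simp: \<mu>_tail[OF that])
    have eq: "(\<integral>\<omega>. f (\<lambda>j\<in>K. X (t n) \<omega> j) \<partial>M) = (\<integral>x. f x \<partial>(\<Pi>\<^sub>M j\<in>K. \<mu> j n))" for n
    proof -
      have "distr M (\<Pi>\<^sub>M j\<in>K. borel) (\<lambda>\<omega>. \<lambda>j\<in>K. X (t n) \<omega> j) = (\<Pi>\<^sub>M j\<in>K. \<mu> j n)"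
        unfolding \<mu>_def using indep_vars_iff_distr_eq_PiM'[OF K(2), where M' = "\<lambda>_. borel" and X = "\<lambda>j \<omega>. X (t n) \<omega> j"]
          X[OF t0] indep[OF t0] by blast
      moreover have "(\<lambda>\<omega>. \<lambda>j\<in>K. X (t n) \<omega> j) \<in> measurable M (\<Pi>\<^sub>M j\<in>K. borel)"
        by (intro measurable_restrict X[OF t0])
      ultimately show ?thesis using integral_distr[of "\<lambda>\<omega>. \<lambda>j\<in>K. X (t n) \<omega> j" M "\<Pi>\<^sub>M j\<in>K. borel" f] fm by simp
    qed
    have "(\<lambda>n. \<integral>\<omega>. f (\<lambda>j\<in>K. X (t n) \<omega> j) \<partial>M) \<longlonglongrightarrow> (\<integral>\<omega>. f \<omega> \<partial>(\<Pi>\<^sub>M j\<in>K. exponential_law (m j)))"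
      unfolding eq using f by (intro weak_convergence_PiM K \<mu> W) auto
    then show "(\<lambda>n. \<integral>\<omega>. f (\<lambda>j\<in>K. X (s n) \<omega> j) \<partial>M) \<longlonglongrightarrow> (\<integral>\<omega>. f \<omega> \<partial>(\<Pi>\<^sub>M j\<in>K. exponential_law (m j)))"
      by (rule Lim_transform_eventually) (use ev in eventually_elim, simp)
  qed
qed

section \<open>The limit process\<close>

lemma E_mat_eq_u_vec: "E_mat P j j = u_vec P j"
  by (rule ext) (simp add: E_mat_def u_vec_def w_coeff_def Let_def kron_def)

text \<open>Row \<open>j\<close> of \<open>E_mat P j\<close> vanishes beyond the diagonal, so only
  rows of \<open>R_mat P\<close> up to \<open>j\<close> contribute. What remains is the formula for
  \<open>w_coeff\<close> with the two sums exchanged.\<close>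

lemma G_mat_diag_eq:
  assumes "1 \<le> j" "j \<le> J"
  shows "G_mat J P j j j = 1 - w_coeff P j j"
proof -
  define Ri where "Ri = inverse_on {1..<j} (R_mat P)"
  have "{1..J} = {1..<j} \<union> {j} \<union> {j<..J}" using assms by auto
  moreover have "(\<Sum>l\<in>{1..<j} \<union> {j} \<union> {j<..J}. E_mat P j j l * R_mat P l j)
      = (\<Sum>l\<in>{1..<j}. E_mat P j j l * R_mat P l j) + R_mat P j j"
    by (subst sum.union_disjoint; force simp: E_mat_def kron_def)+
  ultimately have "G_mat J P j j j = (\<Sum>l\<in>{1..<j}. E_mat P j j l * R_mat P l j) + R_mat P j j"
    unfolding G_mat_def mat_mult_on_def by simp
  also have "(\<Sum>l\<in>{1..<j}. E_mat P j j l * R_mat P l j)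
      = - (\<Sum>l\<in>{1..<j}. \<Sum>m\<in>{1..<j}. R_mat P j m * Ri m l * R_mat P l j)"
    by (simp add: E_mat_def Ri_def sum_negf sum_distrib_right)
  also have "(\<Sum>l\<in>{1..<j}. \<Sum>m\<in>{1..<j}. R_mat P j m * Ri m l * R_mat P l j)
      = (\<Sum>m\<in>{1..<j}. \<Sum>l\<in>{1..<j}. R_mat P j m * Ri m l * R_mat P l j)"
    by (rule sum.swap)
  finally show ?thesis by (simp add: w_coeff_def Let_def Ri_def)
qed

lemma transformed_covariance_diag:
  "transformed_covariance J P \<Gamma> j j j = quad_form_on {1..J} \<Gamma> (E_mat P j j)"
  unfolding transformed_covariance_def mat_mult_on_def quad_form_on_def
  by (simp add: sum_distrib_right) (rule sum.swap)

text \<open>In the block \<open>{j..J}\<close> the index \<open>j\<close> comes first, so row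
  \<open>j\<close> of the Cholesky factor has a single nonzero entry and \<open>\<Sigma> j j\<close>
  is its square. The rate is twice the drift over the variance, as for one-dimensional reflected
  Brownian motion.\<close>

lemma SRBM_first_coordinate_tail:
  assumes SRBM: "is_SRBM M {j..J} \<nu> (\<lambda>i. - Q i j) \<Sigma> Q Z" and j: "j \<le> J" and x: "0 \<le> x"
  shows "0 < Q j j"
    and "((\<lambda>t. measure M {\<omega>\<in>space M. x < Z t \<omega> j}) \<longlongrightarrow> exp (- (2 * Q j j / \<Sigma> j j) * x)) at_top"
proof -
  from SRBM obtain x0 W L where
    Z: "\<forall>t\<ge>0. \<forall>i\<in>{j..J}. (\<lambda>\<omega>. Z t \<omega> i) \<in> borel_measurable M" and Q: "M_matrix_on {j..J} Q"
    and x0: "x0 \<in> measurable M (borel_on {j..J})" and L: "is_cholesky_factor_on {j..J} \<Sigma> L"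
    and W: "standard_brownian_motion M {j..J} W"
    and reflected: "AE \<omega> in M. is_reflection_of {j..J} Q
           (\<lambda>t i. x0 \<omega> i + - Q i j * t + (\<Sum>k\<in>{j..J}. L i k * W t \<omega> k)) (\<lambda>t. Z t \<omega>)"
    unfolding is_SRBM_def by blast
  have L0: "L j k = 0" if "k \<in> {j..J}" "k \<noteq> j" for k
    using L j that unfolding is_cholesky_factor_on_def by auto
  have L1: "0 < L j j" using L j unfolding is_cholesky_factor_on_def by auto
  have "\<Sigma> j j = (\<Sum>l\<in>{j..J}. L j l * L j l)" using L j unfolding is_cholesky_factor_on_def by auto
  also have "\<dots> = L j j * L j j + (\<Sum>l\<in>{j..J} - {j}. L j l * L j l)" using j by (intro sum.remove) auto
  also have "(\<Sum>l\<in>{j..J} - {j}. L j l * L j l) = 0" using L0 by (intro sum.neutral) auto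
  finally have \<Sigma>: "\<Sigma> j j = (L j j)\<^sup>2" by (simp add: power2_eq_square)
  interpret driven_reflection M "{j..J}" W Q L j x0 Z
  proof unfold_locales
    show "(\<lambda>\<omega>. x0 \<omega> j) \<in> borel_measurable M"
      using measurable_compose[OF x0[unfolded borel_on_def] measurable_component_singleton[of j "{j..J}"]] j by simp
    show "(\<lambda>\<omega>. Z t \<omega> j) \<in> borel_measurable M" if "0 \<le> t" for t using Z j that by auto
  qed (use j W Q L0 L1 reflected in auto)
  show "0 < Q j j" by (rule Q_jj_pos)
  show "((\<lambda>t. measure M {\<omega>\<in>space M. x < Z t \<omega> j}) \<longlongrightarrow> exp (- (2 * Q j j / \<Sigma> j j) * x)) at_top"
    unfolding \<Sigma> by (rule tail_limit[OF refl x])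
qed

theorem proposition4:
  fixes M :: "'a measure" and S :: "'b measure" and X :: "'c measure" and N :: "nat \<Rightarrow> 'd measure"
    and J :: nat
    and \<alpha> lam :: "nat \<Rightarrow> real" and P \<Gamma> :: "nat \<Rightarrow> nat \<Rightarrow> real"
    and \<mu> :: "real \<Rightarrow> nat \<Rightarrow> real" and \<gamma> :: "nat \<Rightarrow> real \<Rightarrow> real" and \<epsilon> :: real
    and Te Ts :: "nat \<Rightarrow> nat \<Rightarrow> 'a \<Rightarrow> real" and \<phi> :: "nat \<Rightarrow> nat \<Rightarrow> 'a \<Rightarrow> nat \<Rightarrow> real"
    and Z0 :: "real \<Rightarrow> nat \<Rightarrow> 'a \<Rightarrow> nat" and Z :: "real \<Rightarrow> real \<Rightarrow> 'a \<Rightarrow> nat \<Rightarrow> real"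
    and \<xi> :: "'c \<Rightarrow> nat \<Rightarrow> real"
    and Zstar :: "real \<Rightarrow> 'b \<Rightarrow> nat \<Rightarrow> real" and V :: "nat \<Rightarrow> real \<Rightarrow> 'd \<Rightarrow> nat \<Rightarrow> real"
    and m :: "nat \<Rightarrow> real"
  assumes network:
      "\<And>r. r \<in> {0<..<1} \<Longrightarrow> generalized_jackson_network M J \<alpha> P (\<mu> r) Te Ts \<phi> (Z0 r)"
    and queue_length:
      "\<And>r. r \<in> {0<..<1} \<Longrightarrow> is_queue_length_process M J \<alpha> (\<mu> r) Te Ts \<phi> (Z0 r) (Z r)"
    and traffic: "\<And>j. j \<in> {1..J} \<Longrightarrow> lam j = \<alpha> j + (\<Sum>i=1..J. lam i * P i j)"
    and \<epsilon>: "0 < \<epsilon>" "\<epsilon> < 1"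
    and interarrival_moment:
      "\<And>j. j \<in> {1..J} \<Longrightarrow> 0 < \<alpha> j \<Longrightarrow> integrable M (\<lambda>\<omega>. Te j 1 \<omega> powr (2 + \<epsilon>))"
    and service_moment:
      "\<And>j. j \<in> {1..J} \<Longrightarrow> integrable M (\<lambda>\<omega>. Ts j 1 \<omega> powr (2 + \<epsilon>))"
    and heavy_traffic: "multi_scale_heavy_traffic J \<epsilon> lam \<gamma> \<mu>"
    and \<xi>_space: "prob_space X"
    and \<xi>_measurable: "\<And>j. j \<in> {1..J} \<Longrightarrow> (\<lambda>\<omega>. \<xi> \<omega> j) \<in> borel_measurable X"
    and \<xi>_nonneg: "\<And>j \<omega>. j \<in> {1..J} \<Longrightarrow> \<omega> \<in> space X \<Longrightarrow> 0 \<le> \<xi> \<omega> j"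
    and initial_condition:
      "converges_in_distribution (euclidean_on {1..J}) (at_right 0)
         M (\<lambda>r \<omega>. \<lambda>j\<in>{1..J}. \<gamma> 1 r * real (Z0 r j \<omega>))
         X (\<lambda>\<omega>. \<lambda>j\<in>{1..J}. \<xi> \<omega> j)"
    and \<Gamma>: "\<Gamma> = network_covariance J \<alpha> lam P
               (\<lambda>j. prob_space.variance M (Te j 1)) (\<lambda>j. prob_space.variance M (Ts j 1))"
    and \<Gamma>_positive_definite: "positive_definite_on {1..J} \<Gamma>"
    and limit_space: "prob_space S"
    and limit_process: "cadlag_process S {1..J} Zstar"
    and weak_limit:
      "converges_in_distribution (skorokhod_topology {1..J}) (at_right 0)
         M (\<lambda>r \<omega>. \<lambda>t j. \<gamma> j r * Z r (t / (\<gamma> j r)\<^sup>2) \<omega> j)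
         S (\<lambda>\<omega>. \<lambda>t. Zstar t \<omega>)"
    and limit_independent:
      "prob_space.indep_vars S (\<lambda>_. path_space) (coord_path Zstar) {1..J}"
    and limit_SRBM:
      "\<And>j. j \<in> {1..J} \<Longrightarrow>
         is_SRBM (N j) {j..J} (initial_law J X \<xi> j)
           (\<lambda>i. - G_mat J P j i j) (transformed_covariance J P \<Gamma> j) (G_mat J P j) (V j)"
    and limit_coordinate:
      "\<And>j. j \<in> {1..J} \<Longrightarrow>
         distr S path_space (coord_path Zstar j) = distr (N j) path_space (coord_path (V j) j)"
    and m: "\<And>j. j \<in> {1..J} \<Longrightarrow>
         m j = quad_form_on {1..J} \<Gamma> (E_mat P j j) / (2 * G_mat J P j j j)"
  shows "(\<forall>j\<in>{1..J}. 0 < m j \<and>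
            m j = quad_form_on {1..J} \<Gamma> (u_vec P j) / (2 * (1 - w_coeff P j j))) \<and>
         converges_in_distribution (euclidean_on {1..J}) at_top
           S (\<lambda>t \<omega>. \<lambda>j\<in>{1..J}. Zstar t \<omega> j)
           (Pi\<^sub>M {1..J} (\<lambda>j. exponential_law (m j))) (\<lambda>\<zeta>. \<zeta>)"
proof -
  interpret S: prob_space S by (rule limit_space)
  \<comment> \<open>Any \<open>r\<close> in the unit interval yields \<open>J \<ge> 1\<close>, so
    that the index set of the limit law is nonempty.\<close>
  have "generalized_jackson_network M J \<alpha> P (\<mu> (1 / 2)) Te Ts \<phi> (Z0 (1 / 2))" by (rule network) simp
  then have J: "1 \<le> J" by (rule generalized_jackson_network.J_pos)
  have G: "0 < G_mat J P j j j" if "j \<in> {1..J}" for j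
    using SRBM_first_coordinate_tail(1)[OF limit_SRBM[OF that]] that by auto
  have quad: "0 < quad_form_on {1..J} \<Gamma> (E_mat P j j)" if "j \<in> {1..J}" for j
  proof -
    \<comment> \<open>The diagonal entry is 1, so row \<open>j\<close> is a nonzero vector and
      positive definiteness applies to it.\<close>
    have "E_mat P j j j \<noteq> 0" by (simp add: E_mat_def kron_def)
    with that \<Gamma>_positive_definite show ?thesis unfolding positive_definite_on_def by blast
  qed
  have m_pos: "0 < m j" if "j \<in> {1..J}" for j
    using G[OF that] quad[OF that] m[OF that] by simp
  have m_u: "m j = quad_form_on {1..J} \<Gamma> (u_vec P j) / (2 * (1 - w_coeff P j j))" if "j \<in> {1..J}" for j
    using m[OF that] G_mat_diag_eq[of j J P] that by (simp add: E_mat_eq_u_vec)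
  have tail: "((\<lambda>t. measure S {\<omega>\<in>space S. x < Zstar t \<omega> j}) \<longlongrightarrow> exp (- x / m j)) at_top"
    if j: "j \<in> {1..J}" and x: "0 \<le> x" for j x
  proof -
    have "- (2 * G_mat J P j j j / transformed_covariance J P \<Gamma> j j j) * x = - x / m j"
      unfolding transformed_covariance_diag m[OF j] using quad[OF j] G[OF j] by (simp add: field_simps)
    then have lim: "((\<lambda>t. measure (N j) {\<omega>\<in>space (N j). x < V j t \<omega> j}) \<longlongrightarrow> exp (- x / m j)) at_top"
      using SRBM_first_coordinate_tail(2)[OF limit_SRBM[OF j] _ x] j by simp
    have "measure (N j) {\<omega>\<in>space (N j). x < V j t \<omega> j} = measure S {\<omega>\<in>space S. x < Zstar t \<omega> j}"
      if t: "0 \<le> t" for t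
    proof -
      \<comment> \<open>The equality of laws on path space is used through evaluation at the single
        time \<open>t\<close>.\<close>
      define A where "A = {u \<in> space path_space. x < u t}"
      have "(\<lambda>u. u t) \<in> borel_measurable path_space" using t by (intro measurable_component_singleton) simp
      from measurable_sets[OF this, of "{x<..}"] have A: "A \<in> sets path_space"
        by (simp add: A_def vimage_def Int_def conj_commute)
      have V: "coord_path (V j) j \<in> measurable (N j) path_space"
        using limit_SRBM[OF j] j unfolding coord_path_def is_SRBM_def by (intro measurable_restrict) auto
      have Zm: "coord_path Zstar j \<in> measurable S path_space"
        using limit_process j unfolding coord_path_def cadlag_process_def by (intro measurable_restrict) auto
      have "measure (N j) {\<omega>\<in>space (N j). x < V j t \<omega> j} = measure (distr (N j) path_space (coord_path (V j) j)) A"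
        unfolding measure_distr[OF V A] using t
        by (intro arg_cong[where f="measure (N j)"]) (auto simp: A_def coord_path_def space_PiM)
      also have "\<dots> = measure (distr S path_space (coord_path Zstar j)) A" by (simp add: limit_coordinate[OF j])
      also have "\<dots> = measure S {\<omega>\<in>space S. x < Zstar t \<omega> j}"
        unfolding measure_distr[OF Zm A] using t
        by (intro arg_cong[where f="measure S"]) (auto simp: A_def coord_path_def space_PiM)
      finally show ?thesis .
    qed
    then have "\<forall>\<^sub>F t in at_top. measure (N j) {\<omega>\<in>space (N j). x < V j t \<omega> j} = measure S {\<omega>\<in>space S. x < Zstar t \<omega> j}"
      by (intro eventually_mono[OF eventually_ge_at_top[of 0]])
    from Lim_transform_eventually[OF lim this] show ?thesis .
  qed
  have "converges_in_distribution (euclidean_on {1..J}) at_top S (\<lambda>t \<omega>. \<lambda>j\<in>{1..J}. Zstar t \<omega> j)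
    (\<Pi>\<^sub>M j\<in>{1..J}. exponential_law (m j)) (\<lambda>\<zeta>. \<zeta>)"
  proof (rule S.independent_exponential_limit)
    fix t :: real assume t: "0 \<le> t"
    show "(\<lambda>\<omega>. Zstar t \<omega> j) \<in> borel_measurable S" if "j \<in> {1..J}" for j
      using limit_process t that unfolding cadlag_process_def by auto
    have "S.indep_vars (\<lambda>_. borel) (\<lambda>j \<omega>. coord_path Zstar j \<omega> t) {1..J}"
      by (rule S.indep_vars_compose2[OF limit_independent, where Y = "\<lambda>_ u. u t"]) (use t in auto)
    then show "S.indep_vars (\<lambda>_. borel) (\<lambda>j \<omega>. Zstar t \<omega> j) {1..J}"
      using t by (simp add: coord_path_def)
  qed (use J m_pos tail in auto)
  then show ?thesis using m_pos m_u by blast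
qed

end
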